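(* Let $T$ be a complete simple theory and let $(q_w(x_w))_{w\in W}$ be an amalgamation system over an algebraically closed set of parameters $C$ such that for every $w\in W$: if $a_w$ realizes $q_w$, then $\operatorname{acl}(C a_w)=\operatorname{dcl}(C a_w)$, and for every $v\in W$ with $v\subseteq w$, $\operatorname{acl}(C a_v)\cap a_w=a_v$ (where $a_v=a_w\upharpoonright x_v$). Then there exists an algebraically closed amalgamation system $(s_w(y_w))_{w\in W}$ over $C$ such that for all $w\in W$: $x_w\subseteq y_w$ and $s_w(y_w)\upharpoonright x_w=q_w(x_w)$, and every realization $b_w$ of $s_w$ satisfies $b_w=\operatorname{acl}(C\cup b_w\upharpoonright x_w)$. In particular, every completion of $(s_w(y_w))_{w\in W}$ yields a completion of $(q_w(x_w))_{w\in W}$.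
   Context: Independence is nonforking independence; $\operatorname{acl},\operatorname{dcl}$ are real algebraic and definable closure. For finite $W\subseteq\mathfrak{P}(\mathbb{N})$ closed under subsets, a $W$-amalgamation system over $C$ is a family $(p_w(x_w))_{w\in W}$ of complete types over $C$ such that: (1) for distinct variables $y,z$ in $x_w$, $p_w\vdash y\ne z$; (2) $x_v\cap x_w=x_{v\cap w}$ and $p_w\upharpoonright x_v=p_v$ for $v\subseteq w$; (3) for any realization $b_w$ of $p_w$, with $b_i=b_w\upharpoonright x_{\{i\}}$, the family $(b_i)_{i\in w}$ is independent over $C$ and $b_w$ is algebraic over $C\cup\{b_i:i\in w\}$. It is algebraically closed if each such $b_w$ is an enumeration of $\operatorname{acl}(C\cup\{b_i:i\in w\})$. A completion is a type $p_\top(x_\top)$ such that adding it (indexed by a set $\top$ containing all elements of $W$) gives an amalgamation system. *)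

theory Defs
  imports Main
begin

unbundle cardinal_syntax

section \<open>First-order logic with parameters\<close>

text \<open>
  A language is a set of function symbols and a set of relation symbols, each paired with its arity.
  Formulas may mention elements of the structure directly (constructor \<open>Par\<close>), so that a formula
  whose parameters lie in \<open>A\<close> is a formula of the language expanded by constants for \<open>A\<close>.
\<close>

record ('f, 'r) lang =
  funs :: "('f \<times> nat) set"
  rels :: "('r \<times> nat) set"

datatype (dead 'f, tvars: 'v, tpars: 'a) tm =
  Var 'v | Par 'a | Fn 'f "('f, 'v, 'a) tm list"
  for map: map_tm

datatype (dead 'f, dead 'r, allvars: 'v, pars: 'a) fm =
    Eq "('f, 'v, 'a) tm" "('f, 'v, 'a) tm"
  | Rel 'r "('f, 'v, 'a) tm list"
  | Neg "('f, 'r, 'v, 'a) fm"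
  | Conj "('f, 'r, 'v, 'a) fm" "('f, 'r, 'v, 'a) fm"
  | Exi 'v "('f, 'r, 'v, 'a) fm"
  for map: map_fm

fun tm_in :: "('f, 'r) lang \<Rightarrow> ('f, 'v, 'a) tm \<Rightarrow> bool" where
  "tm_in L (Var v) = True"
| "tm_in L (Par a) = True"
| "tm_in L (Fn f ts) = ((f, length ts) \<in> funs L \<and> (\<forall>t \<in> set ts. tm_in L t))"

primrec fm_in :: "('f, 'r) lang \<Rightarrow> ('f, 'r, 'v, 'a) fm \<Rightarrow> bool" where
  "fm_in L (Eq s t) = (tm_in L s \<and> tm_in L t)"
| "fm_in L (Rel r ts) = ((r, length ts) \<in> rels L \<and> (\<forall>t \<in> set ts. tm_in L t))"
| "fm_in L (Neg \<phi>) = fm_in L \<phi>"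
| "fm_in L (Conj \<phi> \<psi>) = (fm_in L \<phi> \<and> fm_in L \<psi>)"
| "fm_in L (Exi v \<phi>) = fm_in L \<phi>"

primrec fv :: "('f, 'r, 'v, 'a) fm \<Rightarrow> 'v set" where
  "fv (Eq s t) = tvars s \<union> tvars t"
| "fv (Rel r ts) = (\<Union>t \<in> set ts. tvars t)"
| "fv (Neg \<phi>) = fv \<phi>"
| "fv (Conj \<phi> \<psi>) = fv \<phi> \<union> fv \<psi>"
| "fv (Exi v \<phi>) = fv \<phi> - {v}"

definition Form :: "('f, 'r) lang \<Rightarrow> 'a set \<Rightarrow> 'v set \<Rightarrow> ('f, 'r, 'v, 'a) fm set" where
  "Form L A x = {\<phi>. fm_in L \<phi> \<and> pars \<phi> \<subseteq> A \<and> fv \<phi> \<subseteq> x}"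

record ('f, 'r, 'a) fo_struct =
  univ :: "'a set"
  fint :: "'f \<Rightarrow> 'a list \<Rightarrow> 'a"
  rint :: "'r \<Rightarrow> 'a list \<Rightarrow> bool"

definition is_struct :: "('f, 'r) lang \<Rightarrow> ('f, 'r, 'a) fo_struct \<Rightarrow> bool" where
  "is_struct L M \<longleftrightarrow> univ M \<noteq> {} \<and>
     (\<forall>(f, n) \<in> funs L. \<forall>as. length as = n \<and> set as \<subseteq> univ M \<longrightarrow> fint M f as \<in> univ M)"

primrec tm_eval :: "('f, 'r, 'a) fo_struct \<Rightarrow> ('v \<Rightarrow> 'a) \<Rightarrow> ('f, 'v, 'a) tm \<Rightarrow> 'a" where
  "tm_eval M e (Var v) = e v"
| "tm_eval M e (Par a) = a"
| "tm_eval M e (Fn f ts) = fint M f (map (tm_eval M e) ts)"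

primrec sat :: "('f, 'r, 'a) fo_struct \<Rightarrow> ('v \<Rightarrow> 'a) \<Rightarrow> ('f, 'r, 'v, 'a) fm \<Rightarrow> bool" where
  "sat M e (Eq s t) = (tm_eval M e s = tm_eval M e t)"
| "sat M e (Rel r ts) = rint M r (map (tm_eval M e) ts)"
| "sat M e (Neg \<phi>) = (\<not> sat M e \<phi>)"
| "sat M e (Conj \<phi> \<psi>) = (sat M e \<phi> \<and> sat M e \<psi>)"
| "sat M e (Exi v \<phi>) = (\<exists>a \<in> univ M. sat M (e(v := a)) \<phi>)" for e

definition valid :: "('f, 'r, 'a) fo_struct \<Rightarrow> ('f, 'r, 'v, 'a) fm \<Rightarrow> bool" where
  "valid M \<phi> \<longleftrightarrow> (\<forall>e. range e \<subseteq> univ M \<longrightarrow> sat M e \<phi>)"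

definition satisfiable :: "('f, 'r, 'a) fo_struct \<Rightarrow> ('f, 'r, 'v, 'a) fm set \<Rightarrow> bool" where
  "satisfiable M S \<longleftrightarrow> (\<exists>e. range e \<subseteq> univ M \<and> (\<forall>\<phi> \<in> S. sat M e \<phi>))"

definition fin_satisfiable :: "('f, 'r, 'a) fo_struct \<Rightarrow> ('f, 'r, 'v, 'a) fm set \<Rightarrow> bool" where
  "fin_satisfiable M S \<longleftrightarrow> (\<forall>S0. S0 \<subseteq> S \<and> finite S0 \<longrightarrow> satisfiable M S0)"


section \<open>Complete simple theories and monster models\<close>

definition is_model :: "('f, 'r) lang \<Rightarrow> ('f, 'r, 'v, 'a) fm set \<Rightarrow> ('f, 'r, 'a) fo_struct \<Rightarrow> bool"
  where "is_model L T M \<longleftrightarrow> is_struct L M \<and> (\<forall>\<phi> \<in> T. valid M \<phi>)"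

text \<open>Complete theories are taken to be deductively closed.\<close>

definition complete_theory :: "('f, 'r) lang \<Rightarrow> ('f, 'r, 'v, 'a) fm set \<Rightarrow> bool" where
  "complete_theory L T \<longleftrightarrow> T \<subseteq> Form L {} {} \<and> (\<exists>M. is_model L T M) \<and>
     (\<forall>\<phi> \<in> Form L {} {}. \<phi> \<in> T \<or> Neg \<phi> \<in> T)"

text \<open>
  The tree property of \<open>\<phi>(x; y)\<close>, where \<open>Y\<close> is the set of the variables \<open>y\<close> and all other variables
  belong to \<open>x\<close>. The tree of \<open>y\<close>-tuples is indexed by finite sequences: the instances at
  the immediate successors of any node are \<open>k\<close>-inconsistent, and those along any branch are
  (finitely) consistent.
\<close>

definition tree_property :: "('f, 'r, 'a) fo_struct \<Rightarrow> ('f, 'r, 'v, 'a) fm \<Rightarrow> 'v set \<Rightarrow> bool" where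
  "tree_property M \<phi> Y \<longleftrightarrow>
     (\<exists>(k :: nat) (b :: nat list \<Rightarrow> 'v \<Rightarrow> 'a).
        (\<forall>s. range (b s) \<subseteq> univ M) \<and>
        (\<forall>s I. finite I \<and> card I = k \<longrightarrow>
           \<not> (\<exists>e. range e \<subseteq> univ M \<and> (\<forall>i \<in> I. sat M (override_on e (b (s @ [i])) Y) \<phi>))) \<and>
        (\<forall>(\<beta> :: nat \<Rightarrow> nat) n.
           \<exists>e. range e \<subseteq> univ M \<and>
             (\<forall>m \<in> {1..n}. sat M (override_on e (b (map \<beta> [0..<m])) Y) \<phi>)))"

definition simple_theory :: "('f, 'r) lang \<Rightarrow> ('f, 'r, 'v, 'a) fm set \<Rightarrow> bool" where
  "simple_theory L T \<longleftrightarrow>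
     (\<forall>M. is_model L T M \<longrightarrow> 
        (\<forall>\<phi> \<in> (Form L {} UNIV :: ('f, 'r, 'v, 'a) fm set). \<forall>Y. \<not> tree_property M \<phi> Y))"

text \<open>\<open>map_fm id f \<phi>\<close> replaces every parameter \<open>a\<close> of \<open>\<phi>\<close> by \<open>f a\<close>. The type of the variables
  is not determined by the other arguments and is passed explicitly.\<close>

definition elementary_on ::
  "'v itself \<Rightarrow> ('f, 'r) lang \<Rightarrow> ('f, 'r, 'a) fo_struct \<Rightarrow> 'a set \<Rightarrow> ('a \<Rightarrow> 'a) \<Rightarrow> bool" where
  "elementary_on V L M A f \<longleftrightarrow> f ` A \<subseteq> univ M \<and>
     (\<forall>\<phi> \<in> (Form L A {} :: ('f, 'r, 'v, 'a) fm set). valid M \<phi> \<longleftrightarrow> valid M (map_fm id f \<phi>))"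

definition automorphism :: "('f, 'r) lang \<Rightarrow> ('f, 'r, 'a) fo_struct \<Rightarrow> ('a \<Rightarrow> 'a) \<Rightarrow> bool" where
  "automorphism L M g \<longleftrightarrow> bij_betw g (univ M) (univ M) \<and>
     (\<forall>(f, n) \<in> funs L. \<forall>as. length as = n \<and> set as \<subseteq> univ M \<longrightarrow>
        g (fint M f as) = fint M f (map g as)) \<and>
     (\<forall>(r, n) \<in> rels L. \<forall>as. length as = n \<and> set as \<subseteq> univ M \<longrightarrow>
        rint M r as = rint M r (map g as))"

definition small :: "'k rel \<Rightarrow> 'b set \<Rightarrow> bool" where
  "small \<kappa> A \<longleftrightarrow> |A| <o \<kappa>"

text \<open>
  \<open>\<kappa>\<close>-saturation for types in fewer than \<open>\<kappa>\<close> variables, and strong \<open>\<kappa>\<close>-homogeneity, for a cardinal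
  \<open>\<kappa>\<close> above the size of the language. The last condition says that there are enough variables
  to index tuples of any small length.
\<close>

definition monster_model ::
  "('f, 'r) lang \<Rightarrow> ('f, 'r, 'v, 'a) fm set \<Rightarrow> 'k rel \<Rightarrow> ('f, 'r, 'a) fo_struct \<Rightarrow> bool" where
  "monster_model L T \<kappa> M \<longleftrightarrow> is_model L T M \<and>
     Card_order \<kappa> \<and> natLeq <o \<kappa> \<and> small \<kappa> (funs L) \<and> small \<kappa> (rels L) \<and>
     (\<forall>A (x :: 'v set) (p :: ('f, 'r, 'v, 'a) fm set).
        A \<subseteq> univ M \<and> small \<kappa> A \<and> small \<kappa> x \<and> p \<subseteq> Form L A x \<and> fin_satisfiable M p
          \<longrightarrow> satisfiable M p) \<and>
     (\<forall>A f. A \<subseteq> univ M \<and> small \<kappa> A \<and> elementary_on TYPE('v) L M A f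
          \<longrightarrow> (\<exists>g. automorphism L M g \<and> (\<forall>a \<in> A. g a = f a))) \<and>
     \<kappa> \<le>o |UNIV :: 'v set|"


section \<open>Algebraic and definable closure, complete types\<close>

definition acl :: "'v itself \<Rightarrow> ('f, 'r) lang \<Rightarrow> ('f, 'r, 'a) fo_struct \<Rightarrow> 'a set \<Rightarrow> 'a set" where
  "acl V L M A = {a \<in> univ M. \<exists>(v :: 'v). \<exists>\<phi> \<in> Form L A {v}.
     sat M (\<lambda>_. a) \<phi> \<and> finite {b \<in> univ M. sat M (\<lambda>_. b) \<phi>}}"

definition dcl :: "'v itself \<Rightarrow> ('f, 'r) lang \<Rightarrow> ('f, 'r, 'a) fo_struct \<Rightarrow> 'a set \<Rightarrow> 'a set" where
  "dcl V L M A = {a \<in> univ M. \<exists>(v :: 'v). \<exists>\<phi> \<in> Form L A {v}.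
     {b \<in> univ M. sat M (\<lambda>_. b) \<phi>} = {a}}"

definition complete_type ::
  "('f, 'r) lang \<Rightarrow> ('f, 'r, 'a) fo_struct \<Rightarrow> 'a set \<Rightarrow> 'v set \<Rightarrow> ('f, 'r, 'v, 'a) fm set \<Rightarrow> bool" where
  "complete_type L M C x p \<longleftrightarrow> p \<subseteq> Form L C x \<and> fin_satisfiable M p \<and>
     (\<forall>\<phi> \<in> Form L C x. \<phi> \<in> p \<or> Neg \<phi> \<in> p)"

text \<open>Tuples indexed by \<open>x\<close> are functions on all variables, whose values outside \<open>x\<close> are
  irrelevant; the set of entries of the tuple \<open>b\<close> is \<open>b ` x\<close>.\<close>

definition realizes ::
  "('f, 'r, 'a) fo_struct \<Rightarrow> 'v set \<Rightarrow> ('f, 'r, 'v, 'a) fm set \<Rightarrow> ('v \<Rightarrow> 'a) \<Rightarrow> bool" where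
  "realizes M x p b \<longleftrightarrow> b ` x \<subseteq> univ M \<and> (\<forall>\<phi> \<in> p. sat M b \<phi>)"

definition type_restrict :: "('f, 'r, 'v, 'a) fm set \<Rightarrow> 'v set \<Rightarrow> ('f, 'r, 'v, 'a) fm set" where
  "type_restrict p x = {\<phi> \<in> p. fv \<phi> \<subseteq> x}"

definition tp ::
  "('f, 'r) lang \<Rightarrow> ('f, 'r, 'a) fo_struct \<Rightarrow> 'a set \<Rightarrow> 'v set \<Rightarrow> ('v \<Rightarrow> 'a) \<Rightarrow> ('f, 'r, 'v, 'a) fm set"
  where "tp L M A x b = {\<phi> \<in> Form L A x. sat M b \<phi>}"


section \<open>Nonforking independence\<close>

text \<open>
  \<open>\<phi>(x, d)\<close> divides over \<open>C\<close> if for some \<open>k\<close> there are \<open>d\<^sub>i\<close> (\<open>i < \<omega>\<close>) with the same type as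
  \<open>d\<close> over \<open>C\<close> such that \<open>(\<phi>(x, d\<^sub>i))\<^sub>i\<close> is \<open>k\<close>-inconsistent. The tuple \<open>d\<^sub>i\<close> is the image of \<open>d\<close>
  under the elementary map \<open>\<sigma> i\<close>, which fixes \<open>C\<close> pointwise.
\<close>

definition divides ::
  "('f, 'r) lang \<Rightarrow> ('f, 'r, 'a) fo_struct \<Rightarrow> 'a set \<Rightarrow> ('f, 'r, 'v, 'a) fm \<Rightarrow> bool" where
  "divides L M C \<phi> \<longleftrightarrow>
     (\<exists>(k :: nat) (\<sigma> :: nat \<Rightarrow> 'a \<Rightarrow> 'a).
        (\<forall>i. elementary_on TYPE('v) L M (C \<union> pars \<phi>) (\<sigma> i) \<and> (\<forall>c \<in> C. \<sigma> i c = c)) \<and>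
        (\<forall>I. finite I \<and> card I = k \<longrightarrow> \<not> satisfiable M ((\<lambda>i. map_fm id (\<sigma> i) \<phi>) ` I)))"

text \<open>A type forks over \<open>C\<close> if it implies a finite disjunction of formulas that divide over \<open>C\<close>.
  Implication is deducibility modulo the theory of the monster model with parameters, so it only
  involves a finite part of the type.\<close>

definition forks ::
  "('f, 'r) lang \<Rightarrow> ('f, 'r, 'a) fo_struct \<Rightarrow> 'a set \<Rightarrow> 'v set \<Rightarrow> ('f, 'r, 'v, 'a) fm set \<Rightarrow> bool" where
  "forks L M C x p \<longleftrightarrow>
     (\<exists>D p0. finite D \<and> D \<subseteq> Form L (univ M) x \<and> (\<forall>\<psi> \<in> D. divides L M C \<psi>) \<and>
        finite p0 \<and> p0 \<subseteq> p \<and>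
        (\<forall>e. range e \<subseteq> univ M \<and> (\<forall>\<phi> \<in> p0. sat M e \<phi>) \<longrightarrow> (\<exists>\<psi> \<in> D. sat M e \<psi>)))"

definition indep ::
  "('f, 'r) lang \<Rightarrow> ('f, 'r, 'a) fo_struct \<Rightarrow> 'a set \<Rightarrow> 'v set \<Rightarrow> ('v \<Rightarrow> 'a) \<Rightarrow> 'a set \<Rightarrow> bool" where
  "indep L M C x b B \<longleftrightarrow> \<not> forks L M C x (tp L M (C \<union> B) x b)"

definition indep_family ::
  "('f, 'r) lang \<Rightarrow> ('f, 'r, 'a) fo_struct \<Rightarrow> 'a set \<Rightarrow> 'i set \<Rightarrow> ('i \<Rightarrow> 'v set) \<Rightarrow> ('v \<Rightarrow> 'a) \<Rightarrow> bool"
  where "indep_family L M C I x b \<longleftrightarrow>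
     (\<forall>i \<in> I. indep L M C (x i) b (\<Union>j \<in> I - {i}. b ` x j))"


section \<open>Amalgamation systems\<close>

text \<open>
  The defining conditions of an amalgamation system, for an arbitrary index family \<open>W\<close>; they are also
  used for \<open>W \<union> {\<top>}\<close>, which need not be closed under subsets. The tuple \<open>b\<^sub>i\<close> is considered for
  those \<open>i \<in> w\<close> for which the variables \<open>x\<^bsub>{i}\<^esub>\<close> are given; if \<open>W\<close> is closed under subsets these are
  all \<open>i \<in> w\<close>. As everything takes place in a monster model, the tuples of variables are small.
\<close>

definition amalg_conditions ::
  "('f, 'r) lang \<Rightarrow> 'k rel \<Rightarrow> ('f, 'r, 'a) fo_struct \<Rightarrow> 'a set \<Rightarrow> nat set set \<Rightarrow>
   (nat set \<Rightarrow> 'v set) \<Rightarrow> (nat set \<Rightarrow> ('f, 'r, 'v, 'a) fm set) \<Rightarrow> bool" where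
  "amalg_conditions L \<kappa> M C W x p \<longleftrightarrow>
     (\<forall>w \<in> W. small \<kappa> (x w) \<and> complete_type L M C (x w) (p w)) \<and>
     (\<forall>w \<in> W. \<forall>y \<in> x w. \<forall>z \<in> x w. y \<noteq> z \<longrightarrow> Neg (Eq (Var y) (Var z)) \<in> p w) \<and>
     (\<forall>v \<in> W. \<forall>w \<in> W. x v \<inter> x w = x (v \<inter> w)) \<and>
     (\<forall>v \<in> W. \<forall>w \<in> W. v \<subseteq> w \<longrightarrow> type_restrict (p w) (x v) = p v) \<and>
     (\<forall>w \<in> W. \<forall>b. realizes M (x w) (p w) b \<longrightarrow>
        indep_family L M C {i \<in> w. {i} \<in> W} (\<lambda>i. x {i}) b \<and>
        b ` x w \<subseteq> acl TYPE('v) L M (C \<union> (\<Union>i \<in> {i \<in> w. {i} \<in> W}. b ` x {i})))"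

definition amalgamation_system ::
  "('f, 'r) lang \<Rightarrow> 'k rel \<Rightarrow> ('f, 'r, 'a) fo_struct \<Rightarrow> 'a set \<Rightarrow> nat set set \<Rightarrow>
   (nat set \<Rightarrow> 'v set) \<Rightarrow> (nat set \<Rightarrow> ('f, 'r, 'v, 'a) fm set) \<Rightarrow> bool" where
  "amalgamation_system L \<kappa> M C W x p \<longleftrightarrow>
     finite W \<and> (\<forall>w \<in> W. \<forall>v. v \<subseteq> w \<longrightarrow> v \<in> W) \<and> amalg_conditions L \<kappa> M C W x p"

text \<open>By the first condition on amalgamation systems, realizations enumerate without repetition.\<close>

definition alg_closed_system ::
  "('f, 'r) lang \<Rightarrow> 'k rel \<Rightarrow> ('f, 'r, 'a) fo_struct \<Rightarrow> 'a set \<Rightarrow> nat set set \<Rightarrow>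
   (nat set \<Rightarrow> 'v set) \<Rightarrow> (nat set \<Rightarrow> ('f, 'r, 'v, 'a) fm set) \<Rightarrow> bool" where
  "alg_closed_system L \<kappa> M C W x p \<longleftrightarrow> amalgamation_system L \<kappa> M C W x p \<and>
     (\<forall>w \<in> W. \<forall>b. realizes M (x w) (p w) b \<longrightarrow>
        b ` x w = acl TYPE('v) L M (C \<union> (\<Union>i \<in> w. b ` x {i})))"

definition completion ::
  "('f, 'r) lang \<Rightarrow> 'k rel \<Rightarrow> ('f, 'r, 'a) fo_struct \<Rightarrow> 'a set \<Rightarrow> nat set set \<Rightarrow>
   (nat set \<Rightarrow> 'v set) \<Rightarrow> (nat set \<Rightarrow> ('f, 'r, 'v, 'a) fm set) \<Rightarrow>
   nat set \<Rightarrow> 'v set \<Rightarrow> ('f, 'r, 'v, 'a) fm set \<Rightarrow> bool" where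
  "completion L \<kappa> M C W x p t xt pt \<longleftrightarrow> (\<forall>w \<in> W. w \<subseteq> t) \<and>
     (\<exists>x' p'. (\<forall>w \<in> W. x' w = x w \<and> p' w = p w) \<and> x' t = xt \<and> p' t = pt \<and>
        amalg_conditions L \<kappa> M C (insert t W) x' p')"

end

theory Submission
  imports Defs
begin

text \<open>
  Choose a realization \<open>a\<^sub>w\<close> of every \<open>q\<^sub>w\<close>. For \<open>v \<subseteq> w\<close> some automorphism over \<open>C\<close> takes \<open>a\<^sub>v\<close> to the
  restriction of \<open>a\<^sub>w\<close>, and since \<open>acl = dcl\<close> it is unique on \<open>acl (C a\<^sub>v)\<close>; hence the sets
  \<open>acl (C a\<^sub>w)\<close> form a directed family of embeddings. Independence gives
  \<open>acl (C a\<^sub>u) \<inter> acl (C a\<^sub>v) = acl (C a\<^bsub>u \<inter> v\<^esub>)\<close> inside \<open>acl (C a\<^sub>w)\<close>, so every element of \<open>acl (C a\<^sub>w)\<close>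
  has a smallest support \<open>v \<subseteq> w\<close>. The new variables of \<open>y\<^sub>w\<close> are names for the elements with support
  contained in \<open>w\<close> that are not yet entries of the tuples.

  The intersection property and the passage of independence to \<open>dcl\<close> are proved directly
  from the definition of forking, so neither symmetry nor transitivity of independence is used.
\<close>

section \<open>Substitution and counting\<close>

text \<open>\<open>W\<close> need not have a largest member, and no common realization of all the
  types is assumed. The closures of the chosen tuples therefore cannot be compared inside one big
  closure; they are glued through names. The requirement that y_v and y_w meet exactly in the
  variables of the common index set forces each new variable to be tied to one index set. A minimal
  support would not do, since another minimal support could give the same element a second name;
  this is why the intersection property is needed.

  Besides making the embeddings unique, \<open>acl = dcl\<close> lets independence pass from the
  tuples to their closures: a variable definable over \<open>C\<close> and the other variables can
  be quantified away in a forking witness. The hypothesis on acl (C a_v) and a_w excludes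
  repetitions: an entry of a_w with support v is already an entry of a_v, so no named element is
  also the value of an old variable.

  All statements about realizations are checked on one chosen tuple and carried over by
  homogeneity.\<close>

lemma finite_tvars [simp]: "finite (tvars t)"
  by (induction t) auto

lemma finite_tpars [simp]: "finite (tpars t)"
  by (induction t) auto

lemma finite_fv [simp]: "finite (fv \<phi>)"
  by (induction \<phi>) auto

lemma finite_pars [simp]: "finite (pars \<phi>)"
  by (induction \<phi>) auto

lemma finite_allvars [simp]: "finite (allvars \<phi>)"
  by (induction \<phi>) auto

lemma fv_subset_allvars: "fv \<phi> \<subseteq> allvars \<phi>"
  by (induction \<phi>) auto

lemma tvars_map_tm_id [simp]: "tvars (map_tm id h t) = tvars t"
  by (simp add: tm.set_map)

lemma fv_map_fm_id [simp]: "fv (map_fm id h \<phi>) = fv \<phi>"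
  by (induction \<phi>) (auto simp: tm.set_map)

lemma tm_in_map_tm [simp]: "tm_in L (map_tm g h t) = tm_in L t"
  by (induction t) auto

lemma fm_in_map_fm [simp]: "fm_in L (map_fm g h \<phi>) = fm_in L \<phi>"
  by (induction \<phi>) auto

lemma map_tm_id_id [simp]: "map_tm id id t = t"
  by (simp add: tm.map_id)

lemma map_fm_id_id [simp]: "map_fm id id \<phi> = \<phi>"
  by (simp add: fm.map_id)

lemma map_fm_cong_pars: "(\<And>a. a \<in> pars \<phi> \<Longrightarrow> h a = h' a) \<Longrightarrow> map_fm id h \<phi> = map_fm id h' \<phi>"
  by (rule fm.map_cong) auto

lemma map_fm_fixed: "(\<And>a. a \<in> pars \<phi> \<Longrightarrow> h a = a) \<Longrightarrow> map_fm id h \<phi> = \<phi>"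
  using map_fm_cong_pars[of \<phi> h id] by simp

lemma tm_eval_cong: "(\<And>v. v \<in> tvars t \<Longrightarrow> e v = e' v) \<Longrightarrow> tm_eval M e t = tm_eval M e' t"
proof (induction t)
  case (Fn f ts)
  then have "map (tm_eval M e) ts = map (tm_eval M e') ts" by auto
  then show ?case unfolding tm_eval.simps by (rule arg_cong)
qed auto

lemma sat_cong: "(\<And>v. v \<in> fv \<phi> \<Longrightarrow> e v = e' v) \<Longrightarrow> sat M e \<phi> = sat M e' \<phi>"
proof (induction \<phi> arbitrary: e e')
  case (Eq s t)
  then show ?case using tm_eval_cong[of s e e' M] tm_eval_cong[of t e e' M] by auto
next
  case (Rel r ts)
  have "map (tm_eval M e) ts = map (tm_eval M e') ts"
    using Rel by (auto intro!: tm_eval_cong)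
  then show ?case unfolding sat.simps by (rule arg_cong)
next
  case (Conj \<phi> \<psi>)
  have "sat M e \<phi> = sat M e' \<phi>" by (rule Conj.IH(1)) (auto simp: Conj.prems)
  moreover have "sat M e \<psi> = sat M e' \<psi>" by (rule Conj.IH(2)) (auto simp: Conj.prems)
  ultimately show ?case by simp
next
  case (Exi v \<phi>)
  have "sat M (e(v := a)) \<phi> = sat M (e'(v := a)) \<phi>" for a
    by (rule Exi.IH) (auto simp: Exi.prems)
  then show ?case by simp
next
  case (Neg \<phi>)
  have "sat M e \<phi> = sat M e' \<phi>" by (rule Neg.IH) (auto simp: Neg.prems)
  then show ?case by simp
qed

lemma tm_eval_rename: "tm_eval M e (map_tm \<pi> id t) = tm_eval M (\<lambda>v. e (\<pi> v)) t"
proof (induction t)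
  case (Fn f ts)
  then show ?case by (simp del: id_apply cong: map_cong)
qed auto

text \<open>Injectivity on all variables, bound ones included, rules out capture. A formula can thus
  be moved into any infinite set of variables, which is what counting formulas requires.\<close>

lemma sat_rename: "inj_on \<pi> (allvars \<phi>) \<Longrightarrow> sat M e (map_fm \<pi> id \<phi>) = sat M (\<lambda>v. e (\<pi> v)) \<phi>"
proof (induction \<phi> arbitrary: e)
  case (Eq s t)
  then show ?case by (simp add: tm_eval_rename del: id_apply)
next
  case (Rel r ts)
  then show ?case by (simp add: tm_eval_rename del: id_apply cong: map_cong)
next
  case (Conj \<phi> \<psi>)
  then show ?case by (auto simp: inj_on_Un simp del: id_apply)
next
  case (Exi v \<phi>)
  have "sat M (e(\<pi> v := a)) (map_fm \<pi> id \<phi>) = sat M ((\<lambda>v. e (\<pi> v))(v := a)) \<phi>" for a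
  proof -
    have "sat M (e(\<pi> v := a)) (map_fm \<pi> id \<phi>) = sat M (\<lambda>u. (e(\<pi> v := a)) (\<pi> u)) \<phi>"
      using Exi.prems by (intro Exi.IH) (auto simp: inj_on_def)
    also have "\<dots> = sat M ((\<lambda>v. e (\<pi> v))(v := a)) \<phi>"
      using Exi.prems fv_subset_allvars[of \<phi>] by (intro sat_cong) (auto simp: inj_on_def)
    finally show ?thesis .
  qed
  then show ?case by (simp del: id_apply)
qed (simp del: id_apply)

primrec subst_tm :: "('v \<Rightarrow> ('f, 'v, 'a) tm) \<Rightarrow> ('a \<Rightarrow> ('f, 'v, 'a) tm) \<Rightarrow>
    ('f, 'v, 'a) tm \<Rightarrow> ('f, 'v, 'a) tm" where
  "subst_tm \<sigma> \<tau> (Var v) = \<sigma> v"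
| "subst_tm \<sigma> \<tau> (Par a) = \<tau> a"
| "subst_tm \<sigma> \<tau> (Fn f ts) = Fn f (map (subst_tm \<sigma> \<tau>) ts)"

section \<open>Capture-avoiding substitution for variables and parameters\<close>

definition fresh :: "'v set \<Rightarrow> 'v" where
  "fresh X = (SOME z. z \<notin> X)"

lemma fresh_notin: "infinite (UNIV :: 'v set) \<Longrightarrow> finite X \<Longrightarrow> fresh X \<notin> (X :: 'v set)"
  unfolding fresh_def by (rule someI_ex) (use ex_new_if_finite in blast)

text \<open>Parameters are substituted along with variables, because turning parameters into
  variables is the main use. At a quantifier the bound variable is replaced by one that occurs in
  none of the inserted terms, so nothing is captured.\<close>

primrec subst_fm :: "('v \<Rightarrow> ('f, 'v, 'a) tm) \<Rightarrow> ('a \<Rightarrow> ('f, 'v, 'a) tm) \<Rightarrow>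
    ('f, 'r, 'v, 'a) fm \<Rightarrow> ('f, 'r, 'v, 'a) fm" where
  "subst_fm \<sigma> \<tau> (Eq s t) = Eq (subst_tm \<sigma> \<tau> s) (subst_tm \<sigma> \<tau> t)"
| "subst_fm \<sigma> \<tau> (Rel r ts) = Rel r (map (subst_tm \<sigma> \<tau>) ts)"
| "subst_fm \<sigma> \<tau> (Neg \<phi>) = Neg (subst_fm \<sigma> \<tau> \<phi>)"
| "subst_fm \<sigma> \<tau> (Conj \<phi> \<psi>) = Conj (subst_fm \<sigma> \<tau> \<phi>) (subst_fm \<sigma> \<tau> \<psi>)"
| "subst_fm \<sigma> \<tau> (Exi v \<phi>) =
     (let z = fresh ((\<Union>u \<in> fv \<phi> - {v}. tvars (\<sigma> u)) \<union> (\<Union>a \<in> pars \<phi>. tvars (\<tau> a)))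
      in Exi z (subst_fm (\<sigma>(v := Var z)) \<tau> \<phi>))"

lemma tm_in_subst:
  "tm_in L t \<Longrightarrow> (\<And>v. tm_in L (\<sigma> v)) \<Longrightarrow> (\<And>a. tm_in L (\<tau> a)) \<Longrightarrow> tm_in L (subst_tm \<sigma> \<tau> t)"
  by (induction t) auto

lemma fm_in_subst:
  "fm_in L \<phi> \<Longrightarrow> (\<And>v. tm_in L (\<sigma> v)) \<Longrightarrow> (\<And>a. tm_in L (\<tau> a)) \<Longrightarrow> fm_in L (subst_fm \<sigma> \<tau> \<phi>)"
  by (induction \<phi> arbitrary: \<sigma>) (auto simp: tm_in_subst Let_def)

lemma tvars_subst:
  "tvars (subst_tm \<sigma> \<tau> t) \<subseteq> (\<Union>v\<in>tvars t. tvars (\<sigma> v)) \<union> (\<Union>a\<in>tpars t. tvars (\<tau> a))"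
proof (induction t)
  case (Fn g ts)
  then show ?case by fastforce
qed auto

lemma tpars_subst:
  "tpars (subst_tm \<sigma> \<tau> t) \<subseteq> (\<Union>v\<in>tvars t. tpars (\<sigma> v)) \<union> (\<Union>a\<in>tpars t. tpars (\<tau> a))"
proof (induction t)
  case (Fn g ts)
  then show ?case by fastforce
qed auto

lemma fv_subst:
  "fv (subst_fm \<sigma> \<tau> \<phi>) \<subseteq> (\<Union>v\<in>fv \<phi>. tvars (\<sigma> v)) \<union> (\<Union>a\<in>pars \<phi>. tvars (\<tau> a))"
proof (induction \<phi> arbitrary: \<sigma>)
  case (Eq s t)
  show ?case using Un_mono[OF tvars_subst[of \<sigma> \<tau> s] tvars_subst[of \<sigma> \<tau> t]]
    by (simp only: subst_fm.simps fv.simps fm.set UN_Un Un_ac)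
next
  case (Rel r ts)
  show ?case
  proof
    fix u assume "u \<in> fv (subst_fm \<sigma> \<tau> (Rel r ts))"
    then obtain t where t: "t \<in> set ts" "u \<in> tvars (subst_tm \<sigma> \<tau> t)" by auto
    have "tvars t \<subseteq> fv (Rel r ts)" "tpars t \<subseteq> pars (Rel r ts)" using t(1) by auto
    with subsetD[OF tvars_subst t(2)]
    show "u \<in> (\<Union>v\<in>fv (Rel r ts). tvars (\<sigma> v)) \<union> (\<Union>a\<in>pars (Rel r ts). tvars (\<tau> a))"
      by (elim UnE UN_E) (auto simp del: fv.simps fm.set)
  qed
next
  case (Conj \<phi> \<psi>)
  show ?case using Un_mono[OF Conj.IH]
    by (simp only: subst_fm.simps fv.simps fm.set UN_Un Un_ac)
next
  case (Exi v \<phi>)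
  define z where "z = fresh ((\<Union>u \<in> fv \<phi> - {v}. tvars (\<sigma> u)) \<union> (\<Union>a \<in> pars \<phi>. tvars (\<tau> a)))"
  have "(\<Union>u\<in>fv \<phi>. tvars ((\<sigma>(v := Var z)) u)) - {z} \<subseteq> (\<Union>u\<in>fv \<phi> - {v}. tvars (\<sigma> u))"
    by (auto split: if_splits)
  moreover have "fv (subst_fm \<sigma> \<tau> (Exi v \<phi>)) = fv (subst_fm (\<sigma>(v := Var z)) \<tau> \<phi>) - {z}"
    by (simp add: Let_def z_def)
  moreover note Exi[of "\<sigma>(v := Var z)"]
  ultimately show ?case unfolding fv.simps fm.set
    by (smt (verit) Diff_subset Un_Diff Un_mono Diff_mono order_trans subset_refl)
qed simp

lemma pars_subst:
  "pars (subst_fm \<sigma> \<tau> \<phi>) \<subseteq> (\<Union>v\<in>fv \<phi>. tpars (\<sigma> v)) \<union> (\<Union>a\<in>pars \<phi>. tpars (\<tau> a))"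
proof (induction \<phi> arbitrary: \<sigma>)
  case (Eq s t)
  show ?case using Un_mono[OF tpars_subst[of \<sigma> \<tau> s] tpars_subst[of \<sigma> \<tau> t]]
    by (simp only: subst_fm.simps fv.simps fm.set UN_Un Un_ac)
next
  case (Rel r ts)
  show ?case
  proof
    fix u assume "u \<in> pars (subst_fm \<sigma> \<tau> (Rel r ts))"
    then obtain t where t: "t \<in> set ts" "u \<in> tpars (subst_tm \<sigma> \<tau> t)" by auto
    have "tvars t \<subseteq> fv (Rel r ts)" "tpars t \<subseteq> pars (Rel r ts)" using t(1) by auto
    with subsetD[OF tpars_subst t(2)]
    show "u \<in> (\<Union>v\<in>fv (Rel r ts). tpars (\<sigma> v)) \<union> (\<Union>a\<in>pars (Rel r ts). tpars (\<tau> a))"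
      by (elim UnE UN_E) (auto simp del: fv.simps fm.set)
  qed
next
  case (Conj \<phi> \<psi>)
  show ?case using Un_mono[OF Conj.IH]
    by (simp only: subst_fm.simps fv.simps fm.set UN_Un Un_ac)
next
  case (Exi v \<phi>)
  define z where "z = fresh ((\<Union>u \<in> fv \<phi> - {v}. tvars (\<sigma> u)) \<union> (\<Union>a \<in> pars \<phi>. tvars (\<tau> a)))"
  have "(\<Union>u\<in>fv \<phi>. tpars ((\<sigma>(v := Var z)) u)) \<subseteq> (\<Union>u\<in>fv \<phi> - {v}. tpars (\<sigma> u))"
    by (auto split: if_splits)
  moreover have "pars (subst_fm \<sigma> \<tau> (Exi v \<phi>)) = pars (subst_fm (\<sigma>(v := Var z)) \<tau> \<phi>)"
    by (simp add: Let_def z_def)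
  moreover note Exi[of "\<sigma>(v := Var z)"]
  ultimately show ?case unfolding fv.simps fm.set
    by (smt (verit) Diff_subset Un_Diff Un_mono Diff_mono order_trans subset_refl)
qed simp

lemma tm_eval_subst:
  "tm_eval M e (map_tm id h (subst_tm \<sigma> \<tau> t)) =
   tm_eval M (\<lambda>v. tm_eval M e (map_tm id h (\<sigma> v))) (map_tm id (\<lambda>a. tm_eval M e (map_tm id h (\<tau> a))) t)"
  (is "_ = tm_eval M ?e (map_tm id ?h t)")
proof (induction t)
  case (Fn f ts)
  then have "map (\<lambda>t. tm_eval M e (map_tm id h (subst_tm \<sigma> \<tau> t))) ts =
      map (\<lambda>t. tm_eval M ?e (map_tm id ?h t)) ts"
    by (intro map_cong refl)
  then show ?case by (simp only: subst_tm.simps tm.map tm_eval.simps map_map o_def)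
qed auto

text \<open>The parameter map \<open>h\<close> acts after the substitution because dividing speaks
  of conjugates \<open>map_fm id h\<close> of an instance; the equivalence reads their truth off
  from the values of the substituted terms. Infinitely many variables are needed for the fresh bound
  variable.\<close>

lemma sat_subst:
  fixes \<phi> :: "('f, 'r, 'v, 'a) fm"
  assumes inf: "infinite (UNIV :: 'v set)"
  shows "sat M e (map_fm id h (subst_fm \<sigma> \<tau> \<phi>)) \<longleftrightarrow>
    sat M (\<lambda>v. tm_eval M e (map_tm id h (\<sigma> v)))
      (map_fm id (\<lambda>a. tm_eval M e (map_tm id h (\<tau> a))) \<phi>)"
proof (induction \<phi> arbitrary: \<sigma> e)
  case (Eq s t)
  show ?case by (simp only: subst_fm.simps fm.map sat.simps tm_eval_subst)
next
  case (Rel r ts)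
  show ?case by (simp only: subst_fm.simps fm.map sat.simps tm_eval_subst map_map o_def)
next
  case (Neg \<phi>)
  show ?case by (simp only: subst_fm.simps fm.map sat.simps Neg)
next
  case (Conj \<phi> \<psi>)
  show ?case by (simp only: subst_fm.simps fm.map sat.simps Conj)
next
  case (Exi v \<phi>)
  define X where "X = (\<Union>u \<in> fv \<phi> - {v}. tvars (\<sigma> u)) \<union> (\<Union>a \<in> pars \<phi>. tvars (\<tau> a))"
  define z where "z = fresh X"
  have z: "z \<notin> X" unfolding z_def by (rule fresh_notin[OF inf]) (simp add: X_def)
  define E where "E = (\<lambda>v. tm_eval M e (map_tm id h (\<sigma> v)))"
  define H where "H = (\<lambda>a. tm_eval M e (map_tm id h (\<tau> a)))"
  have *: "sat M (e(z := c)) (map_fm id h (subst_fm (\<sigma>(v := Var z)) \<tau> \<phi>)) =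
    sat M (E(v := c)) (map_fm id H \<phi>)" (is "?l = ?r") for c
  proof -
    have "?l = sat M (\<lambda>u. tm_eval M (e(z := c)) (map_tm id h ((\<sigma>(v := Var z)) u)))
      (map_fm id (\<lambda>a. tm_eval M (e(z := c)) (map_tm id h (\<tau> a))) \<phi>)"
      by (rule Exi.IH)
    also have "map_fm id (\<lambda>a. tm_eval M (e(z := c)) (map_tm id h (\<tau> a))) \<phi> = map_fm id H \<phi>"
      unfolding H_def by (rule map_fm_cong_pars, rule tm_eval_cong) (use z in \<open>auto simp: X_def\<close>)
    also have "sat M (\<lambda>u. tm_eval M (e(z := c)) (map_tm id h ((\<sigma>(v := Var z)) u))) \<dots> = ?r"
    proof (rule sat_cong)
      fix u assume "u \<in> fv (map_fm id H \<phi>)"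
      then have u: "u \<in> fv \<phi>" by simp
      show "tm_eval M (e(z := c)) (map_tm id h ((\<sigma>(v := Var z)) u)) = (E(v := c)) u"
      proof (cases "u = v")
        case False
        then have "tm_eval M (e(z := c)) (map_tm id h (\<sigma> u)) = tm_eval M e (map_tm id h (\<sigma> u))"
          using z u by (intro tm_eval_cong) (auto simp: X_def)
        then show ?thesis using False by (simp add: E_def)
      qed simp
    qed
    finally show ?thesis .
  qed
  have "subst_fm \<sigma> \<tau> (Exi v \<phi>) = Exi z (subst_fm (\<sigma>(v := Var z)) \<tau> \<phi>)"
    by (simp add: z_def X_def Let_def)
  then show ?case by (simp add: * del: id_apply flip: E_def H_def) (simp add: *)
qed

lemma sat_subst_id:
  fixes \<phi> :: "('f, 'r, 'v, 'a) fm"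
  assumes inf: "infinite (UNIV :: 'v set)"
  shows "sat M e (subst_fm \<sigma> \<tau> \<phi>) \<longleftrightarrow>
    sat M (\<lambda>v. tm_eval M e (\<sigma> v)) (map_fm id (\<lambda>a. tm_eval M e (\<tau> a)) \<phi>)"
  using sat_subst[OF inf, of M e id \<sigma> \<tau> \<phi>] by simp

section \<open>Finite conjunctions and counting quantifiers\<close>

lemma ex_bigconj:
  fixes x :: "'v set"
  assumes "finite S" "S \<subseteq> Form L A x"
  shows "\<exists>\<chi> \<in> Form L A x. \<forall>M e. is_struct L M \<longrightarrow> (sat M e \<chi> \<longleftrightarrow> (\<forall>\<phi>\<in>S. sat M e \<phi>))"
  using assms
proof (induction S rule: finite_induct)
  case empty
  \<comment> \<open>The empty conjunction needs a closed true formula; this one holds because the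
    universe is nonempty.\<close>
  show ?case by (rule bexI[of _ "Exi undefined (Eq (Var undefined) (Var undefined))"]) (auto simp: Form_def is_struct_def)
next
  case (insert \<phi> S)
  then obtain \<chi> where "\<chi> \<in> Form L A x"
    "\<forall>M e. is_struct L M \<longrightarrow> (sat M e \<chi> \<longleftrightarrow> (\<forall>\<phi>\<in>S. sat M e \<phi>))" by auto
  then show ?case using insert.prems
    by (intro bexI[of _ "Conj \<phi> \<chi>"]) (auto simp: Form_def)
qed

text \<open>At least k + 1 solutions means that some solution \<open>z0\<close> has k solutions
  different from it. The formula is uniform in the assignment, so its negation can impose a bound on
  the number of solutions under every assignment at once.\<close>

lemma ex_at_least:
  fixes \<phi> :: "('f, 'r, 'v, 'a) fm"
  assumes inf: "infinite (UNIV :: 'v set)" and "\<phi> \<in> Form L A (insert z x)"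
  shows "\<exists>\<theta> \<in> Form L A x. \<forall>M e. is_struct L M \<longrightarrow>
    (sat M e \<theta> \<longleftrightarrow> (\<exists>S. finite S \<and> card S = k \<and> S \<subseteq> {c \<in> univ M. sat M (e(z := c)) \<phi>}))"
  using assms(2)
proof (induction k arbitrary: \<phi> x)
  case 0
  show ?case by (rule bexI[of _ "Exi z (Eq (Var z) (Var z))"]) (auto simp: Form_def is_struct_def)
next
  case (Suc k)
  define z0 where "z0 = fresh (insert z (fv \<phi>))"
  have z0: "z0 \<noteq> z" "z0 \<notin> fv \<phi>" using fresh_notin[OF inf, of "insert z (fv \<phi>)"] by (auto simp: z0_def)
  let ?\<psi> = "Conj \<phi> (Neg (Eq (Var z) (Var z0)))"
  have "?\<psi> \<in> Form L A (insert z (insert z0 x))" using Suc.prems by (auto simp: Form_def)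
  from Suc.IH[OF this] obtain \<theta> where \<theta>: "\<theta> \<in> Form L A (insert z0 x)"
    "\<And>M e. is_struct L M \<Longrightarrow> sat M e \<theta> \<longleftrightarrow>
      (\<exists>S. finite S \<and> card S = k \<and> S \<subseteq> {c \<in> univ M. sat M (e(z := c)) ?\<psi>})" by blast
  \<comment> \<open>The conjunct \<open>Exi z (Conj (Eq (Var z) (Var z0)) \<phi>)\<close> says that
    \<open>z0\<close> solves \<phi> without performing a substitution.\<close>
  let ?\<theta> = "Exi z0 (Conj (Exi z (Conj (Eq (Var z) (Var z0)) \<phi>)) \<theta>)"
  have "?\<theta> \<in> Form L A x" using \<theta>(1) Suc.prems z0 by (auto simp: Form_def)
  moreover have "sat M e ?\<theta> \<longleftrightarrow>
    (\<exists>S. finite S \<and> card S = Suc k \<and> S \<subseteq> {c \<in> univ M. sat M (e(z := c)) \<phi>})" (is "?l \<longleftrightarrow> ?r")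
    if M: "is_struct L M" for M e
  proof -
    have upd: "sat M (e(z0 := d, z := c)) \<phi> = sat M (e(z := c)) \<phi>" for c d
      using z0 by (intro sat_cong) auto
    have "?l \<longleftrightarrow> (\<exists>d \<in> univ M. sat M (e(z := d)) \<phi> \<and>
      (\<exists>S. finite S \<and> card S = k \<and> S \<subseteq> {c \<in> univ M. sat M (e(z := c)) \<phi> \<and> c \<noteq> d}))"
      using z0 by (auto simp: \<theta>(2)[OF M] upd)
    also have "\<dots> \<longleftrightarrow> ?r"
    proof
      assume "\<exists>d \<in> univ M. sat M (e(z := d)) \<phi> \<and>
      (\<exists>S. finite S \<and> card S = k \<and> S \<subseteq> {c \<in> univ M. sat M (e(z := c)) \<phi> \<and> c \<noteq> d})"
      then obtain d S where "d \<in> univ M" "sat M (e(z := d)) \<phi>" "finite S" "card S = k"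
        "S \<subseteq> {c \<in> univ M. sat M (e(z := c)) \<phi> \<and> c \<noteq> d}" by blast
      then show ?r by (intro exI[of _ "insert d S"]) (auto simp: card_insert_if)
    next
      assume ?r
      then obtain S where S: "finite S" "card S = Suc k" "S \<subseteq> {c \<in> univ M. sat M (e(z := c)) \<phi>}" by blast
      then obtain d where d: "d \<in> S" by fastforce
      show "\<exists>d \<in> univ M. sat M (e(z := d)) \<phi> \<and>
      (\<exists>S. finite S \<and> card S = k \<and> S \<subseteq> {c \<in> univ M. sat M (e(z := c)) \<phi> \<and> c \<noteq> d})"
        using S d by (intro bexI[of _ d] conjI exI[of _ "S - {d}"]) auto
    qed
    finally show ?thesis .
  qed
  ultimately show ?case by blast
qed

section \<open>Automorphisms and homogeneity\<close>

lemma FormI: "fm_in L \<phi> \<Longrightarrow> pars \<phi> \<subseteq> A \<Longrightarrow> fv \<phi> \<subseteq> x \<Longrightarrow> \<phi> \<in> Form L A x"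
  by (simp add: Form_def)

lemma FormD:
  assumes "\<phi> \<in> Form L A x"
  shows "fm_in L \<phi>" "pars \<phi> \<subseteq> A" "fv \<phi> \<subseteq> x"
  using assms by (auto simp: Form_def)

lemma Form_mono: "A \<subseteq> B \<Longrightarrow> x \<subseteq> y \<Longrightarrow> Form L A x \<subseteq> Form L B y"
  by (auto simp: Form_def)

lemma Neg_in_Form [simp]: "Neg \<phi> \<in> Form L A x \<longleftrightarrow> \<phi> \<in> Form L A x"
  by (simp add: Form_def)

lemma Conj_in_Form [simp]: "Conj \<phi> \<psi> \<in> Form L A x \<longleftrightarrow> \<phi> \<in> Form L A x \<and> \<psi> \<in> Form L A x"
  by (auto simp: Form_def)

lemma Exi_in_Form: "\<phi> \<in> Form L A (insert v x) \<Longrightarrow> Exi v \<phi> \<in> Form L A x"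
  by (auto simp: Form_def)

lemma sat_single:
  assumes "\<phi> \<in> Form L A {v}"
  shows "sat M e \<phi> \<longleftrightarrow> sat M (\<lambda>_. e v) \<phi>"
  using FormD(3)[OF assms] by (intro sat_cong) auto

lemma tm_eval_in_univ:
  assumes "is_struct L M" "tm_in L t" "tpars t \<subseteq> univ M" "\<forall>v\<in>tvars t. e v \<in> univ M"
  shows "tm_eval M e t \<in> univ M"
  using assms(2-)
proof (induction t)
  case (Fn f ts)
  have "set (map (tm_eval M e) ts) \<subseteq> univ M" using Fn.prems by (auto intro!: Fn.IH)
  moreover have "(f, length (map (tm_eval M e) ts)) \<in> funs L" using Fn.prems by simp
  ultimately have "fint M f (map (tm_eval M e) ts) \<in> univ M"
    using assms(1) unfolding is_struct_def by blast
  then show ?case by simp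
qed auto

lemma automorphism_tm_eval:
  assumes "is_struct L M" "automorphism L M g"
    and "tm_in L t" "tpars t \<subseteq> univ M" "\<forall>v\<in>tvars t. e v \<in> univ M"
  shows "tm_eval M (\<lambda>v. g (e v)) (map_tm id g t) = g (tm_eval M e t)"
  using assms(3-)
proof (induction t)
  case (Fn f ts)
  let ?as = "map (tm_eval M e) ts"
  have "set ?as \<subseteq> univ M" using Fn.prems by (auto intro!: tm_eval_in_univ[OF assms(1)])
  moreover have "(f, length ?as) \<in> funs L" using Fn.prems by simp
  ultimately have "g (fint M f ?as) = fint M f (map g ?as)"
    using assms(2) unfolding automorphism_def by blast
  moreover have "map (\<lambda>t. tm_eval M (\<lambda>v. g (e v)) (map_tm id g t)) ts = map (\<lambda>t. g (tm_eval M e t)) ts"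
    using Fn.prems by (intro map_cong refl Fn.IH) auto
  ultimately show ?case by (simp only: tm.map tm_eval.simps map_map o_def)
qed auto

lemma automorphism_sat:
  assumes M: "is_struct L M" and g: "automorphism L M g"
    and "fm_in L \<phi>" "pars \<phi> \<subseteq> univ M" "\<forall>v\<in>fv \<phi>. e v \<in> univ M"
  shows "sat M (\<lambda>v. g (e v)) (map_fm id g \<phi>) \<longleftrightarrow> sat M e \<phi>"
  using assms(3-)
proof (induction \<phi> arbitrary: e)
  case (Eq s t)
  have "tm_eval M e s \<in> univ M" "tm_eval M e t \<in> univ M"
    using Eq by (auto intro!: tm_eval_in_univ[OF M])
  moreover have "inj_on g (univ M)" using g by (auto simp: automorphism_def bij_betw_def)
  moreover have "tm_eval M (\<lambda>v. g (e v)) (map_tm id g s) = g (tm_eval M e s)"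
    "tm_eval M (\<lambda>v. g (e v)) (map_tm id g t) = g (tm_eval M e t)"
    using Eq by (auto intro!: automorphism_tm_eval[OF M g])
  ultimately show ?case by (simp only: fm.map sat.simps inj_on_eq_iff)
next
  case (Rel r ts)
  let ?as = "map (tm_eval M e) ts"
  have "set ?as \<subseteq> univ M" using Rel.prems by (auto intro!: tm_eval_in_univ[OF M])
  moreover have "(r, length ?as) \<in> rels L" using Rel.prems by simp
  ultimately have "rint M r ?as = rint M r (map g ?as)"
    using g unfolding automorphism_def by blast
  moreover have "map (\<lambda>t. tm_eval M (\<lambda>v. g (e v)) (map_tm id g t)) ts = map (\<lambda>t. g (tm_eval M e t)) ts"
    using Rel.prems by (intro map_cong refl automorphism_tm_eval[OF M g]) auto
  ultimately show ?case by (simp only: fm.map sat.simps map_map o_def)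
next
  case (Neg \<phi>)
  then show ?case by (simp del: id_apply)
next
  case (Conj \<phi> \<psi>)
  have "sat M (\<lambda>v. g (e v)) (map_fm id g \<phi>) = sat M e \<phi>"
    using Conj.prems by (intro Conj.IH) auto
  moreover have "sat M (\<lambda>v. g (e v)) (map_fm id g \<psi>) = sat M e \<psi>"
    using Conj.prems by (intro Conj.IH) auto
  ultimately show ?case by (simp only: fm.map sat.simps)
next
  case (Exi v \<phi>)
  let ?e = "\<lambda>u. g (e u)"
  have *: "sat M (?e(id v := g a)) (map_fm id g \<phi>) = sat M (e(v := a)) \<phi>" if "a \<in> univ M" for a
  proof -
    have "sat M (\<lambda>u. g ((e(v := a)) u)) (map_fm id g \<phi>) = sat M (e(v := a)) \<phi>"
      using Exi.prems that by (intro Exi.IH) auto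
    moreover have "(\<lambda>u. g ((e(v := a)) u)) = ?e(id v := g a)" by auto
    ultimately show ?thesis by simp
  qed
  have "g ` univ M = univ M" using g by (auto simp: automorphism_def bij_betw_def)
  then have "(\<exists>a\<in>univ M. sat M (?e(id v := a)) (map_fm id g \<phi>)) \<longleftrightarrow>
      (\<exists>a\<in>univ M. sat M (?e(id v := g a)) (map_fm id g \<phi>))"
    by (metis (no_types, lifting) image_iff)
  then show ?case using * by (auto simp only: fm.map sat.simps)
qed

lemma automorphism_in_univ: "automorphism L M g \<Longrightarrow> a \<in> univ M \<Longrightarrow> g a \<in> univ M"
  by (auto simp: automorphism_def bij_betw_def)

lemma automorphism_inj: "automorphism L M g \<Longrightarrow> inj_on g (univ M)"
  by (auto simp: automorphism_def bij_betw_def)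

lemma automorphism_surj: "automorphism L M g \<Longrightarrow> g ` univ M = univ M"
  by (auto simp: automorphism_def bij_betw_def)


section \<open>Composition and inverses of automorphisms\<close>

lemma automorphismI:
  assumes "bij_betw g (univ M) (univ M)"
    and "\<And>f as. (f, length as) \<in> funs L \<Longrightarrow> set as \<subseteq> univ M \<Longrightarrow> g (fint M f as) = fint M f (map g as)"
    and "\<And>r as. (r, length as) \<in> rels L \<Longrightarrow> set as \<subseteq> univ M \<Longrightarrow> rint M r as = rint M r (map g as)"
  shows "automorphism L M g"
  using assms unfolding automorphism_def by auto

lemma automorphismD:
  assumes "automorphism L M g"
  shows "bij_betw g (univ M) (univ M)"
    and "\<And>f as. (f, length as) \<in> funs L \<Longrightarrow> set as \<subseteq> univ M \<Longrightarrow> g (fint M f as) = fint M f (map g as)"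
    and "\<And>r as. (r, length as) \<in> rels L \<Longrightarrow> set as \<subseteq> univ M \<Longrightarrow> rint M r as = rint M r (map g as)"
  using assms unfolding automorphism_def by auto

lemma automorphism_comp:
  assumes g: "automorphism L M g" and h: "automorphism L M h"
  shows "automorphism L M (\<lambda>a. g (h a))"
proof (rule automorphismI)
  show "bij_betw (\<lambda>a. g (h a)) (univ M) (univ M)"
    using bij_betw_trans[OF automorphismD(1)[OF h] automorphismD(1)[OF g]] by (simp add: o_def)
next
  fix f as assume as: "(f, length as) \<in> funs L" "set as \<subseteq> univ M"
  have "set (map h as) \<subseteq> univ M" using as(2) automorphism_in_univ[OF h] by auto
  then have "g (fint M f (map h as)) = fint M f (map g (map h as))"
    using as(1) by (intro automorphismD(2)[OF g]) simp_all
  then show "g (h (fint M f as)) = fint M f (map (\<lambda>a. g (h a)) as)"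
    using automorphismD(2)[OF h as] by (simp add: o_def)
next
  fix r as assume as: "(r, length as) \<in> rels L" "set as \<subseteq> univ M"
  have "set (map h as) \<subseteq> univ M" using as(2) automorphism_in_univ[OF h] by auto
  then have "rint M r (map h as) = rint M r (map g (map h as))"
    using as(1) by (intro automorphismD(3)[OF g]) simp_all
  then show "rint M r as = rint M r (map (\<lambda>a. g (h a)) as)"
    using automorphismD(3)[OF h as] by (simp add: o_def)
qed

lemma automorphism_inv:
  assumes M: "is_struct L M" and g: "automorphism L M g"
  shows "automorphism L M (inv_into (univ M) g)" (is "automorphism L M ?h")
proof -
  have h_univ: "?h a \<in> univ M" "g (?h a) = a" if "a \<in> univ M" for a
    using that automorphism_surj[OF g] by (metis inv_into_into, metis f_inv_into_f)
  have hg: "?h (g a) = a" if "a \<in> univ M" for a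
    using that automorphism_inj[OF g] by simp
  have map_gh: "map g (map ?h as) = as" "set (map ?h as) \<subseteq> univ M" if "set as \<subseteq> univ M" for as
    using that h_univ by (auto intro!: map_idI)
  show ?thesis
  proof (rule automorphismI)
    show "bij_betw ?h (univ M) (univ M)" by (rule bij_betw_inv_into[OF automorphismD(1)[OF g]])
  next
    fix f as assume as: "(f, length as) \<in> funs L" "set as \<subseteq> univ M"
    have f: "(f, length (map ?h as)) \<in> funs L" using as by simp
    have "fint M f (map ?h as) \<in> univ M"
      using M f map_gh(2)[OF as(2)] unfolding is_struct_def by blast
    moreover have "g (fint M f (map ?h as)) = fint M f as"
      using automorphismD(2)[OF g f map_gh(2)[OF as(2)]] map_gh(1)[OF as(2)] by simp
    ultimately show "?h (fint M f as) = fint M f (map ?h as)" using hg by metis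
  next
    fix r as assume as: "(r, length as) \<in> rels L" "set as \<subseteq> univ M"
    have r: "(r, length (map ?h as)) \<in> rels L" using as by simp
    show "rint M r as = rint M r (map ?h as)"
      using automorphismD(3)[OF g r map_gh(2)[OF as(2)]] map_gh(1)[OF as(2)] by simp
  qed
qed

section \<open>Elementary properties of the closures\<close>

lemma acl_subset_univ: "acl V L M A \<subseteq> univ M"
  by (auto simp: acl_def)

lemma acl_mono: "A \<subseteq> B \<Longrightarrow> acl V L M A \<subseteq> acl V L M B"
  unfolding acl_def using Form_mono[OF _ subset_refl] by blast

lemma subset_acl: "A \<subseteq> univ M \<Longrightarrow> A \<subseteq> acl (V :: 'v itself) L M A"
proof
  fix a assume "A \<subseteq> univ M" "a \<in> A"
  moreover obtain v :: 'v where True by simp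
  ultimately show "a \<in> acl V L M A"
    by (auto simp: acl_def Form_def intro!: exI[of _ v] exI[of _ "Eq (Var v) (Par a)"])
qed

lemma dcl_subset_univ: "dcl V L M A \<subseteq> univ M"
  by (auto simp: dcl_def)

lemma dcl_mono: "A \<subseteq> B \<Longrightarrow> dcl V L M A \<subseteq> dcl V L M B"
  unfolding dcl_def using Form_mono[OF _ subset_refl] by blast

locale monster =
  fixes L :: "('f, 'r) lang"
    and T :: "('f, 'r, 'v, 'a) fm set"
    and \<kappa> :: "'k rel"
    and M :: "('f, 'r, 'a) fo_struct"
  assumes monster: "monster_model L T \<kappa> M"
begin


lemma M_struct: "is_struct L M"
  using monster by (auto simp: monster_model_def is_model_def)

lemma univ_nonempty: "univ M \<noteq> {}"
  using M_struct by (auto simp: is_struct_def)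

lemma Card_order_\<kappa>: "Card_order \<kappa>"
  and natLeq_less_\<kappa>: "natLeq <o \<kappa>"
  and small_funs: "small \<kappa> (funs L)"
  and small_rels: "small \<kappa> (rels L)"
  and \<kappa>_le_vars: "\<kappa> \<le>o |UNIV :: 'v set|"
  using monster by (auto simp: monster_model_def)

lemma saturation:
  fixes p :: "('f, 'r, 'v, 'a) fm set"
  assumes "A \<subseteq> univ M" "small \<kappa> A" "small \<kappa> x" "p \<subseteq> Form L A x" "fin_satisfiable M p"
  shows "satisfiable M p"
  using monster assms unfolding monster_model_def by blast

lemma extend_elementary:
  assumes "A \<subseteq> univ M" "small \<kappa> A" "elementary_on TYPE('v) L M A f"
  shows "\<exists>g. automorphism L M g \<and> (\<forall>a \<in> A. g a = f a)"
  using monster assms unfolding monster_model_def by blast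

section \<open>Small sets and fresh variables\<close>

lemma infinite_\<kappa>: "infinite (Field \<kappa>)"
proof
  assume "finite (Field \<kappa>)"
  then have "|Field \<kappa>| <o natLeq" by (metis finite_iff_ordLess_natLeq)
  moreover have "|Field \<kappa>| =o \<kappa>" by (rule card_of_Field_ordIso[OF Card_order_\<kappa>])
  ultimately show False using natLeq_less_\<kappa>
    by (meson not_ordLess_ordIso ordIso_ordLess_trans ordIso_symmetric ordLess_transitive)
qed

lemma small_subset: "small \<kappa> A \<Longrightarrow> B \<subseteq> A \<Longrightarrow> small \<kappa> B"
  unfolding small_def using card_of_mono1 ordLeq_ordLess_trans by blast

lemma small_image: "small \<kappa> A \<Longrightarrow> small \<kappa> (f ` A)"
  unfolding small_def using card_of_image ordLeq_ordLess_trans by blast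

lemma small_Un: "small \<kappa> A \<Longrightarrow> small \<kappa> B \<Longrightarrow> small \<kappa> (A \<union> B)"
  unfolding small_def using card_of_Un_ordLess_infinite_Field[OF infinite_\<kappa> Card_order_\<kappa>] by blast

lemma small_finite: "finite A \<Longrightarrow> small \<kappa> A"
  unfolding small_def using natLeq_less_\<kappa> finite_iff_ordLess_natLeq ordLess_transitive by blast

lemma small_UN: "finite I \<Longrightarrow> (\<And>i. i \<in> I \<Longrightarrow> small \<kappa> (A i)) \<Longrightarrow> small \<kappa> (\<Union>i\<in>I. A i)"
  by (induction I rule: finite_induct) (auto intro: small_Un small_finite)

lemma infinite_vars: "infinite (UNIV :: 'v set)"
  using small_finite[of "UNIV :: 'v set"] \<kappa>_le_vars not_ordLess_ordLeq unfolding small_def by blast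

lemma large_Compl:
  fixes X :: "'v set"
  assumes "small \<kappa> X"
  shows "\<not> small \<kappa> (- X)"
proof
  assume "small \<kappa> (- X)"
  then have "small \<kappa> (X \<union> - X)" using assms by (rule small_Un[rotated])
  then show False using \<kappa>_le_vars not_ordLess_ordLeq[of "|UNIV :: 'v set|" \<kappa>] by (simp add: small_def)
qed

lemma ex_fresh:
  fixes X :: "'v set"
  assumes "small \<kappa> X"
  shows "\<exists>z. z \<notin> X"
  using large_Compl[OF assms] small_finite by (metis Compl_iff finite.emptyI subset_empty subsetI)

text \<open>The complement of a small set of variables still has at least \<kappa> elements, so
  every small set embeds into it. This supplies the new variables of the extended system.\<close>

lemma ex_inj_fresh:
  fixes X :: "'v set"
  assumes "small \<kappa> X" "small \<kappa> Z"
  shows "\<exists>\<eta>. inj_on \<eta> Z \<and> \<eta> ` Z \<inter> X = {}"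
proof -
  have "\<kappa> \<le>o |- X|"
    using large_Compl[OF assms(1)] not_ordLess_iff_ordLeq[of \<kappa> "|- X|"] Card_order_\<kappa>
    by (auto simp: small_def card_order_on_def card_of_Well_order)
  then have "|Z| \<le>o |- X|"
    using assms(2) unfolding small_def by (meson ordLess_imp_ordLeq ordLeq_transitive)
  then obtain \<eta> where "inj_on \<eta> Z" "\<eta> ` Z \<subseteq> - X" unfolding card_of_ordLeq[symmetric] by blast
  then show ?thesis by blast
qed

lemma finite_vars_fresh:
  fixes X :: "'v set"
  assumes "finite X"
  shows "\<exists>z. z \<notin> X"
  using ex_new_if_finite[OF infinite_vars assms] by blast

section \<open>Tuples, parameters and homogeneity\<close>

text \<open>Every parameter outside \<open>A\<close> is an entry of \<open>b\<close>, and a variable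
  of \<open>x\<close> at which \<open>b\<close> takes that value is put in its place. The
  equivalence is stated for all assignments: at \<open>e = b\<close> the parameter map is the
  identity on the parameters of \<phi>, at another tuple it is the map induced by b u \<mapsto> e u.
  The map \<sigma> need not be injective.\<close>

lemma abstract_pars:
  fixes \<phi> :: "('f, 'r, 'v, 'a) fm" and b :: "'v \<Rightarrow> 'a" and \<sigma> :: "'v \<Rightarrow> 'v"
  assumes "\<phi> \<in> Form L (A \<union> b ` x) z"
  obtains \<phi>' where "\<phi>' \<in> Form L A (\<sigma> ` z \<union> x)"
    and "\<And>e. sat M e \<phi>' \<longleftrightarrow> sat M (\<lambda>v. e (\<sigma> v))
      (map_fm id (\<lambda>p. if p \<in> A then p else e (SOME u. u \<in> x \<and> b u = p)) \<phi>)"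
proof
  define \<tau> :: "'a \<Rightarrow> ('f, 'v, 'a) tm"
    where "\<tau> = (\<lambda>p. if p \<in> A then Par p else Var (SOME u. u \<in> x \<and> b u = p))"
  let ?\<phi> = "subst_fm (\<lambda>v. Var (\<sigma> v)) \<tau> \<phi>"
  have u: "(SOME u. u \<in> x \<and> b u = p) \<in> x" if "p \<in> pars \<phi>" "p \<notin> A" for p
  proof -
    have "\<exists>u. u \<in> x \<and> b u = p" using that FormD(2)[OF assms] by auto
    from someI_ex[OF this] show ?thesis by blast
  qed
  show "?\<phi> \<in> Form L A (\<sigma> ` z \<union> x)"
  proof (rule FormI)
    show "fm_in L ?\<phi>" using FormD(1)[OF assms] by (rule fm_in_subst) (auto simp: \<tau>_def)
    show "pars ?\<phi> \<subseteq> A"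
      by (rule order_trans[OF pars_subst]) (auto simp: \<tau>_def split: if_splits)
    show "fv ?\<phi> \<subseteq> \<sigma> ` z \<union> x"
      by (rule order_trans[OF fv_subst]) (use FormD(3)[OF assms] u in \<open>auto simp: \<tau>_def split: if_splits\<close>)
  qed
  show "sat M e ?\<phi> \<longleftrightarrow> sat M (\<lambda>v. e (\<sigma> v))
      (map_fm id (\<lambda>p. if p \<in> A then p else e (SOME u. u \<in> x \<and> b u = p)) \<phi>)" for e
  proof -
    have "(\<lambda>a. tm_eval M e (\<tau> a)) = (\<lambda>p. if p \<in> A then p else e (SOME u. u \<in> x \<and> b u = p))"
      by (auto simp: \<tau>_def)
    then show ?thesis using sat_subst_id[OF infinite_vars, of M e "\<lambda>v. Var (\<sigma> v)" \<tau> \<phi>] by simp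
  qed
qed

lemma valid_closed:
  fixes \<phi> :: "('f, 'r, 'v, 'a) fm"
  assumes "fv \<phi> = {}"
  shows "valid M \<phi> \<longleftrightarrow> sat M e \<phi>"
proof -
  obtain c where "c \<in> univ M" using univ_nonempty by blast
  then have "range (\<lambda>_::'v. c) \<subseteq> univ M" by auto
  then show ?thesis unfolding valid_def using sat_cong[of \<phi> _ e M] assms by (metis empty_iff)
qed

text \<open>The map that fixes \<open>A\<close> and sends \<open>b u\<close> to \<open>c u\<close>
  is well defined, since equations between two variables, or between a variable and a parameter, are
  among the transferred formulas. It is elementary because a sentence over \<open>A\<close> and the
  entries of \<open>b\<close> becomes a formula in \<open>x\<close> once the entries are turned back
  into variables; strong homogeneity extends it.\<close>

lemma homogeneity:
  fixes b c :: "'v \<Rightarrow> 'a"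
  assumes A: "A \<subseteq> univ M" "small \<kappa> A" and x: "small \<kappa> x"
    and b: "b ` x \<subseteq> univ M" and c: "c ` x \<subseteq> univ M"
    and imp: "\<And>\<phi>. \<phi> \<in> Form L A x \<Longrightarrow> sat M b \<phi> \<Longrightarrow> sat M c \<phi>"
  obtains g where "automorphism L M g" "\<And>a. a \<in> A \<Longrightarrow> g a = a" "\<And>u. u \<in> x \<Longrightarrow> g (b u) = c u"
proof -
  have iff: "sat M b \<phi> \<longleftrightarrow> sat M c \<phi>" if "\<phi> \<in> Form L A x" for \<phi>
    using imp[OF that] imp[of "Neg \<phi>"] that by auto
  define f where "f p = (if p \<in> A then p else c (SOME u. u \<in> x \<and> b u = p))" for p
  have f_b: "f (b u) = c u" if u: "u \<in> x" for u
  proof (cases "b u \<in> A")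
    case True
    then have "Eq (Var u) (Par (b u)) \<in> Form L A x" using u by (auto simp: Form_def)
    from imp[OF this] show ?thesis using True by (simp add: f_def)
  next
    case False
    define u' where "u' = (SOME u'. u' \<in> x \<and> b u' = b u)"
    have "\<exists>u'. u' \<in> x \<and> b u' = b u" using u by blast
    from someI_ex[OF this] have u': "u' \<in> x" "b u' = b u" by (auto simp: u'_def)
    then have "Eq (Var u') (Var u) \<in> Form L A x" using u by (auto simp: Form_def)
    from imp[OF this] show ?thesis using False u' by (simp add: f_def flip: u'_def)
  qed
  have "elementary_on TYPE('v) L M (A \<union> b ` x) f"
    unfolding elementary_on_def
  proof (intro conjI ballI)
    have "f ` A \<subseteq> univ M" using A by (auto simp: f_def)
    then show "f ` (A \<union> b ` x) \<subseteq> univ M" using c f_b by auto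
  next
    fix \<phi> :: "('f, 'r, 'v, 'a) fm" assume \<phi>: "\<phi> \<in> Form L (A \<union> b ` x) {}"
    obtain \<phi>' where \<phi>': "\<phi>' \<in> Form L A (id ` {} \<union> x)"
      "\<And>e. sat M e \<phi>' \<longleftrightarrow> sat M (\<lambda>v. e (id v))
      (map_fm id (\<lambda>p. if p \<in> A then p else e (SOME u. u \<in> x \<and> b u = p)) \<phi>)"
      using abstract_pars[OF \<phi>, of id] by blast
    have "map_fm id (\<lambda>p. if p \<in> A then p else b (SOME u. u \<in> x \<and> b u = p)) \<phi> = \<phi>"
    proof (rule map_fm_fixed)
      fix p assume "p \<in> pars \<phi>"
      then have "p \<in> A \<or> (\<exists>u. u \<in> x \<and> b u = p)" using FormD(2)[OF \<phi>] by auto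
      then show "(if p \<in> A then p else b (SOME u. u \<in> x \<and> b u = p)) = p"
        using someI_ex[of "\<lambda>u. u \<in> x \<and> b u = p"] by auto
    qed
    then have "sat M b \<phi>' \<longleftrightarrow> sat M b \<phi>" using \<phi>'(2)[of b] by simp
    moreover have "sat M c \<phi>' \<longleftrightarrow> sat M c (map_fm id f \<phi>)"
      using \<phi>'(2)[of c] by (simp add: f_def[abs_def])
    moreover have "fv \<phi> = {}" using FormD(3)[OF \<phi>] by simp
    moreover have "sat M b \<phi>' \<longleftrightarrow> sat M c \<phi>'" using \<phi>'(1) by (intro iff) simp
    ultimately show "valid M \<phi> \<longleftrightarrow> valid M (map_fm id f \<phi>)"
      using valid_closed[of \<phi> b] valid_closed[of "map_fm id f \<phi>" c] by simp
  qed
  moreover have "small \<kappa> (A \<union> b ` x)" using A x by (intro small_Un small_image)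
  moreover have "A \<union> b ` x \<subseteq> univ M" using A b by blast
  ultimately obtain g where g: "automorphism L M g" "\<forall>a \<in> A \<union> b ` x. g a = f a"
    using extend_elementary by blast
  then have "g a = a" if "a \<in> A" for a using that by (simp add: f_def)
  moreover have "g (b u) = c u" if "u \<in> x" for u
    using g(2) f_b[OF that] that by simp
  ultimately show thesis using that g(1) by blast
qed

lemma automorphism_elementary:
  assumes g: "automorphism L M g" and A: "A \<subseteq> univ M"
  shows "elementary_on TYPE('v) L M A g"
  unfolding elementary_on_def
proof (intro conjI ballI)
  show "g ` A \<subseteq> univ M" using automorphism_in_univ[OF g] A by blast
next
  fix \<phi> :: "('f, 'r, 'v, 'a) fm" assume \<phi>: "\<phi> \<in> Form L A {}"
  obtain c where "c \<in> univ M" using univ_nonempty by blast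
  then have "sat M (\<lambda>v. g c) (map_fm id g \<phi>) \<longleftrightarrow> sat M (\<lambda>_. c) \<phi>"
    using FormD[OF \<phi>] A by (intro automorphism_sat[OF M_struct g]) auto
  then show "valid M \<phi> \<longleftrightarrow> valid M (map_fm id g \<phi>)"
    using FormD(3)[OF \<phi>] valid_closed[of \<phi> "\<lambda>_. c"] valid_closed[of "map_fm id g \<phi>" "\<lambda>_. g c"]
    by simp
qed

end

section \<open>Algebraic closure\<close>

lemma ordLeq_finite: "infinite B \<Longrightarrow> finite A \<Longrightarrow> |A| \<le>o |B|"
  by (meson card_of_Well_order card_of_ordLeq_finite ordLeq_total)

lemma ordLeq_image: "|A| \<le>o |B| \<Longrightarrow> |f ` A| \<le>o |B|"
  using card_of_image ordLeq_transitive by blast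

lemma ordLeq_Un: "infinite B \<Longrightarrow> |A| \<le>o |B| \<Longrightarrow> |A'| \<le>o |B| \<Longrightarrow> |A \<union> A'| \<le>o |B|"
  using card_of_Un_ordLeq_infinite_Field[of "|B|" A A'] by (simp add: Field_card_of card_of_card_order_on)

lemma ordLeq_Times: "infinite B \<Longrightarrow> |A| \<le>o |B| \<Longrightarrow> |A'| \<le>o |B| \<Longrightarrow> |A \<times> A'| \<le>o |B|"
  using card_of_Times_ordLeq_infinite_Field[of "|B|" A A'] by (simp add: Field_card_of card_of_card_order_on)

lemma ordLeq_UN_nat:
  assumes "infinite B" "\<And>n :: nat. |A n| \<le>o |B|"
  shows "|\<Union>n. A n| \<le>o |B|"
  using assms by (intro card_of_UNION_ordLeq_infinite) (auto simp flip: infinite_iff_card_of_nat)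

lemma ordLeq_lists:
  assumes B: "infinite B" and X: "|X| \<le>o |B|"
  shows "|lists X| \<le>o |B|"
proof -
  have "|{xs \<in> lists X. length xs = n}| \<le>o |B|" for n
  proof (induction n)
    case (Suc n)
    have "{xs \<in> lists X. length xs = Suc n} \<subseteq>
        (\<lambda>(x, xs). x # xs) ` (X \<times> {xs \<in> lists X. length xs = n})"
      by (force simp: length_Suc_conv)
    then show ?case
      by (rule ordLeq_transitive[OF card_of_mono1]) (intro ordLeq_image ordLeq_Times B X Suc.IH)
  qed (rule ordLeq_finite[OF B], simp add: conj_commute cong: conj_cong)
  then have "|\<Union>n. {xs \<in> lists X. length xs = n}| \<le>o |B|" by (rule ordLeq_UN_nat[OF B])
  moreover have "lists X = (\<Union>n. {xs \<in> lists X. length xs = n})" by auto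
  ultimately show ?thesis by simp
qed

context monster
begin

section \<open>Orbits and algebraicity\<close>

text \<open>The pointwise stabilizer of \<open>A\<close> in the automorphism group. By
  \<open>finite_orbit\<close> and \<open>infinite_orbit\<close>, an element of the universe is
  algebraic over a small \<open>A\<close> exactly when its orbit under this group is finite.\<close>

definition fixer :: "'a set \<Rightarrow> ('a \<Rightarrow> 'a) set" where
  "fixer A = {g. automorphism L M g \<and> (\<forall>a\<in>A. g a = a)}"

lemma fixerD:
  assumes "g \<in> fixer A"
  shows "automorphism L M g" "\<And>a. a \<in> A \<Longrightarrow> g a = a"
  using assms by (auto simp: fixer_def)

lemma automorphism_sat_single:
  fixes \<phi> :: "('f, 'r, 'v, 'a) fm"
  assumes "automorphism L M g" "\<phi> \<in> Form L A {v}" "A \<subseteq> univ M" "c \<in> univ M"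
  shows "sat M (\<lambda>_. g c) (map_fm id g \<phi>) \<longleftrightarrow> sat M (\<lambda>_. c) \<phi>"
  using automorphism_sat[OF M_struct assms(1), of \<phi> "\<lambda>_. c"] FormD[OF assms(2)] assms(3,4) by blast

lemma automorphism_solutions:
  fixes \<phi> :: "('f, 'r, 'v, 'a) fm"
  assumes "automorphism L M g" "\<phi> \<in> Form L A {v}" "A \<subseteq> univ M"
  shows "{c \<in> univ M. sat M (\<lambda>_. c) (map_fm id g \<phi>)} = g ` {c \<in> univ M. sat M (\<lambda>_. c) \<phi>}"
proof (intro equalityI subsetI)
  fix d assume "d \<in> {c \<in> univ M. sat M (\<lambda>_. c) (map_fm id g \<phi>)}"
  moreover then obtain c where "c \<in> univ M" "d = g c" using automorphism_surj[OF assms(1)] by blast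
  ultimately show "d \<in> g ` {c \<in> univ M. sat M (\<lambda>_. c) \<phi>}"
    using automorphism_sat_single[OF assms] by auto
next
  fix d assume "d \<in> g ` {c \<in> univ M. sat M (\<lambda>_. c) \<phi>}"
  then show "d \<in> {c \<in> univ M. sat M (\<lambda>_. c) (map_fm id g \<phi>)}"
    using automorphism_sat_single[OF assms] automorphism_in_univ[OF assms(1)] by auto
qed

lemma map_fm_in_Form: "\<phi> \<in> Form L A x \<Longrightarrow> map_fm id g \<phi> \<in> Form L (g ` A) x"
  by (auto simp: Form_def fm.set_map)

text \<open>By homogeneity the orbit contains every realization of the type of \<open>a\<close> over
  \<open>A\<close>. Each formula of that type has infinitely many solutions because \<open>a\<close>
  is not algebraic. If the set \<open>R\<close> of realizations were finite, the type together with
  the inequations excluding \<open>R\<close> would be finitely satisfiable, and saturation would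
  yield one more realization.\<close>

lemma infinite_orbit:
  assumes A: "A \<subseteq> univ M" "small \<kappa> A" and a: "a \<in> univ M" "a \<notin> acl TYPE('v) L M A"
  shows "infinite ((\<lambda>g. g a) ` fixer A)"
proof
  assume fin: "finite ((\<lambda>g. g a) ` fixer A)"
  obtain v :: 'v where True by simp
  define p where "p = tp L M A {v} (\<lambda>_. a)"
  define R where "R = {r \<in> univ M. \<forall>\<phi>\<in>p. sat M (\<lambda>_. r) \<phi>}"
  have "R \<subseteq> (\<lambda>g. g a) ` fixer A"
  proof
    fix r assume r: "r \<in> R"
    obtain g where "automorphism L M g" "\<And>a. a \<in> A \<Longrightarrow> g a = a" "\<And>u. u \<in> {v} \<Longrightarrow> g a = r"
      by (rule homogeneity[OF A small_finite, of "{v}" "\<lambda>_. a" "\<lambda>_. r"])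
        (use a r in \<open>auto simp: R_def p_def tp_def\<close>)
    then show "r \<in> (\<lambda>g. g a) ` fixer A" by (auto simp: fixer_def)
  qed
  with fin have finR: "finite R" by (rule rev_finite_subset)
  define S where "S = p \<union> (\<lambda>r. Neg (Eq (Var v) (Par r))) ` R"
  have "satisfiable M S"
  proof (rule saturation)
    show "A \<union> R \<subseteq> univ M" using A by (auto simp: R_def)
    show "small \<kappa> (A \<union> R)" using small_Un[OF A(2) small_finite] finR by blast
    show "small \<kappa> {v}" by (simp add: small_finite)
    show "S \<subseteq> Form L (A \<union> R) {v}" by (auto simp: S_def p_def tp_def Form_def)
    show "fin_satisfiable M S"
      unfolding fin_satisfiable_def
    proof (intro allI impI)
      fix S0 assume S0: "S0 \<subseteq> S \<and> finite S0"
      have "S0 \<inter> p \<subseteq> Form L A {v}" by (auto simp: p_def tp_def)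
      from ex_bigconj[OF _ this] S0 obtain \<chi> where \<chi>: "\<chi> \<in> Form L A {v}"
        "\<And>e. sat M e \<chi> \<longleftrightarrow> (\<forall>\<phi>\<in>S0 \<inter> p. sat M e \<phi>)" using M_struct by blast
      have "sat M (\<lambda>_. a) \<chi>" unfolding \<chi>(2) by (auto simp: p_def tp_def)
      then have "infinite {b \<in> univ M. sat M (\<lambda>_. b) \<chi>}" using a \<chi>(1) by (auto simp: acl_def)
      from infinite_imp_nonempty[OF Diff_infinite_finite[OF finR this]]
      obtain b where b: "b \<in> univ M" "sat M (\<lambda>_. b) \<chi>" "b \<notin> R" by blast
      show "satisfiable M S0" unfolding satisfiable_def
        using b S0 \<chi>(2) by (intro exI[of _ "\<lambda>_. b"]) (auto simp: S_def)
    qed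
  qed
  then obtain e where e: "range e \<subseteq> univ M" "\<forall>\<phi>\<in>S. sat M e \<phi>" by (auto simp: satisfiable_def)
  have "\<forall>\<phi>\<in>p. sat M (\<lambda>_. e v) \<phi>"
    using e(2) sat_single[of _ L A v M e] by (auto simp: S_def p_def tp_def)
  then have "e v \<in> R" using e(1) by (auto simp: R_def)
  then have "Neg (Eq (Var v) (Par (e v))) \<in> S" by (auto simp: S_def)
  then show False using e(2) by fastforce
qed

lemma finite_orbit:
  assumes A: "A \<subseteq> univ M" and a: "a \<in> acl TYPE('v) L M A"
  shows "finite ((\<lambda>g. g a) ` fixer A)"
proof -
  obtain v :: 'v and \<phi> where \<phi>: "\<phi> \<in> Form L A {v}" "sat M (\<lambda>_. a) \<phi>"
    "finite {b \<in> univ M. sat M (\<lambda>_. b) \<phi>}" and a': "a \<in> univ M"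
    using a by (auto simp: acl_def)
  have "g a \<in> {b \<in> univ M. sat M (\<lambda>_. b) \<phi>}" if g: "g \<in> fixer A" for g
  proof -
    have "map_fm id g \<phi> = \<phi>" using FormD(2)[OF \<phi>(1)] fixerD(2)[OF g] by (intro map_fm_fixed) auto
    then show ?thesis
      using automorphism_sat_single[OF fixerD(1)[OF g] \<phi>(1) A a'] \<phi>(2)
        automorphism_in_univ[OF fixerD(1)[OF g] a'] by simp
  qed
  then show ?thesis by (intro finite_subset[OF _ \<phi>(3)]) blast
qed

text \<open>Orbits replace the construction of a formula over \<open>A\<close>: an automorphism over
  \<open>A\<close> moves \<open>f\<close> to one of finitely many elements, and the image of
  \<open>a\<close> then solves the formula in which \<open>f\<close> is replaced by that element.
  Each such solution set is an image of the original one, hence finite, so the orbit of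
  \<open>a\<close> is finite.\<close>

lemma acl_insert:
  assumes A: "A \<subseteq> univ M" "small \<kappa> A" and f: "f \<in> acl TYPE('v) L M A"
  shows "acl TYPE('v) L M (insert f A) \<subseteq> acl TYPE('v) L M A"
proof
  fix a assume a: "a \<in> acl TYPE('v) L M (insert f A)"
  obtain v :: 'v and \<phi> where \<phi>: "\<phi> \<in> Form L (insert f A) {v}" "sat M (\<lambda>_. a) \<phi>"
    "finite {b \<in> univ M. sat M (\<lambda>_. b) \<phi>}" and a': "a \<in> univ M"
    using a by (auto simp: acl_def)
  have fA: "insert f A \<subseteq> univ M" using subsetD[OF acl_subset_univ f] A by blast
  define Sol where "Sol f' = {b \<in> univ M. sat M (\<lambda>_. b) (map_fm id (id(f := f')) \<phi>)}" for f'
  have eq: "map_fm id g \<phi> = map_fm id (id(f := g f)) \<phi>" if "g \<in> fixer A" for g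
    using FormD(2)[OF \<phi>(1)] fixerD(2)[OF that] by (intro map_fm_cong_pars) auto
  have Sol: "Sol (g f) = g ` {b \<in> univ M. sat M (\<lambda>_. b) \<phi>}" if g: "g \<in> fixer A" for g
    using automorphism_solutions[OF fixerD(1)[OF g] \<phi>(1) fA] by (simp add: Sol_def eq[OF g])
  have "(\<lambda>g. g a) ` fixer A \<subseteq> (\<Union>f' \<in> (\<lambda>g. g f) ` fixer A. Sol f')"
    using Sol \<phi>(2) a' by auto
  moreover have "finite (\<Union>f' \<in> (\<lambda>g. g f) ` fixer A. Sol f')"
    using finite_orbit[OF A(1) f] Sol \<phi>(3) by (intro finite_UN_I) auto
  ultimately have "finite ((\<lambda>g. g a) ` fixer A)" by (rule finite_subset)
  then show "a \<in> acl TYPE('v) L M A" using infinite_orbit[OF A a'] by blast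
qed

text \<open>Only the finitely many parameters of one formula matter, and \<open>acl_insert\<close>
  absorbs them one at a time.\<close>

lemma acl_least:
  assumes A: "A \<subseteq> univ M" "small \<kappa> A" and B: "B \<subseteq> acl TYPE('v) L M A"
  shows "acl TYPE('v) L M B \<subseteq> acl TYPE('v) L M A"
proof
  fix a assume "a \<in> acl TYPE('v) L M B"
  then obtain v :: 'v and \<phi> where \<phi>: "\<phi> \<in> Form L B {v}" "sat M (\<lambda>_. a) \<phi>"
    "finite {b \<in> univ M. sat M (\<lambda>_. b) \<phi>}" and a': "a \<in> univ M"
    by (auto simp: acl_def)
  have fin: "acl TYPE('v) L M (F \<union> A) \<subseteq> acl TYPE('v) L M A" if "finite F" "F \<subseteq> B" for F
    using that
  proof (induction F rule: finite_induct)
    case (insert f F)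
    have "F \<subseteq> univ M" using insert.prems B acl_subset_univ[of "TYPE('v)" L M A] by blast
    then have "F \<union> A \<subseteq> univ M" using A(1) by blast
    moreover have "small \<kappa> (F \<union> A)" using small_Un[OF small_finite A(2)] insert.hyps by blast
    moreover have "f \<in> acl TYPE('v) L M (F \<union> A)"
      using insert.prems B acl_mono[of A "F \<union> A" "TYPE('v)" L M] by blast
    ultimately have "acl TYPE('v) L M (insert f (F \<union> A)) \<subseteq> acl TYPE('v) L M (F \<union> A)"
      by (rule acl_insert)
    also have "\<dots> \<subseteq> acl TYPE('v) L M A" using insert.prems by (intro insert.IH) simp
    finally show ?case by simp
  qed simp
  have "\<phi> \<in> Form L (pars \<phi> \<union> A) {v}" using \<phi>(1) by (auto simp: Form_def)
  then have "a \<in> acl TYPE('v) L M (pars \<phi> \<union> A)" using \<phi> a' by (auto simp: acl_def)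
  then show "a \<in> acl TYPE('v) L M A" using fin[of "pars \<phi>"] FormD(2)[OF \<phi>(1)] by auto
qed

lemma automorphism_acl_subset:
  assumes g: "automorphism L M g" and A: "A \<subseteq> univ M"
  shows "g ` acl TYPE('v) L M A \<subseteq> acl TYPE('v) L M (g ` A)"
proof clarify
  fix a assume "a \<in> acl TYPE('v) L M A"
  then obtain v :: 'v and \<phi> where \<phi>: "\<phi> \<in> Form L A {v}" "sat M (\<lambda>_. a) \<phi>"
    "finite {b \<in> univ M. sat M (\<lambda>_. b) \<phi>}" and a': "a \<in> univ M"
    by (auto simp: acl_def)
  have "finite {b \<in> univ M. sat M (\<lambda>_. b) (map_fm id g \<phi>)}"
    using \<phi>(3) by (simp only: automorphism_solutions[OF g \<phi>(1) A] finite_imageI)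
  then show "g a \<in> acl TYPE('v) L M (g ` A)"
    using map_fm_in_Form[OF \<phi>(1)] automorphism_sat_single[OF g \<phi>(1) A a'] \<phi>(2)
      automorphism_in_univ[OF g a'] unfolding acl_def by blast
qed

lemma automorphism_acl:
  assumes g: "automorphism L M g" and A: "A \<subseteq> univ M"
  shows "g ` acl TYPE('v) L M A = acl TYPE('v) L M (g ` A)"
proof
  show "g ` acl TYPE('v) L M A \<subseteq> acl TYPE('v) L M (g ` A)" by (rule automorphism_acl_subset[OF g A])
  let ?h = "inv_into (univ M) g"
  have gA: "g ` A \<subseteq> univ M" using automorphism_in_univ[OF g] A by blast
  have "?h ` g ` A = A" by (rule inv_into_image_cancel[OF automorphism_inj[OF g] A])
  then have h: "?h ` acl TYPE('v) L M (g ` A) \<subseteq> acl TYPE('v) L M A"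
    using automorphism_acl_subset[OF automorphism_inv[OF M_struct g] gA] by simp
  show "acl TYPE('v) L M (g ` A) \<subseteq> g ` acl TYPE('v) L M A"
  proof
    fix a assume a: "a \<in> acl TYPE('v) L M (g ` A)"
    have "a \<in> g ` univ M"
      using subsetD[OF acl_subset_univ a] by (simp only: automorphism_surj[OF g])
    then have "g (?h a) = a" by (rule f_inv_into_f)
    moreover have "?h a \<in> acl TYPE('v) L M A" using h a by blast
    ultimately show "a \<in> g ` acl TYPE('v) L M A" by (metis image_eqI)
  qed
qed

text \<open>Both maps turn the formula isolating \<open>d\<close> into the same formula, whose only
  solution is then the image of \<open>d\<close> under either map. This is the source of the
  coherence of the transports.\<close>

lemma automorphisms_agree_dcl:
  assumes g: "automorphism L M g" and h: "automorphism L M h" and A: "A \<subseteq> univ M"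
    and eq: "\<And>a. a \<in> A \<Longrightarrow> g a = h a" and d: "d \<in> dcl TYPE('v) L M A"
  shows "g d = h d"
proof -
  obtain v :: 'v and \<phi> where \<phi>: "\<phi> \<in> Form L A {v}" "{b \<in> univ M. sat M (\<lambda>_. b) \<phi>} = {d}"
    using d by (auto simp: dcl_def)
  have "map_fm id g \<phi> = map_fm id h \<phi>" using FormD(2)[OF \<phi>(1)] eq by (intro map_fm_cong_pars) auto
  then have "g ` {d} = h ` {d}"
    using automorphism_solutions[OF g \<phi>(1) A] automorphism_solutions[OF h \<phi>(1) A] \<phi>(2) by simp
  then show ?thesis by simp
qed

text \<open>Renaming all variables of a formula injectively into a fixed countable set leaves only as many
  formulas to count as there are symbols and parameters, however many variables the type \<open>'v\<close> has.\<close>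

lemma small_acl:
  assumes A: "small \<kappa> A"
  shows "small \<kappa> (acl TYPE('v) L M A)"
proof -
  obtain \<iota> :: "nat \<Rightarrow> 'v" where \<iota>: "inj \<iota>"
    using infinite_vars infinite_countable_subset by blast
  define N where "N = range \<iota>"
  \<comment> \<open>The summands are the variables, the parameters, the function symbols and the
    relation symbols. The infinite summand \<open>N\<close> lets |B| absorb finite unions, products
    and lists.\<close>
  define B where "B = (N <+> A) <+> (funs L <+> rels L)"
  have "|N| \<le>o natLeq" unfolding N_def
    using card_of_image card_of_nat ordLeq_ordIso_trans by blast
  then have "small \<kappa> N" unfolding small_def using natLeq_less_\<kappa> ordLeq_ordLess_trans by blast
  then have "small \<kappa> B"
    unfolding B_def small_def using A small_funs small_rels
    by (intro card_of_Plus_ordLess_infinite_Field[OF infinite_\<kappa> Card_order_\<kappa>]) (auto simp: small_def)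
  have "infinite N" unfolding N_def using \<iota> by (simp add: finite_image_iff)
  then have infB: "infinite B" unfolding B_def by (simp add: finite_Plus_iff)
  have le: "|N| \<le>o |B|" "|A| \<le>o |B|" "|funs L| \<le>o |B|" "|rels L| \<le>o |B|"
    unfolding B_def
    by (rule ordLeq_transitive[OF card_of_Plus1 card_of_Plus1]
        ordLeq_transitive[OF card_of_Plus2 card_of_Plus1]
        ordLeq_transitive[OF card_of_Plus1 card_of_Plus2]
        ordLeq_transitive[OF card_of_Plus2 card_of_Plus2])+
  define TS where "TS = {t :: ('f, 'v, 'a) tm. tm_in L t \<and> tvars t \<subseteq> N \<and> tpars t \<subseteq> A}"
  \<comment> \<open>Bound variables are confined to \<open>N\<close> as well; otherwise the size of
    the type of variables would enter the count.\<close>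
  define FS where "FS = {\<phi> :: ('f, 'r, 'v, 'a) fm. fm_in L \<phi> \<and> allvars \<phi> \<subseteq> N \<and> pars \<phi> \<subseteq> A}"
  \<comment> \<open>Stratifying by size turns the recursive datatype into a countable union of sets,
    each obtained from the previous one by finitely many constructors.\<close>
  have TSn: "|{t \<in> TS. size t < n}| \<le>o |B|" for n
  proof (induction n)
    case (Suc n)
    have size: "size t < n" if "size (Fn f ts) < Suc n" "t \<in> set ts"
      for f t and ts :: "('f, 'v, 'a) tm list"
      using that size_list_estimation'[of t ts "size t" size] by simp
    have "{t \<in> TS. size t < Suc n} \<subseteq> Var ` N \<union> Par ` A \<union>
      (\<lambda>(f, ts). Fn f ts) ` (fst ` funs L \<times> lists {t \<in> TS. size t < n})"
    proof
      fix t assume t: "t \<in> {t \<in> TS. size t < Suc n}"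
      show "t \<in> Var ` N \<union> Par ` A \<union>
        (\<lambda>(f, ts). Fn f ts) ` (fst ` funs L \<times> lists {t \<in> TS. size t < n})"
      proof (cases t)
        case (Fn f ts)
        have t': "tm_in L (Fn f ts)" "tvars (Fn f ts) \<subseteq> N" "tpars (Fn f ts) \<subseteq> A"
          "size (Fn f ts) < Suc n"
          using t by (simp_all add: TS_def flip: Fn)
        then have "(f, length ts) \<in> funs L" by simp
        then have "f \<in> fst ` funs L" by (rule image_eqI[rotated]) simp
        moreover have "u \<in> TS" if "u \<in> set ts" for u
        proof -
          have "tvars u \<subseteq> tvars (Fn f ts)" "tpars u \<subseteq> tpars (Fn f ts)" using that by auto
          then have "tvars u \<subseteq> N" "tpars u \<subseteq> A" using order_trans[OF _ t'(2)] order_trans[OF _ t'(3)] by auto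
          moreover have "tm_in L u" using t'(1) that by simp
          ultimately show ?thesis by (simp add: TS_def)
        qed
        then have "ts \<in> lists {t \<in> TS. size t < n}" using size[OF t'(4)] by (simp add: in_lists_conv_set)
        ultimately show ?thesis unfolding Fn by (intro UnI2 image_eqI[of _ _ "(f, ts)"]) simp_all
      qed (use t in \<open>auto simp: TS_def\<close>)
    qed
    then show ?case
      by (rule ordLeq_transitive[OF card_of_mono1])
        (intro ordLeq_Un ordLeq_image ordLeq_Times ordLeq_lists infB le Suc.IH)
  qed (simp add: ordLeq_finite infB)
  have "TS = (\<Union>n. {t \<in> TS. size t < n})" by auto
  then have TS: "|TS| \<le>o |B|" using ordLeq_UN_nat[OF infB, of "\<lambda>n. {t \<in> TS. size t < n}"] TSn by simp
  have FSn: "|{\<phi> \<in> FS. size \<phi> < n}| \<le>o |B|" for n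
  proof (induction n)
    case (Suc n)
    let ?F = "{\<phi> \<in> FS. size \<phi> < n}"
    have "{\<phi> \<in> FS. size \<phi> < Suc n} \<subseteq> (\<lambda>(s, t). Eq s t) ` (TS \<times> TS) \<union>
      (\<lambda>(r, ts). Rel r ts) ` (fst ` rels L \<times> lists TS) \<union> Neg ` ?F \<union>
      (\<lambda>(\<phi>, \<psi>). Conj \<phi> \<psi>) ` (?F \<times> ?F) \<union> (\<lambda>(v, \<phi>). Exi v \<phi>) ` (N \<times> ?F)"
    proof
      fix \<phi> assume \<phi>: "\<phi> \<in> {\<phi> \<in> FS. size \<phi> < Suc n}"
      show "\<phi> \<in> (\<lambda>(s, t). Eq s t) ` (TS \<times> TS) \<union>
        (\<lambda>(r, ts). Rel r ts) ` (fst ` rels L \<times> lists TS) \<union> Neg ` ?F \<union>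
        (\<lambda>(\<phi>, \<psi>). Conj \<phi> \<psi>) ` (?F \<times> ?F) \<union> (\<lambda>(v, \<phi>). Exi v \<phi>) ` (N \<times> ?F)"
      proof (cases \<phi>)
        case (Rel r ts)
        have \<phi>': "fm_in L (Rel r ts)" "allvars (Rel r ts) \<subseteq> N" "pars (Rel r ts) \<subseteq> A"
          using \<phi> by (simp_all add: FS_def flip: Rel)
        then have "(r, length ts) \<in> rels L" by simp
        then have "r \<in> fst ` rels L" by (rule image_eqI[rotated]) simp
        moreover have "u \<in> TS" if "u \<in> set ts" for u
        proof -
          have "tvars u \<subseteq> allvars (Rel r ts)" "tpars u \<subseteq> pars (Rel r ts)" using that by auto
          then have "tvars u \<subseteq> N" "tpars u \<subseteq> A" using order_trans[OF _ \<phi>'(2)] order_trans[OF _ \<phi>'(3)] by auto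
          moreover have "tm_in L u" using \<phi>'(1) that by simp
          ultimately show ?thesis by (simp add: TS_def)
        qed
        then have "ts \<in> lists TS" by (simp add: in_lists_conv_set)
        ultimately have "\<phi> \<in> (\<lambda>(r, ts). Rel r ts) ` (fst ` rels L \<times> lists TS)"
          unfolding Rel by (intro image_eqI[of _ _ "(r, ts)"]) simp_all
        then show ?thesis by (simp only: Un_iff simp_thms)
      next
        case (Eq s t)
        have "s \<in> TS" "t \<in> TS" using \<phi> Eq by (simp_all add: FS_def TS_def)
        then have "\<phi> \<in> (\<lambda>(s, t). Eq s t) ` (TS \<times> TS)"
          unfolding Eq by (intro image_eqI[of _ _ "(s, t)"]) simp_all
        then show ?thesis by (simp only: Un_iff simp_thms)
      next
        case (Neg \<psi>)
        then have "\<phi> \<in> Neg ` ?F" using \<phi> by (simp add: FS_def)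
        then show ?thesis by (simp only: Un_iff simp_thms)
      next
        case (Conj \<psi> \<chi>)
        have "\<psi> \<in> ?F" "\<chi> \<in> ?F" using \<phi> Conj by (simp_all add: FS_def)
        then have "\<phi> \<in> (\<lambda>(\<phi>, \<psi>). Conj \<phi> \<psi>) ` (?F \<times> ?F)"
          unfolding Conj by (intro image_eqI[of _ _ "(\<psi>, \<chi>)"]) simp_all
        then show ?thesis by (simp only: Un_iff simp_thms)
      next
        case (Exi v \<psi>)
        have "v \<in> N" "\<psi> \<in> ?F" using \<phi> Exi by (simp_all add: FS_def)
        then have "\<phi> \<in> (\<lambda>(v, \<phi>). Exi v \<phi>) ` (N \<times> ?F)"
          unfolding Exi by (intro image_eqI[of _ _ "(v, \<psi>)"]) simp_all
        then show ?thesis by (simp only: Un_iff simp_thms)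
      qed
    qed
    then show ?case
      by (rule ordLeq_transitive[OF card_of_mono1])
        (intro ordLeq_Un ordLeq_image ordLeq_Times ordLeq_lists infB le TS Suc.IH)
  qed (simp add: ordLeq_finite infB)
  have "FS = (\<Union>n. {\<phi> \<in> FS. size \<phi> < n})" by auto
  then have FS: "|FS| \<le>o |B|" using ordLeq_UN_nat[OF infB, of "\<lambda>n. {\<phi> \<in> FS. size \<phi> < n}"] FSn by simp
  \<comment> \<open>Infinite solution sets are replaced by the empty set, so that every member of
    the family is finite and the union stays below |B|.\<close>
  define Sol where "Sol \<phi> = (let S = {b \<in> univ M. sat M (\<lambda>_. b) \<phi>} in if finite S then S else {})"
    for \<phi> :: "('f, 'r, 'v, 'a) fm"
  have "acl TYPE('v) L M A \<subseteq> (\<Union>\<phi>\<in>FS. Sol \<phi>)"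
  proof
    fix a assume "a \<in> acl TYPE('v) L M A"
    then obtain v :: 'v and \<phi> where \<phi>: "\<phi> \<in> Form L A {v}" "sat M (\<lambda>_. a) \<phi>"
      "finite {b \<in> univ M. sat M (\<lambda>_. b) \<phi>}" and a': "a \<in> univ M"
      by (auto simp: acl_def)
    obtain \<pi> :: "'v \<Rightarrow> nat" where \<pi>: "inj_on \<pi> (allvars \<phi>)"
      using finite_imp_inj_to_nat_seg[OF finite_allvars[of \<phi>]] by blast
    let ?\<phi> = "map_fm (\<lambda>v. \<iota> (\<pi> v)) id \<phi>"
    have "inj_on (\<lambda>v. \<iota> (\<pi> v)) (allvars \<phi>)" using \<pi> \<iota> by (auto simp: inj_on_def inj_def)
    then have "sat M (\<lambda>_. b) ?\<phi> \<longleftrightarrow> sat M (\<lambda>_. b) \<phi>" for b by (rule sat_rename)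
    then have "a \<in> Sol ?\<phi>" using \<phi> a' by (simp add: Sol_def Let_def)
    moreover have "?\<phi> \<in> FS" using FormD[OF \<phi>(1)] by (auto simp: FS_def N_def fm.set_map)
    ultimately show "a \<in> (\<Union>\<phi>\<in>FS. Sol \<phi>)" by blast
  qed
  moreover have "|\<Union>\<phi>\<in>FS. Sol \<phi>| \<le>o |B|"
    by (rule card_of_UNION_ordLeq_infinite[OF infB FS]) (auto simp: Sol_def Let_def ordLeq_finite infB)
  ultimately have "|acl TYPE('v) L M A| \<le>o |B|" using card_of_mono1 ordLeq_transitive by blast
  then show ?thesis using \<open>small \<kappa> B\<close> unfolding small_def by (rule ordLeq_ordLess_trans)
qed

end

section \<open>Forking\<close>

context monster
begin

section \<open>Choosing the variable of an algebraic or defining formula\<close>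

lemma abstract_pars_single:
  fixes \<phi> :: "('f, 'r, 'v, 'a) fm" and b :: "'v \<Rightarrow> 'a"
  assumes \<phi>: "\<phi> \<in> Form L (A \<union> b ` x) {v}" and z: "z \<notin> x"
  obtains \<phi>' where "\<phi>' \<in> Form L A (insert z x)"
    and "\<And>c. sat M (b(z := c)) \<phi>' \<longleftrightarrow> sat M (\<lambda>_. c) \<phi>"
proof -
  obtain \<phi>' where \<phi>': "\<phi>' \<in> Form L A ((\<lambda>_. z) ` {v} \<union> x)"
    "\<And>e. sat M e \<phi>' \<longleftrightarrow> sat M (\<lambda>u. e z)
      (map_fm id (\<lambda>p. if p \<in> A then p else e (SOME u. u \<in> x \<and> b u = p)) \<phi>)"
    by (rule abstract_pars[OF \<phi>, of "\<lambda>_. z"]) (rule that)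
  have "sat M (b(z := c)) \<phi>' \<longleftrightarrow> sat M (\<lambda>_. c) \<phi>" for c
  proof -
    have "map_fm id (\<lambda>p. if p \<in> A then p else (b(z := c)) (SOME u. u \<in> x \<and> b u = p)) \<phi> = \<phi>"
    proof (rule map_fm_fixed)
      fix p assume "p \<in> pars \<phi>"
      then have "p \<in> A \<or> (\<exists>u. u \<in> x \<and> b u = p)" using FormD(2)[OF \<phi>] by auto
      then show "(if p \<in> A then p else (b(z := c)) (SOME u. u \<in> x \<and> b u = p)) = p"
        using someI_ex[of "\<lambda>u. u \<in> x \<and> b u = p"] z by auto
    qed
    then show ?thesis using \<phi>'(2)[of "b(z := c)"] by simp
  qed
  then show thesis using that[of \<phi>'] \<phi>'(1) by simp
qed

lemma rename_single:
  fixes \<phi> :: "('f, 'r, 'v, 'a) fm" and z :: 'v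
  assumes "\<phi> \<in> Form L A {v}"
  obtains \<phi>' where "\<phi>' \<in> Form L A {z}" "\<And>c. sat M (\<lambda>_. c) \<phi>' \<longleftrightarrow> sat M (\<lambda>_. c) \<phi>"
proof -
  have "\<phi> \<in> Form L (A \<union> undefined ` {}) {v}" using assms by simp
  from abstract_pars_single[OF this, of z] obtain \<phi>' where
    \<phi>': "\<phi>' \<in> Form L A {z}" "\<And>c. sat M (undefined(z := c)) \<phi>' \<longleftrightarrow> sat M (\<lambda>_. c) \<phi>"
    by auto
  have "sat M (\<lambda>_. c) \<phi>' \<longleftrightarrow> sat M (\<lambda>_. c) \<phi>" for c
    using \<phi>'(2)[of c] sat_single[OF \<phi>'(1), of M "undefined(z := c)"] by simp
  then show thesis using that \<phi>'(1) by blast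
qed

text \<open>The variable of the algebraic formula may be prescribed, in particular outside the
  variables of a given tuple.\<close>

lemma aclE:
  assumes "a \<in> acl TYPE('v) L M A"
  obtains \<phi> where "\<phi> \<in> Form L A {z :: 'v}" "sat M (\<lambda>_. a) \<phi>" "finite {b \<in> univ M. sat M (\<lambda>_. b) \<phi>}"
proof -
  obtain v :: 'v and \<phi> where \<phi>: "\<phi> \<in> Form L A {v}" "sat M (\<lambda>_. a) \<phi>"
    "finite {b \<in> univ M. sat M (\<lambda>_. b) \<phi>}"
    using assms by (auto simp: acl_def)
  obtain \<phi>' where "\<phi>' \<in> Form L A {z}" "\<And>c. sat M (\<lambda>_. c) \<phi>' \<longleftrightarrow> sat M (\<lambda>_. c) \<phi>"
    by (rule rename_single[OF \<phi>(1)]) (rule that)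
  then show thesis using that \<phi>(2,3) by simp
qed

lemma dclE:
  assumes "a \<in> dcl TYPE('v) L M A"
  obtains \<phi> where "\<phi> \<in> Form L A {z :: 'v}" "{b \<in> univ M. sat M (\<lambda>_. b) \<phi>} = {a}"
proof -
  obtain v :: 'v and \<phi> where \<phi>: "\<phi> \<in> Form L A {v}" "{b \<in> univ M. sat M (\<lambda>_. b) \<phi>} = {a}"
    using assms by (auto simp: dcl_def)
  obtain \<phi>' where "\<phi>' \<in> Form L A {z}" "\<And>c. sat M (\<lambda>_. c) \<phi>' \<longleftrightarrow> sat M (\<lambda>_. c) \<phi>"
    by (rule rename_single[OF \<phi>(1)]) (rule that)
  then show thesis using that \<phi>(2) by simp
qed

section \<open>Instances of formulas and the intersection of algebraic closures\<close>

lemma sat_instantiate: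
  fixes \<psi> :: "('f, 'r, 'v, 'a) fm"
  shows "sat M e (map_fm id g (subst_fm (Var(z := Par d)) Par \<psi>)) \<longleftrightarrow> sat M (e(z := g d)) (map_fm id g \<psi>)"
proof -
  have "(\<lambda>v. tm_eval M e (map_tm id g ((Var(z := Par d)) v))) = e(z := g d)" by auto
  moreover have "(\<lambda>a. tm_eval M e (map_tm id g (Par a))) = g" by auto
  ultimately show ?thesis
    using sat_subst[OF infinite_vars, of M e g "Var(z := Par d)" Par \<psi>] by simp
qed

text \<open>The formula says that the algebraic element \<open>e\<close> lies among the at most \<open>n\<close> solutions coded by
  the tuple; as \<open>e\<close> has infinitely many conjugates over \<open>A\<close>, it divides. Replacing \<open>e\<close> by a variable
  ranging over its finitely many conjugates over \<open>D\<close> gives a forking formula over \<open>D\<close>.\<close>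

lemma indep_acl_inter:
  fixes a :: "'v \<Rightarrow> 'a"
  assumes C: "C \<subseteq> univ M" "small \<kappa> C" and D: "D \<subseteq> univ M" "small \<kappa> D" and AD: "A \<subseteq> D"
    and x: "small \<kappa> x" and ind: "indep L M C x a D"
    and e1: "e \<in> acl TYPE('v) L M (C \<union> A \<union> a ` x)" and e2: "e \<in> acl TYPE('v) L M (C \<union> D)"
  shows "e \<in> acl TYPE('v) L M (C \<union> A)"
proof (rule ccontr)
  assume e: "e \<notin> acl TYPE('v) L M (C \<union> A)"
  have e_univ: "e \<in> univ M" using subsetD[OF acl_subset_univ e1] .
  have CA: "C \<union> A \<subseteq> univ M" "small \<kappa> (C \<union> A)"
    using C(1) D(1) AD small_Un[OF C(2) small_subset[OF D(2) AD]] by blast+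
  obtain z where z: "z \<notin> x" using ex_fresh[OF x] by blast
  obtain \<phi> where \<phi>: "\<phi> \<in> Form L (C \<union> A \<union> a ` x) {z}" "sat M (\<lambda>_. e) \<phi>"
    "finite {b \<in> univ M. sat M (\<lambda>_. b) \<phi>}" by (rule aclE[OF e1]) (rule that)
  define n where "n = card {b \<in> univ M. sat M (\<lambda>_. b) \<phi>}"
  obtain \<phi>' where \<phi>': "\<phi>' \<in> Form L (C \<union> A) (insert z x)"
    "\<And>c. sat M (a(z := c)) \<phi>' \<longleftrightarrow> sat M (\<lambda>_. c) \<phi>"
    by (rule abstract_pars_single[OF \<phi>(1) z]) (rule that)
  obtain \<theta> where \<theta>: "\<theta> \<in> Form L (C \<union> A) x"
    "\<And>e. sat M e \<theta> \<longleftrightarrow> (\<exists>S. finite S \<and> card S = Suc n \<and> S \<subseteq> {c \<in> univ M. sat M (e(z := c)) \<phi>'})"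
    using ex_at_least[OF infinite_vars \<phi>'(1), of "Suc n"] M_struct by blast
  \<comment> \<open>The conjunct \<open>Neg \<theta>\<close> bounds the number of solutions in
    \<open>z\<close> by \<open>n\<close> under every assignment of \<open>x\<close>, not only under
    \<open>a\<close>. Hence instances at n + 1 distinct elements cannot hold together.\<close>
  define \<psi> where "\<psi> = Conj \<phi>' (Neg \<theta>)"
  have \<psi>: "\<psi> \<in> Form L (C \<union> A) (insert z x)"
    using \<phi>'(1) subsetD[OF Form_mono[OF subset_refl subset_insertI] \<theta>(1)] by (simp add: \<psi>_def)
  have "\<not> sat M (a(z := e)) \<theta>"
  proof
    assume "sat M (a(z := e)) \<theta>"
    then obtain S where S: "card S = Suc n" "S \<subseteq> {b \<in> univ M. sat M (\<lambda>_. b) \<phi>}"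
      unfolding \<theta>(2) by (auto simp: \<phi>'(2))
    show False using card_mono[OF \<phi>(3) S(2)] S(1) by (simp add: n_def)
  qed
  then have sat_\<psi>: "sat M (a(z := e)) \<psi>" using \<phi>(2) by (simp add: \<psi>_def \<phi>'(2))
  obtain \<chi>0 where \<chi>0: "\<chi>0 \<in> Form L (C \<union> D) {z}" "sat M (\<lambda>_. e) \<chi>0"
    "finite {b \<in> univ M. sat M (\<lambda>_. b) \<chi>0}" by (rule aclE[OF e2]) (rule that)
  \<comment> \<open>An instance at an element algebraic over \<open>C \<union> A\<close> need not
    divide. Such solutions of \<open>\<chi>0\<close> are removed by negating one algebraic formula
    for each; there are finitely many, and \<open>e\<close> is not among the solutions of those
    formulas.\<close>
  define Bad where "Bad = {b \<in> univ M. sat M (\<lambda>_. b) \<chi>0} \<inter> acl TYPE('v) L M (C \<union> A)"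
  have "\<exists>\<eta>. \<eta> \<in> Form L (C \<union> A) {z} \<and> sat M (\<lambda>_. d) \<eta> \<and> finite {b \<in> univ M. sat M (\<lambda>_. b) \<eta>}"
    if "d \<in> Bad" for d
  proof -
    have "d \<in> acl TYPE('v) L M (C \<union> A)" using that by (simp add: Bad_def)
    then obtain \<eta> where "\<eta> \<in> Form L (C \<union> A) {z}" "sat M (\<lambda>_. d) \<eta>"
      "finite {b \<in> univ M. sat M (\<lambda>_. b) \<eta>}" by (rule aclE) (rule that)
    then show ?thesis by blast
  qed
  then have "\<forall>d\<in>Bad. \<exists>\<eta>. \<eta> \<in> Form L (C \<union> A) {z} \<and> sat M (\<lambda>_. d) \<eta> \<and>
      finite {b \<in> univ M. sat M (\<lambda>_. b) \<eta>}" by simp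
  from bchoice[OF this] obtain \<eta> where "\<forall>d\<in>Bad. \<eta> d \<in> Form L (C \<union> A) {z} \<and>
      sat M (\<lambda>_. d) (\<eta> d) \<and> finite {b \<in> univ M. sat M (\<lambda>_. b) (\<eta> d)}"
    by (elim exE) (rule that)
  then have \<eta>: "\<eta> d \<in> Form L (C \<union> A) {z}" "sat M (\<lambda>_. d) (\<eta> d)"
    "finite {b \<in> univ M. sat M (\<lambda>_. b) (\<eta> d)}" if "d \<in> Bad" for d
    using that by simp_all
  define S where "S = insert \<chi>0 ((\<lambda>d. Neg (\<eta> d)) ` Bad)"
  have "C \<union> A \<subseteq> C \<union> D" using AD by blast
  then have CACD: "Form L (C \<union> A) y \<subseteq> Form L (C \<union> D) y" for y :: "'v set" by (rule Form_mono) simp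
  have "finite S" using \<chi>0(3) by (simp add: S_def Bad_def)
  moreover have "S \<subseteq> Form L (C \<union> D) {z}" using \<chi>0(1) subsetD[OF CACD \<eta>(1)] by (auto simp: S_def)
  ultimately obtain \<chi> where \<chi>: "\<chi> \<in> Form L (C \<union> D) {z}"
    "\<And>e. sat M e \<chi> \<longleftrightarrow> (\<forall>\<phi>\<in>S. sat M e \<phi>)"
    using ex_bigconj[of S L "C \<union> D" "{z}"] M_struct by blast
  define Sol where "Sol = {b \<in> univ M. sat M (\<lambda>_. b) \<chi>}"
  have finSol: "finite Sol"
    by (rule finite_subset[OF _ \<chi>0(3)]) (auto simp: Sol_def \<chi>(2) S_def)
  have Sol: "d \<in> univ M" "d \<notin> acl TYPE('v) L M (C \<union> A)" if "d \<in> Sol" for d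
  proof -
    show "d \<in> univ M" using that by (simp add: Sol_def)
    show "d \<notin> acl TYPE('v) L M (C \<union> A)"
    proof
      assume "d \<in> acl TYPE('v) L M (C \<union> A)"
      then have "d \<in> Bad" using that by (simp add: Bad_def Sol_def \<chi>(2) S_def)
      then show False using that \<eta>(2)[of d] by (auto simp: Sol_def \<chi>(2) S_def)
    qed
  qed
  have "\<not> sat M (\<lambda>_. e) (\<eta> d)" if "d \<in> Bad" for d
  proof
    assume "sat M (\<lambda>_. e) (\<eta> d)"
    then have "e \<in> acl TYPE('v) L M (C \<union> A)"
      unfolding acl_def using \<eta>(1,3)[OF that] e_univ by auto
    then show False using e by simp
  qed
  then have sat_\<chi>: "sat M (\<lambda>_. e) \<chi>" using \<chi>0(2) by (auto simp: \<chi>(2) S_def)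
  define \<psi>i where "\<psi>i d = subst_fm (Var(z := Par d)) Par \<psi>" for d
  have \<psi>i: "\<psi>i d \<in> Form L (univ M) x" if "d \<in> univ M" for d
  proof (rule FormI)
    show "fm_in L (\<psi>i d)" unfolding \<psi>i_def using FormD(1)[OF \<psi>] by (rule fm_in_subst) auto
    show "pars (\<psi>i d) \<subseteq> univ M" unfolding \<psi>i_def
      by (rule order_trans[OF pars_subst]) (use that FormD(2)[OF \<psi>] CA(1) in \<open>auto split: if_splits\<close>)
    show "fv (\<psi>i d) \<subseteq> x" unfolding \<psi>i_def
      by (rule order_trans[OF fv_subst]) (use FormD(3)[OF \<psi>] in \<open>auto split: if_splits\<close>)
  qed
  have divides: "divides L M C (\<psi>i d)" if d: "d \<in> Sol" for d
  proof -
    \<comment> \<open>Infinitely many distinct conjugates of \<open>d\<close> over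
      \<open>C \<union> A\<close>; automorphisms realizing them serve as the elementary maps in the
      definition of dividing.\<close>
    obtain h :: "nat \<Rightarrow> 'a" where h: "inj h" "range h \<subseteq> (\<lambda>g. g d) ` fixer (C \<union> A)"
      using infinite_countable_subset[OF infinite_orbit[OF CA Sol[OF d]]] by blast
    then have "\<forall>i. \<exists>g. g \<in> fixer (C \<union> A) \<and> g d = h i" by (metis imageE range_subsetD)
    then obtain g where g: "\<And>i. g i \<in> fixer (C \<union> A)" "\<And>i. g i d = h i" by metis
    have h_univ: "h i \<in> univ M" for i
      using automorphism_in_univ[OF fixerD(1)[OF g(1)[of i]] Sol(1)[OF d]] by (simp add: g(2))
    have incons: "\<not> satisfiable M ((\<lambda>i. map_fm id (g i) (\<psi>i d)) ` I)"
      if I: "finite I" "card I = Suc n" for I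
    proof
      assume "satisfiable M ((\<lambda>i. map_fm id (g i) (\<psi>i d)) ` I)"
      then obtain e' where e': "\<And>i. i \<in> I \<Longrightarrow> sat M e' (map_fm id (g i) (\<psi>i d))"
        by (auto simp: satisfiable_def)
      have sat: "sat M (e'(z := h i)) \<psi>" if "i \<in> I" for i
      proof -
        have "map_fm id (g i) \<psi> = \<psi>"
          using FormD(2)[OF \<psi>] fixerD(2)[OF g(1)[of i]] by (intro map_fm_fixed) auto
        then show ?thesis using e'[OF that] by (simp add: \<psi>i_def sat_instantiate g(2))
      qed
      obtain i where i: "i \<in> I" using I by fastforce
      have "h ` I \<subseteq> {c \<in> univ M. sat M (e'(z := c)) \<phi>'}"
        using sat h_univ by (auto simp: \<psi>_def)
      moreover have "card (h ` I) = Suc n" using I h(1) by (simp add: card_image inj_on_subset)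
      ultimately have "sat M (e'(z := h i)) \<theta>"
        unfolding \<theta>(2) using I(1) by (intro exI[of _ "h ` I"]) simp
      then show False using sat[OF i] by (simp add: \<psi>_def)
    qed
    have "C \<union> pars (\<psi>i d) \<subseteq> univ M" using FormD(2)[OF \<psi>i[OF Sol(1)[OF d]]] C(1) by blast
    then have elem: "elementary_on TYPE('v) L M (C \<union> pars (\<psi>i d)) (g i)" for i
      by (rule automorphism_elementary[OF fixerD(1)[OF g(1)]])
    have "g i c = c" if "c \<in> C" for i c using fixerD(2)[OF g(1)] that by blast
    then show ?thesis unfolding divides_def
      using elem incons by (intro exI[of _ "Suc n"] exI[of _ g]) simp
  qed
  define \<Phi> where "\<Phi> = Exi z (Conj \<chi> \<psi>)"
  have "\<chi> \<in> Form L (C \<union> D) (insert z x)" using \<chi>(1) by (auto simp: Form_def)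
  moreover have "\<psi> \<in> Form L (C \<union> D) (insert z x)" using subsetD[OF CACD \<psi>] .
  ultimately have "\<Phi> \<in> Form L (C \<union> D) x" unfolding \<Phi>_def by (intro Exi_in_Form) simp
  moreover have "sat M (a(z := e)) \<chi>" using sat_\<chi> sat_single[OF \<chi>(1), of M "a(z := e)"] by simp
  then have "sat M a \<Phi>" using sat_\<psi> e_univ by (auto simp: \<Phi>_def)
  ultimately have \<Phi>: "\<Phi> \<in> tp L M (C \<union> D) x a" by (simp add: tp_def)
  have "\<exists>\<psi>'\<in>\<psi>i ` Sol. sat M e' \<psi>'" if e': "sat M e' \<Phi>" for e'
  proof -
    obtain c where c: "c \<in> univ M" "sat M (e'(z := c)) \<chi>" "sat M (e'(z := c)) \<psi>"
      using e' by (auto simp: \<Phi>_def)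
    then have "c \<in> Sol" using sat_single[OF \<chi>(1), of M "e'(z := c)"] by (simp add: Sol_def)
    moreover have "sat M e' (\<psi>i c)" using c(3) sat_instantiate[of e' id z c \<psi>] by (simp add: \<psi>i_def)
    ultimately show ?thesis by blast
  qed
  then have "forks L M C x (tp L M (C \<union> D) x a)"
    unfolding forks_def using finSol divides \<psi>i Sol(1) \<Phi>
    by (intro exI[of _ "\<psi>i ` Sol"] exI[of _ "{\<Phi>}"]) auto
  then show False using ind by (simp add: indep_def)
qed

section \<open>Independence and definable closure\<close>

text \<open>A parameter isolated by \<delta> over \<open>D\<close> can be replaced by a quantified
  variable constrained by \<delta>. The parameters of \<delta> lie in \<open>D\<close>, so no new
  ones arise and the induction removes \<open>F\<close> element by element.\<close>

lemma eliminate_dcl_pars: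
  fixes \<phi> :: "('f, 'r, 'v, 'a) fm"
  assumes "finite F" "F \<subseteq> dcl TYPE('v) L M D" "\<phi> \<in> Form L (F \<union> D) x"
  shows "\<exists>\<phi>' \<in> Form L D x. \<forall>e. sat M e \<phi>' \<longleftrightarrow> sat M e \<phi>"
  using assms
proof (induction F arbitrary: \<phi> rule: finite_induct)
  case (insert d F)
  obtain z where z: "z \<notin> fv \<phi>" using finite_vars_fresh[OF finite_fv] by blast
  have "d \<in> dcl TYPE('v) L M D" using insert.prems by simp
  then obtain \<delta> where \<delta>: "\<delta> \<in> Form L D {z}" "{b \<in> univ M. sat M (\<lambda>_. b) \<delta>} = {d}"
    by (rule dclE) (rule that)
  define \<phi>1 where "\<phi>1 = subst_fm Var (Par(d := Var z)) \<phi>"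
  have "fm_in L \<phi>1" unfolding \<phi>1_def using FormD(1)[OF insert.prems(2)] by (rule fm_in_subst) auto
  moreover have "pars \<phi>1 \<subseteq> F \<union> D" unfolding \<phi>1_def
    by (rule order_trans[OF pars_subst]) (use FormD(2)[OF insert.prems(2)] in \<open>auto split: if_splits\<close>)
  moreover have "fv \<phi>1 \<subseteq> insert z x" unfolding \<phi>1_def
    by (rule order_trans[OF fv_subst]) (use FormD(3)[OF insert.prems(2)] in \<open>auto split: if_splits\<close>)
  ultimately have "\<phi>1 \<in> Form L (F \<union> D) (insert z x)" by (rule FormI)
  moreover have "\<delta> \<in> Form L (F \<union> D) (insert z x)" using \<delta>(1) by (auto simp: Form_def)
  ultimately have "Exi z (Conj \<delta> \<phi>1) \<in> Form L (F \<union> D) x" by (intro Exi_in_Form) simp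
  then obtain \<phi>' where \<phi>': "\<phi>' \<in> Form L D x" "\<And>e. sat M e \<phi>' \<longleftrightarrow> sat M e (Exi z (Conj \<delta> \<phi>1))"
    using insert.IH insert.prems(1) by blast
  have "sat M e (Exi z (Conj \<delta> \<phi>1)) \<longleftrightarrow> sat M e \<phi>" for e
  proof -
    have "c \<in> univ M \<and> sat M (e(z := c)) \<delta> \<longleftrightarrow> c = d" for c
      using \<delta>(2) sat_single[OF \<delta>(1), of M "e(z := c)"] by auto
    moreover have "sat M e (Exi z (Conj \<delta> \<phi>1)) \<longleftrightarrow>
        (\<exists>c. (c \<in> univ M \<and> sat M (e(z := c)) \<delta>) \<and> sat M (e(z := c)) \<phi>1)" by auto
    ultimately have "sat M e (Exi z (Conj \<delta> \<phi>1)) \<longleftrightarrow> sat M (e(z := d)) \<phi>1" by simp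
    also have "\<dots> \<longleftrightarrow> sat M (\<lambda>v. (e(z := d)) v)
        (map_fm id (\<lambda>a. tm_eval M (e(z := d)) ((Par(d := Var z)) a)) \<phi>)"
      unfolding \<phi>1_def by (simp only: sat_subst_id[OF infinite_vars] tm_eval.simps)
    also have "map_fm id (\<lambda>a. tm_eval M (e(z := d)) ((Par(d := Var z)) a)) \<phi> = \<phi>"
      by (rule map_fm_fixed) auto
    also have "sat M (\<lambda>v. (e(z := d)) v) \<phi> \<longleftrightarrow> sat M e \<phi>" by (rule sat_cong) (use z in auto)
    finally show ?thesis .
  qed
  then show ?case using \<phi>' by blast
qed auto

text \<open>The finitely many formulas of the type in a forking witness are rewritten over
  \<open>C \<union> B\<close> with the same truth values; the dividing formulas stay as they
  are.\<close>

lemma indep_dcl_right: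
  fixes b :: "'v \<Rightarrow> 'a"
  assumes ind: "indep L M C x b B" and B': "B' \<subseteq> dcl TYPE('v) L M (C \<union> B)"
  shows "indep L M C x b B'"
  unfolding indep_def
proof
  assume "forks L M C x (tp L M (C \<union> B') x b)"
  then obtain D p0 where D: "finite D" "D \<subseteq> Form L (univ M) x" "\<forall>\<psi>\<in>D. divides L M C \<psi>"
    and p0: "finite p0" "p0 \<subseteq> tp L M (C \<union> B') x b"
      "\<forall>e. range e \<subseteq> univ M \<and> (\<forall>\<phi> \<in> p0. sat M e \<phi>) \<longrightarrow> (\<exists>\<psi> \<in> D. sat M e \<psi>)"
    unfolding forks_def by blast
  have "\<exists>\<phi>'. \<phi>' \<in> Form L (C \<union> B) x \<and> (\<forall>e. sat M e \<phi>' \<longleftrightarrow> sat M e \<phi>)" if "\<phi> \<in> p0" for \<phi>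
  proof -
    have \<phi>: "\<phi> \<in> Form L (C \<union> B') x" using p0(2) that by (auto simp: tp_def)
    then have "\<phi> \<in> Form L (pars \<phi> \<inter> B' \<union> (C \<union> B)) x" by (auto simp: Form_def)
    then show ?thesis using eliminate_dcl_pars[of "pars \<phi> \<inter> B'" "C \<union> B" \<phi> x] B' by auto
  qed
  then obtain t where t: "\<And>\<phi>. \<phi> \<in> p0 \<Longrightarrow> t \<phi> \<in> Form L (C \<union> B) x"
    "\<And>\<phi> e. \<phi> \<in> p0 \<Longrightarrow> sat M e (t \<phi>) \<longleftrightarrow> sat M e \<phi>" by metis
  have "t ` p0 \<subseteq> tp L M (C \<union> B) x b" using t p0(2) by (auto simp: tp_def)
  moreover have "\<forall>e. range e \<subseteq> univ M \<and> (\<forall>\<phi> \<in> t ` p0. sat M e \<phi>) \<longrightarrow> (\<exists>\<psi> \<in> D. sat M e \<psi>)"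
    using p0(3) t(2) by simp
  ultimately have "forks L M C x (tp L M (C \<union> B) x b)"
    unfolding forks_def using D finite_imageI[OF p0(1), of t] by (intro exI[of _ D] exI[of _ "t ` p0"]) simp
  then show False using ind by (simp add: indep_def)
qed

lemma elementary_on_subset:
  assumes f: "elementary_on TYPE('v) L M A f" and BA: "B \<subseteq> A"
  shows "elementary_on TYPE('v) L M B f"
  unfolding elementary_on_def
proof (intro conjI ballI)
  show "f ` B \<subseteq> univ M" using f BA by (auto simp: elementary_on_def)
next
  fix \<phi> :: "('f, 'r, 'v, 'a) fm" assume "\<phi> \<in> Form L B {}"
  then have "\<phi> \<in> Form L A {}" by (rule subsetD[OF Form_mono[OF BA subset_refl]])
  then show "valid M \<phi> \<longleftrightarrow> valid M (map_fm id f \<phi>)" using f by (simp add: elementary_on_def)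
qed

text \<open>The parameters of \<delta> lie in \<open>C\<close>, so every \<sigma> i leaves \<delta>
  unchanged. If several conjugates of the projected formula hold under one assignment, their
  witnesses for \<open>v\<close> all satisfy \<delta> and therefore coincide, which satisfies the
  same conjugates of \<psi> at once. Hence the same \<open>k\<close> and \<sigma> show
  dividing.\<close>

lemma divides_definable_var:
  fixes \<psi> :: "('f, 'r, 'v, 'a) fm"
  assumes div: "divides L M C \<psi>" and \<delta>: "pars \<delta> \<subseteq> C"
    and uniq: "\<And>e c c'. c \<in> univ M \<Longrightarrow> c' \<in> univ M \<Longrightarrow> sat M (e(v := c)) \<delta> \<Longrightarrow>
      sat M (e(v := c')) \<delta> \<Longrightarrow> c = c'"
  shows "divides L M C (Exi v (Conj \<delta> \<psi>))"
proof -
  obtain k and \<sigma> :: "nat \<Rightarrow> 'a \<Rightarrow> 'a" where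
    \<sigma>': "\<forall>i. elementary_on TYPE('v) L M (C \<union> pars \<psi>) (\<sigma> i) \<and> (\<forall>c\<in>C. \<sigma> i c = c)" and
    incons': "\<forall>I. finite I \<and> card I = k \<longrightarrow> \<not> satisfiable M ((\<lambda>i. map_fm id (\<sigma> i) \<psi>) ` I)"
    using div unfolding divides_def by (elim exE conjE) (rule that)
  have \<sigma>: "elementary_on TYPE('v) L M (C \<union> pars \<psi>) (\<sigma> i)" "c \<in> C \<Longrightarrow> \<sigma> i c = c" for i c
    using \<sigma>' by simp_all
  have incons: "\<not> satisfiable M ((\<lambda>i. map_fm id (\<sigma> i) \<psi>) ` I)" if "finite I" "card I = k" for I
    using incons' that by simp
  have "elementary_on TYPE('v) L M (C \<union> pars (Exi v (Conj \<delta> \<psi>))) (\<sigma> i)" for i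
    using \<delta> by (intro elementary_on_subset[OF \<sigma>(1)]) auto
  moreover have "\<not> satisfiable M ((\<lambda>i. map_fm id (\<sigma> i) (Exi v (Conj \<delta> \<psi>))) ` I)"
    if I: "finite I" "card I = k" for I
  proof
    assume "satisfiable M ((\<lambda>i. map_fm id (\<sigma> i) (Exi v (Conj \<delta> \<psi>))) ` I)"
    then obtain e where e: "range e \<subseteq> univ M"
      "\<And>i. i \<in> I \<Longrightarrow> sat M e (map_fm id (\<sigma> i) (Exi v (Conj \<delta> \<psi>)))"
      by (auto simp: satisfiable_def simp del: fm.map sat.simps)
    have "\<exists>c \<in> univ M. sat M (e(v := c)) \<delta> \<and> sat M (e(v := c)) (map_fm id (\<sigma> i) \<psi>)"
      if i: "i \<in> I" for i
    proof -
      have "map_fm id (\<sigma> i) \<delta> = \<delta>" using \<delta> \<sigma>(2) by (intro map_fm_fixed) auto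
      moreover have "\<exists>c \<in> univ M. sat M (e(id v := c)) (map_fm id (\<sigma> i) \<delta>) \<and>
          sat M (e(id v := c)) (map_fm id (\<sigma> i) \<psi>)"
        using e(2)[OF i] by (simp only: fm.map sat.simps)
      ultimately show ?thesis by simp
    qed
    then obtain c where c: "\<And>i. i \<in> I \<Longrightarrow> c i \<in> univ M" "\<And>i. i \<in> I \<Longrightarrow> sat M (e(v := c i)) \<delta>"
      "\<And>i. i \<in> I \<Longrightarrow> sat M (e(v := c i)) (map_fm id (\<sigma> i) \<psi>)" by metis
    \<comment> \<open>The case \<open>I = {}\<close> arises for \<open>k = 0\<close>; there any
      element of the nonempty universe will do.\<close>
    obtain c0 where c0: "c0 \<in> univ M" "\<And>i. i \<in> I \<Longrightarrow> c i = c0"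
    proof (cases "I = {}")
      case True
      then show thesis using that univ_nonempty by blast
    next
      case False
      then obtain j where "j \<in> I" by blast
      then show thesis using that[of "c j"] c(1,2) uniq by metis
    qed
    have "range (e(v := c0)) \<subseteq> univ M" using e(1) c0(1) by auto
    moreover have "sat M (e(v := c0)) (map_fm id (\<sigma> i) \<psi>)" if "i \<in> I" for i
      using c(3)[OF that] c0(2)[OF that] by simp
    ultimately have "satisfiable M ((\<lambda>i. map_fm id (\<sigma> i) \<psi>) ` I)"
      unfolding satisfiable_def by (intro exI[of _ "e(v := c0)"]) simp
    then show False using incons[OF I] by simp
  qed
  ultimately show ?thesis unfolding divides_def using \<sigma>(2) by (intro exI[of _ k] exI[of _ \<sigma>]) simp
qed

text \<open>The variable \<open>v\<close> is quantified away, under the constraint \<delta> that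
  determines it, both in the finite part of the type and in the dividing formulas. The implication
  between them survives because the witness chosen for \<open>v\<close> on the left also serves on
  the right.\<close>

lemma forks_definable_var:
  fixes b :: "'v \<Rightarrow> 'a"
  assumes "forks L M C (insert v x) (tp L M (C \<union> B) (insert v x) b)"
    and C: "C \<subseteq> univ M" and bv: "b v \<in> dcl TYPE('v) L M (C \<union> b ` x)" and v: "v \<notin> x"
  shows "forks L M C x (tp L M (C \<union> B) x b)"
proof -
  obtain D p0 where D: "finite D" "D \<subseteq> Form L (univ M) (insert v x)" "\<forall>\<psi>\<in>D. divides L M C \<psi>"
    and p0: "finite p0" "p0 \<subseteq> tp L M (C \<union> B) (insert v x) b"
      "\<forall>e. range e \<subseteq> univ M \<and> (\<forall>\<phi> \<in> p0. sat M e \<phi>) \<longrightarrow> (\<exists>\<psi> \<in> D. sat M e \<psi>)"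
    using assms(1) unfolding forks_def by blast
  obtain \<delta>0 where \<delta>0: "\<delta>0 \<in> Form L (C \<union> b ` x) {v}" "{c \<in> univ M. sat M (\<lambda>_. c) \<delta>0} = {b v}"
    by (rule dclE[OF bv]) (rule that)
  obtain \<delta>1 where \<delta>1: "\<delta>1 \<in> Form L C (insert v x)"
    "\<And>c. sat M (b(v := c)) \<delta>1 \<longleftrightarrow> sat M (\<lambda>_. c) \<delta>0" by (rule abstract_pars_single[OF \<delta>0(1) v]) (rule that)
  obtain \<theta> where \<theta>: "\<theta> \<in> Form L C x"
    "\<And>e. sat M e \<theta> \<longleftrightarrow> (\<exists>S. finite S \<and> card S = 2 \<and> S \<subseteq> {c \<in> univ M. sat M (e(v := c)) \<delta>1})"
    using ex_at_least[OF infinite_vars \<delta>1(1), of 2] M_struct by blast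
  \<comment> \<open>The formula \<open>\<delta>1\<close> determines the value of \<open>v\<close>
    only when the other variables are interpreted by \<open>b\<close>. Excluding two solutions makes
    \<delta> functional under every assignment, as \<open>divides_definable_var\<close>
    demands.\<close>
  define \<delta> where "\<delta> = Conj \<delta>1 (Neg \<theta>)"
  have \<delta>: "\<delta> \<in> Form L C (insert v x)"
    using \<delta>1(1) subsetD[OF Form_mono[OF subset_refl subset_insertI] \<theta>(1)] by (simp add: \<delta>_def)
  have bv_univ: "b v \<in> univ M" using subsetD[OF dcl_subset_univ bv] .
  have "\<not> sat M b \<theta>"
  proof
    assume "sat M b \<theta>"
    then obtain S where S: "card S = 2" "S \<subseteq> {b v}" unfolding \<theta>(2) by (auto simp: \<delta>1(2) \<delta>0(2))
    from card_mono[OF _ S(2)] S(1) show False by simp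
  qed
  moreover have "sat M (b(v := b v)) \<delta>1" unfolding \<delta>1(2) using \<delta>0(2) by blast
  ultimately have sat_\<delta>: "sat M b \<delta>" by (simp add: \<delta>_def)
  have uniq: "c = c'" if c: "c \<in> univ M" "c' \<in> univ M" "sat M (e(v := c)) \<delta>" "sat M (e(v := c')) \<delta>" for e c c'
  proof (rule ccontr)
    assume "c \<noteq> c'"
    then have "sat M (e(v := c)) \<theta>" unfolding \<theta>(2) using c
      by (intro exI[of _ "{c, c'}"]) (simp add: \<delta>_def)
    then show False using c(3) by (simp add: \<delta>_def)
  qed
  define t where "t \<psi> = Exi v (Conj \<delta> \<psi>)" for \<psi>
  have t_Form: "t \<psi> \<in> Form L A x" if "\<psi> \<in> Form L A (insert v x)" "C \<subseteq> A" for \<psi> A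
    unfolding t_def using subsetD[OF Form_mono[OF that(2) subset_refl] \<delta>] that(1) by (intro Exi_in_Form) simp
  have "p0 \<subseteq> Form L (C \<union> B) (insert v x)" using p0(2) by (auto simp: tp_def)
  from ex_bigconj[OF p0(1) this] obtain \<chi> where \<chi>: "\<chi> \<in> Form L (C \<union> B) (insert v x)"
    "\<And>e. sat M e \<chi> \<longleftrightarrow> (\<forall>\<phi>\<in>p0. sat M e \<phi>)" using M_struct by blast
  have "sat M b \<chi>" using p0(2) by (auto simp: \<chi>(2) tp_def)
  then have "\<exists>c\<in>univ M. sat M (b(v := c)) (Conj \<delta> \<chi>)" using sat_\<delta> bv_univ by (intro bexI[of _ "b v"]) simp_all
  then have "t \<chi> \<in> tp L M (C \<union> B) x b" using t_Form[OF \<chi>(1)] by (simp add: tp_def t_def)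
  moreover have "t ` D \<subseteq> Form L (univ M) x" using t_Form[OF _ C] D(2) by auto
  moreover have "divides L M C (t \<psi>)" if "\<psi> \<in> D" for \<psi>
    unfolding t_def using D(3) that FormD(2)[OF \<delta>] uniq by (intro divides_definable_var) auto
  moreover have "\<exists>\<psi>\<in>t ` D. sat M e \<psi>" if e: "range e \<subseteq> univ M" "sat M e (t \<chi>)" for e
  proof -
    obtain c where c: "c \<in> univ M" "sat M (e(v := c)) \<delta>" "sat M (e(v := c)) \<chi>"
      using e(2) by (auto simp: t_def)
    have "range (e(v := c)) \<subseteq> univ M" using e(1) c(1) by auto
    moreover have "\<forall>\<phi>\<in>p0. sat M (e(v := c)) \<phi>" using c(3) \<chi>(2) by simp
    ultimately have "\<exists>\<psi>\<in>D. sat M (e(v := c)) \<psi>" using p0(3) by (simp only: simp_thms)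
    then obtain \<psi> where "\<psi> \<in> D" "sat M (e(v := c)) \<psi>" by blast
    then show ?thesis using c by (auto simp: t_def)
  qed
  ultimately show ?thesis unfolding forks_def using D(1)
    by (intro exI[of _ "t ` D"] exI[of _ "{t \<chi>}"]) auto
qed

text \<open>A forking witness mentions only finitely many variables of \<open>y\<close>. Those
  outside \<open>x\<close> are removed one at a time, each being definable over \<open>C\<close> and
  the entries at the variables that remain.\<close>

lemma indep_dcl_left:
  fixes b :: "'v \<Rightarrow> 'a"
  assumes ind: "indep L M C x b B" and C: "C \<subseteq> univ M"
    and xy: "x \<subseteq> y" and b_y: "b ` y \<subseteq> dcl TYPE('v) L M (C \<union> b ` x)"
  shows "indep L M C y b B"
  unfolding indep_def
proof
  assume "forks L M C y (tp L M (C \<union> B) y b)"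
  then obtain D p0 where D: "finite D" "D \<subseteq> Form L (univ M) y" "\<forall>\<psi>\<in>D. divides L M C \<psi>"
    and p0: "finite p0" "p0 \<subseteq> tp L M (C \<union> B) y b"
      "\<forall>e. range e \<subseteq> univ M \<and> (\<forall>\<phi> \<in> p0. sat M e \<phi>) \<longrightarrow> (\<exists>\<psi> \<in> D. sat M e \<psi>)"
    unfolding forks_def by blast
  define F where "F = (\<Union>\<phi>\<in>D \<union> p0. fv \<phi>)"
  have F: "finite F" using D(1) p0(1) by (simp add: F_def)
  have Fy: "F \<subseteq> y" using D(2) p0(2) by (auto simp: F_def tp_def Form_def)
  have "D \<subseteq> Form L (univ M) (F \<union> x)" using D(2) by (auto simp: F_def Form_def)
  moreover have "p0 \<subseteq> tp L M (C \<union> B) (F \<union> x) b" using p0(2) by (auto simp: F_def tp_def Form_def)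
  ultimately have "forks L M C (F \<union> x) (tp L M (C \<union> B) (F \<union> x) b)"
    unfolding forks_def using D p0 by blast
  with F Fy have "forks L M C x (tp L M (C \<union> B) x b)"
  proof (induction F rule: finite_induct)
    case (insert v F)
    show ?case
    proof (cases "v \<in> F \<union> x")
      case True
      then have "insert v F \<union> x = F \<union> x" by auto
      then show ?thesis using insert by simp
    next
      case False
      have "C \<union> b ` x \<subseteq> C \<union> b ` (F \<union> x)" by auto
      from dcl_mono[OF this, of "TYPE('v)" L M] have "b v \<in> dcl TYPE('v) L M (C \<union> b ` (F \<union> x))"
        using b_y insert.prems(1) by blast
      moreover have "forks L M C (insert v (F \<union> x)) (tp L M (C \<union> B) (insert v (F \<union> x)) b)"
        using insert.prems(2) by simp
      ultimately have "forks L M C (F \<union> x) (tp L M (C \<union> B) (F \<union> x) b)"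
        using forks_definable_var[OF _ C] False by blast
      then show ?thesis using insert by simp
    qed
  qed simp
  then show False using ind by (simp add: indep_def)
qed

end

section \<open>The algebraically closed system\<close>

lemma type_restrict_tp: "x \<subseteq> y \<Longrightarrow> type_restrict (tp L M A y b) x = tp L M A x b"
  by (auto simp: type_restrict_def tp_def Form_def)

lemma type_restrict_twice: "x \<subseteq> y \<Longrightarrow> type_restrict (type_restrict p y) x = type_restrict p x"
  by (auto simp: type_restrict_def)

lemma tp_cong: "(\<And>u. u \<in> x \<Longrightarrow> b u = c u) \<Longrightarrow> tp L M A x b = tp L M A x c"
  unfolding tp_def using sat_cong[of _ b c M] by (auto simp: Form_def subset_eq)

lemma complete_type_eq_tp:
  assumes "complete_type L M C x p" "realizes M x p b"
  shows "p = tp L M C x b"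
proof
  show "p \<subseteq> tp L M C x b" using assms by (auto simp: complete_type_def realizes_def tp_def)
  show "tp L M C x b \<subseteq> p"
  proof
    fix \<phi> assume \<phi>: "\<phi> \<in> tp L M C x b"
    then have "\<phi> \<in> p \<or> Neg \<phi> \<in> p" using assms(1) by (auto simp: complete_type_def tp_def)
    moreover have "Neg \<phi> \<notin> p" using assms(2) \<phi> by (auto simp: realizes_def tp_def)
    ultimately show "\<phi> \<in> p" by simp
  qed
qed

lemma complete_type_tp:
  assumes "b ` x \<subseteq> univ M" "univ M \<noteq> {}"
  shows "complete_type L M C x (tp L M C x b)"
proof -
  obtain c where c: "c \<in> univ M" using assms(2) by blast
  \<comment> \<open>Outside \<open>x\<close> the tuple \<open>b\<close> may take values outside the
    universe, so these values are redirected to \<open>c\<close>.\<close>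
  let ?e = "\<lambda>u. if u \<in> x then b u else c"
  have "range ?e \<subseteq> univ M" using assms(1) c by auto
  moreover have "sat M ?e \<phi>" if "\<phi> \<in> tp L M C x b" for \<phi>
    using that tp_cong[of x b ?e L M C] by (auto simp: tp_def)
  ultimately have "fin_satisfiable M (tp L M C x b)"
    unfolding fin_satisfiable_def satisfiable_def by blast
  then show ?thesis by (auto simp: complete_type_def tp_def)
qed

lemma complete_type_restrict:
  assumes "complete_type L M C y p" "x \<subseteq> y"
  shows "complete_type L M C x (type_restrict p x)"
proof -
  have "fin_satisfiable M (type_restrict p x)"
    using assms(1) unfolding complete_type_def fin_satisfiable_def type_restrict_def by blast
  moreover have "\<phi> \<in> type_restrict p x \<or> Neg \<phi> \<in> type_restrict p x" if "\<phi> \<in> Form L C x" for \<phi>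
  proof -
    have "\<phi> \<in> Form L C y" using that Form_mono[OF subset_refl assms(2)] by blast
    then have "\<phi> \<in> p \<or> Neg \<phi> \<in> p" using assms(1) by (simp add: complete_type_def)
    then show ?thesis using FormD(3)[OF that] by (auto simp: type_restrict_def)
  qed
  moreover have "type_restrict p x \<subseteq> Form L C x"
    using assms(1) by (auto simp: complete_type_def type_restrict_def Form_def)
  ultimately show ?thesis by (simp add: complete_type_def)
qed

text \<open>A forking witness for the smaller variables and parameters is also one for the larger
  type.\<close>

lemma indep_mono:
  assumes ind: "indep L M C y b B" and xy: "x \<subseteq> y" and B: "B' \<subseteq> B"
  shows "indep L M C x b B'"
  unfolding indep_def
proof
  assume "forks L M C x (tp L M (C \<union> B') x b)"
  then obtain D p0 where D: "finite D" "D \<subseteq> Form L (univ M) x" "\<forall>\<psi>\<in>D. divides L M C \<psi>"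
    and p0: "finite p0" "p0 \<subseteq> tp L M (C \<union> B') x b"
      "\<forall>e. range e \<subseteq> univ M \<and> (\<forall>\<phi> \<in> p0. sat M e \<phi>) \<longrightarrow> (\<exists>\<psi> \<in> D. sat M e \<psi>)"
    unfolding forks_def by blast
  have "D \<subseteq> Form L (univ M) y" using D(2) Form_mono[OF subset_refl xy] by blast
  moreover have "Form L (C \<union> B') x \<subseteq> Form L (C \<union> B) y" using B xy by (intro Form_mono) auto
  then have "p0 \<subseteq> tp L M (C \<union> B) y b" using p0(2) unfolding tp_def by blast
  ultimately have "forks L M C y (tp L M (C \<union> B) y b)"
    unfolding forks_def using D(1,3) p0(1,3) by (intro exI[of _ D] exI[of _ p0]) simp
  then show False using ind by (simp add: indep_def)
qed

lemma indep_cong: "(\<And>u. u \<in> x \<Longrightarrow> b u = c u) \<Longrightarrow> indep L M C x b B = indep L M C x c B"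
  unfolding indep_def using tp_cong[of x b c L M "C \<union> B"] by simp

context monster
begin

lemma ex_realization:
  fixes p :: "('f, 'r, 'v, 'a) fm set"
  assumes "C \<subseteq> univ M" "small \<kappa> C" "small \<kappa> x" "complete_type L M C x p"
  shows "\<exists>b. realizes M x p b"
proof -
  have "satisfiable M p" using assms by (intro saturation[of C x]) (auto simp: complete_type_def)
  then obtain e where e: "range e \<subseteq> univ M" "\<forall>\<phi> \<in> p. sat M e \<phi>" by (auto simp: satisfiable_def)
  then have "realizes M x p e" by (auto simp: realizes_def)
  then show ?thesis by blast
qed

lemma conjugate_realizations:
  fixes b c :: "'v \<Rightarrow> 'a"
  assumes "C \<subseteq> univ M" "small \<kappa> C" "small \<kappa> x" "b ` x \<subseteq> univ M" "realizes M x (tp L M C x b) c"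
  obtains h where "automorphism L M h" "\<And>a. a \<in> C \<Longrightarrow> h a = a" "\<And>u. u \<in> x \<Longrightarrow> h (b u) = c u"
proof -
  have "sat M c \<phi>" if "\<phi> \<in> Form L C x" "sat M b \<phi>" for \<phi>
    using assms(5) that by (simp add: realizes_def tp_def)
  moreover have "c ` x \<subseteq> univ M" using assms(5) by (simp add: realizes_def)
  ultimately show thesis using homogeneity[OF assms(1-4)] that by blast
qed

end

locale dcl_amalgamation = monster L T \<kappa> M
  for L :: "('f, 'r) lang"
    and T :: "('f, 'r, 'v, 'a) fm set"
    and \<kappa> :: "'k rel"
    and M :: "('f, 'r, 'a) fo_struct" +
  fixes C :: "'a set"
    and W :: "nat set set"
    and x :: "nat set \<Rightarrow> 'v set"
    and q :: "nat set \<Rightarrow> ('f, 'r, 'v, 'a) fm set"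
  assumes C: "C \<subseteq> univ M" "small \<kappa> C"
    and sys: "amalgamation_system L \<kappa> M C W x q"
    and acl_dcl: "\<And>w a. w \<in> W \<Longrightarrow> realizes M (x w) (q w) a \<Longrightarrow>
           acl TYPE('v) L M (C \<union> a ` x w) = dcl TYPE('v) L M (C \<union> a ` x w)"
    and acl_inter_tuple: "\<And>w a v. w \<in> W \<Longrightarrow> realizes M (x w) (q w) a \<Longrightarrow> v \<in> W \<Longrightarrow> v \<subseteq> w \<Longrightarrow>
           acl TYPE('v) L M (C \<union> a ` x v) \<inter> a ` x w = a ` x v"
begin

section \<open>The given system and intersections of its closures\<close>

lemma finite_W: "finite W"
  using sys by (simp add: amalgamation_system_def)

lemma W_subset: "w \<in> W \<Longrightarrow> v \<subseteq> w \<Longrightarrow> v \<in> W"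
  using sys by (simp add: amalgamation_system_def)

text \<open>All subsets of \<open>w\<close> belong to the finite family \<open>W\<close>, so
  \<open>Pow w\<close> is finite.\<close>

lemma finite_W_member: "w \<in> W \<Longrightarrow> finite w"
  using finite_subset[OF _ finite_W, of "Pow w"] W_subset by (auto simp: finite_Pow_iff)

lemma W_singletons: "w \<in> W \<Longrightarrow> {i \<in> w. {i} \<in> W} = w"
  using W_subset by auto

lemma conditions: "amalg_conditions L \<kappa> M C W x q"
  using sys by (simp add: amalgamation_system_def)

lemma small_x: "w \<in> W \<Longrightarrow> small \<kappa> (x w)"
  and complete_q: "w \<in> W \<Longrightarrow> complete_type L M C (x w) (q w)"
  and q_distinct: "w \<in> W \<Longrightarrow> u \<in> x w \<Longrightarrow> z \<in> x w \<Longrightarrow> u \<noteq> z \<Longrightarrow> Neg (Eq (Var u) (Var z)) \<in> q w"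
  and x_inter: "v \<in> W \<Longrightarrow> w \<in> W \<Longrightarrow> x v \<inter> x w = x (v \<inter> w)"
  and q_restrict: "v \<in> W \<Longrightarrow> w \<in> W \<Longrightarrow> v \<subseteq> w \<Longrightarrow> type_restrict (q w) (x v) = q v"
  using conditions unfolding amalg_conditions_def by simp_all

lemma
  assumes "w \<in> W" "realizes M (x w) (q w) b"
  shows q_indep: "indep_family L M C w (\<lambda>i. x {i}) b"
    and q_acl: "b ` x w \<subseteq> acl TYPE('v) L M (C \<union> (\<Union>i \<in> w. b ` x {i}))"
proof -
  have "\<forall>w \<in> W. \<forall>b. realizes M (x w) (q w) b \<longrightarrow>
      indep_family L M C {i \<in> w. {i} \<in> W} (\<lambda>i. x {i}) b \<and>
      b ` x w \<subseteq> acl TYPE('v) L M (C \<union> (\<Union>i \<in> {i \<in> w. {i} \<in> W}. b ` x {i}))"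
    using conditions unfolding amalg_conditions_def by (elim conjE)
  from this[rule_format, OF assms]
  show "indep_family L M C w (\<lambda>i. x {i}) b"
    "b ` x w \<subseteq> acl TYPE('v) L M (C \<union> (\<Union>i \<in> w. b ` x {i}))"
    unfolding W_singletons[OF assms(1)] by simp_all
qed

lemma x_mono: "w \<in> W \<Longrightarrow> v \<subseteq> w \<Longrightarrow> x v \<subseteq> x w"
  using x_inter[of v w] W_subset[of w v] by (auto simp: inf.absorb1)

lemma realizes_subset:
  assumes "w \<in> W" "v \<subseteq> w" "realizes M (x w) (q w) b"
  shows "realizes M (x v) (q v) b"
proof -
  have "q v \<subseteq> q w"
    using q_restrict[OF W_subset[OF assms(1,2)] assms(1,2)] by (auto simp: type_restrict_def)
  then show ?thesis using assms(3) x_mono[OF assms(1,2)] unfolding realizes_def by blast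
qed

lemma small_params:
  assumes "w \<in> W" "realizes M (x w) (q w) b"
  shows "C \<union> b ` x w \<subseteq> univ M" "small \<kappa> (C \<union> b ` x w)"
proof -
  have "b ` x w \<subseteq> univ M" using assms(2) by (simp add: realizes_def)
  then show "C \<union> b ` x w \<subseteq> univ M" using C(1) by blast
  show "small \<kappa> (C \<union> b ` x w)" by (rule small_Un[OF C(2) small_image[OF small_x[OF assms(1)]]])
qed

text \<open>Independence speaks only of the parts b_i, so closures of whole tuples are reduced to
  closures of unions of these parts.\<close>

lemma acl_tuple_eq:
  assumes "w \<in> W" "realizes M (x w) (q w) b"
  shows "acl TYPE('v) L M (C \<union> b ` x w) = acl TYPE('v) L M (C \<union> (\<Union>i \<in> w. b ` x {i}))"
proof
  have "x {i} \<subseteq> x w" if "i \<in> w" for i using that by (intro x_mono[OF assms(1)]) simp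
  then have sub: "(\<Union>i \<in> w. b ` x {i}) \<subseteq> b ` x w" by blast
  then show "acl TYPE('v) L M (C \<union> (\<Union>i \<in> w. b ` x {i})) \<subseteq> acl TYPE('v) L M (C \<union> b ` x w)"
    by (intro acl_mono) auto
  have le: "C \<union> (\<Union>i \<in> w. b ` x {i}) \<subseteq> C \<union> b ` x w" using sub by auto
  note small = order_trans[OF le small_params(1)[OF assms]] small_subset[OF small_params(2)[OF assms] le]
  have "C \<union> b ` x w \<subseteq> acl TYPE('v) L M (C \<union> (\<Union>i \<in> w. b ` x {i}))"
    using q_acl[OF assms] subset_acl[OF small(1), of "TYPE('v)" L] by auto
  then show "acl TYPE('v) L M (C \<union> b ` x w) \<subseteq> acl TYPE('v) L M (C \<union> (\<Union>i \<in> w. b ` x {i}))"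
    by (rule acl_least[OF small])
qed

text \<open>The indices of \<open>u - v\<close> are removed from \<open>u\<close> one at a time. For
  such an \<open>i\<close>, the part b_i is independent from all other parts together;
  \<open>e\<close> is algebraic over these other parts, since they include those of
  \<open>v\<close>, and \<open>indep_acl_inter\<close> drops b_i from the parts of \<open>u\<close>.
  When nothing is left to remove, \<open>u\<close> is contained in \<open>v\<close>.\<close>

lemma acl_inter:
  assumes w: "w \<in> W" and b: "realizes M (x w) (q w) b" and "u \<subseteq> w" "v \<subseteq> w"
    and e: "e \<in> acl TYPE('v) L M (C \<union> b ` x u)" "e \<in> acl TYPE('v) L M (C \<union> b ` x v)"
  shows "e \<in> acl TYPE('v) L M (C \<union> b ` x (u \<inter> v))"
proof -
  define P where "P u = (\<Union>i \<in> u. b ` x {i})" for u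
  have eq: "acl TYPE('v) L M (C \<union> b ` x u) = acl TYPE('v) L M (C \<union> P u)" if "u \<subseteq> w" for u
    unfolding P_def by (rule acl_tuple_eq[OF W_subset[OF w that] realizes_subset[OF w that b]])
  have "e \<in> acl TYPE('v) L M (C \<union> P (u \<inter> v))"
    if "u \<subseteq> w" "v \<subseteq> w" "e \<in> acl TYPE('v) L M (C \<union> P u)" "e \<in> acl TYPE('v) L M (C \<union> P v)" for u v
    using that
  proof (induction "card (u - v)" arbitrary: u)
    case 0
    then have "finite (u - v)" using finite_W_member[OF w] finite_subset by blast
    then have "u \<inter> v = u" using 0(1) by auto
    then show ?case using 0 by simp
  next
    case (Suc n)
    then obtain i where i: "i \<in> u - v" by (metis card.empty ex_in_conv nat.distinct(1))
    \<comment> \<open>Taking all indices of \<open>w\<close> except \<open>i\<close> makes one set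
      serve for both \<open>u - {i}\<close> and \<open>v\<close>, and it is exactly the set in the
      definition of an independent family.\<close>
    define D where "D = P (w - {i})"
    have "e \<in> acl TYPE('v) L M (C \<union> P (u - {i}))"
    proof (rule indep_acl_inter[OF C])
      have "x {j} \<subseteq> x w" if "j \<in> w" for j using that by (intro x_mono[OF w]) simp
      then have "D \<subseteq> C \<union> b ` x w" unfolding D_def P_def by blast
      then show "D \<subseteq> univ M" "small \<kappa> D"
        using small_params(1)[OF w b] small_subset[OF small_params(2)[OF w b]] by blast+
      show "P (u - {i}) \<subseteq> D" using Suc.prems(1) by (auto simp: D_def P_def)
      show "small \<kappa> (x {i})" using i Suc.prems(1) by (intro small_x W_subset[OF w]) auto
      show "indep L M C (x {i}) b D"
        using q_indep[OF w b] i Suc.prems(1) unfolding indep_family_def D_def P_def by blast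
      have "C \<union> P u \<subseteq> C \<union> P (u - {i}) \<union> b ` x {i}" by (auto simp: P_def)
      from subsetD[OF acl_mono[OF this] Suc.prems(3)]
      show "e \<in> acl TYPE('v) L M (C \<union> P (u - {i}) \<union> b ` x {i})" .
      have "C \<union> P v \<subseteq> C \<union> D" using Suc.prems(2) i by (auto simp: D_def P_def)
      from subsetD[OF acl_mono[OF this] Suc.prems(4)]
      show "e \<in> acl TYPE('v) L M (C \<union> D)" .
    qed
    moreover have "n = card (u - {i} - v)"
    proof -
      have "u - {i} - v = (u - v) - {i}" by auto
      then show ?thesis using Suc.hyps(2) i by simp
    qed
    moreover have "(u - {i}) \<inter> v = u \<inter> v" "u - {i} \<subseteq> w" using i Suc.prems(1) by auto
    ultimately show ?case using Suc.hyps(1)[of "u - {i}"] Suc.prems by auto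
  qed
  from this[OF assms(3,4)] e show ?thesis using eq assms(3,4) by (simp add: le_infI1)
qed

section \<open>Chosen realizations and the maps between their closures\<close>

definition rl :: "nat set \<Rightarrow> 'v \<Rightarrow> 'a" where
  "rl w = (SOME a. realizes M (x w) (q w) a)"

lemma rl: "w \<in> W \<Longrightarrow> realizes M (x w) (q w) (rl w)"
  unfolding rl_def using ex_realization[OF C small_x complete_q] by (rule someI_ex)

lemma rl_univ: "w \<in> W \<Longrightarrow> rl w ` x w \<subseteq> univ M"
  using rl by (simp add: realizes_def)

lemma q_eq_tp: "w \<in> W \<Longrightarrow> q w = tp L M C (x w) (rl w)"
  using complete_type_eq_tp[OF complete_q rl] .

lemma rl_inj: "w \<in> W \<Longrightarrow> inj_on (rl w) (x w)"
proof (rule inj_onI, rule ccontr)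
  fix u z assume "w \<in> W" "u \<in> x w" "z \<in> x w" "rl w u = rl w z" "u \<noteq> z"
  moreover from this have "Neg (Eq (Var u) (Var z)) \<in> q w" by (intro q_distinct)
  then have "sat M (rl w) (Neg (Eq (Var u) (Var z)))"
    using rl[OF \<open>w \<in> W\<close>] unfolding realizes_def by blast
  ultimately show False by simp
qed

lemma ex_transport:
  assumes "w \<in> W" "v \<subseteq> w"
  shows "\<exists>g. g \<in> fixer C \<and> (\<forall>u \<in> x v. g (rl v u) = rl w u)"
proof -
  have v: "v \<in> W" using W_subset assms by blast
  have "realizes M (x v) (tp L M C (x v) (rl v)) (rl w)"
    using realizes_subset[OF assms rl[OF assms(1)]] q_eq_tp[OF v] by simp
  then obtain g where "automorphism L M g" "\<And>a. a \<in> C \<Longrightarrow> g a = a" "\<And>u. u \<in> x v \<Longrightarrow> g (rl v u) = rl w u"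
    by (rule conjugate_realizations[OF C small_x[OF v] rl_univ[OF v]]) (rule that)
  then show ?thesis by (auto simp: fixer_def)
qed

text \<open>The automorphism is an arbitrary choice; only its restriction to acl (C a_v) is
  determined by the condition, and only that restriction composes coherently.\<close>

definition transport :: "nat set \<Rightarrow> nat set \<Rightarrow> 'a \<Rightarrow> 'a" where
  "transport v w = (SOME g. g \<in> fixer C \<and> (\<forall>u \<in> x v. g (rl v u) = rl w u))"

lemma
  assumes "w \<in> W" "v \<subseteq> w"
  shows transport: "transport v w \<in> fixer C"
    and transport_rl: "u \<in> x v \<Longrightarrow> transport v w (rl v u) = rl w u"
  using someI_ex[OF ex_transport[OF assms]] by (simp_all add: transport_def)

text \<open>The first index is the ambient one: \<open>cl w v\<close> is the copy, inside the
  closure of a_w, of the closure belonging to \<open>v\<close>.\<close>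

definition cl :: "nat set \<Rightarrow> nat set \<Rightarrow> 'a set" where
  "cl w v = acl TYPE('v) L M (C \<union> rl w ` x v)"

lemma cl_mono: "w \<in> W \<Longrightarrow> v \<subseteq> w \<Longrightarrow> u \<subseteq> v \<Longrightarrow> cl w u \<subseteq> cl w v"
  unfolding cl_def using x_mono[of v u] W_subset[of w v] by (intro acl_mono) auto

lemma cl_univ: "cl w v \<subseteq> univ M"
  unfolding cl_def by (rule acl_subset_univ)

lemma transport_cl:
  assumes w: "w \<in> W" and vw: "v \<subseteq> w" and uv: "u \<subseteq> v"
  shows "transport v w ` cl v u = cl w u"
proof -
  have v: "v \<in> W" using W_subset w vw by blast
  have xu: "x u \<subseteq> x v" by (rule x_mono[OF v uv])
  have "transport v w ` (C \<union> rl v ` x u) = C \<union> rl w ` x u"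
  proof -
    have "transport v w ` C = C" using fixerD(2)[OF transport[OF w vw]] by simp
    moreover have "transport v w ` rl v ` x u = rl w ` x u"
      unfolding image_image using transport_rl[OF w vw] xu by (intro image_cong) auto
    ultimately show ?thesis by (simp add: image_Un)
  qed
  moreover have "C \<union> rl v ` x u \<subseteq> univ M" using C(1) rl_univ[OF v] xu by blast
  ultimately show ?thesis
    unfolding cl_def using automorphism_acl[OF fixerD(1)[OF transport[OF w vw]]] by simp
qed

lemma transport_inj:
  assumes "w \<in> W" "v \<subseteq> w"
  shows "inj_on (transport v w) (univ M)"
  by (rule automorphism_inj[OF fixerD(1)[OF transport[OF assms]]])

text \<open>Both sides are automorphisms over \<open>C\<close> that agree on a_u, hence on its
  definable closure; by hypothesis this is all of \<open>cl u u\<close>.\<close>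

lemma transport_comp:
  assumes w: "w \<in> W" and vw: "v \<subseteq> w" and uv: "u \<subseteq> v" and n: "n \<in> cl u u"
  shows "transport v w (transport u v n) = transport u w n"
proof -
  have v: "v \<in> W" using W_subset w vw by blast
  have u: "u \<in> W" using W_subset v uv by blast
  have uw: "u \<subseteq> w" using uv vw by blast
  have "n \<in> dcl TYPE('v) L M (C \<union> rl u ` x u)"
    using n acl_dcl[OF u rl[OF u]] by (simp add: cl_def)
  moreover have "automorphism L M (\<lambda>a. transport v w (transport u v a))"
    by (rule automorphism_comp[OF fixerD(1)[OF transport[OF w vw]] fixerD(1)[OF transport[OF v uv]]])
  moreover have "transport v w (transport u v a) = transport u w a" if "a \<in> C \<union> rl u ` x u" for a
    using that
  proof
    assume "a \<in> C"
    then show ?thesis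
      using fixerD(2)[OF transport[OF w vw]] fixerD(2)[OF transport[OF v uv]]
        fixerD(2)[OF transport[OF w uw]] by simp
  next
    assume "a \<in> rl u ` x u"
    then obtain z where z: "z \<in> x u" "a = rl u z" by blast
    then have "z \<in> x v" using x_mono[OF v uv] by blast
    then show ?thesis using z transport_rl[OF w vw] transport_rl[OF v uv] transport_rl[OF w uw] by simp
  qed
  moreover have "C \<union> rl u ` x u \<subseteq> univ M" using C(1) rl_univ[OF u] by blast
  ultimately show ?thesis
    using automorphisms_agree_dcl[OF _ fixerD(1)[OF transport[OF w uw]]] by blast
qed

text \<open>The elements of \<open>acl (C a\<^sub>v)\<close> whose smallest support is \<open>v\<close>.\<close>

definition exact :: "nat set \<Rightarrow> 'a set" where
  "exact v = cl v v - (\<Union>u \<in> {u. u \<subset> v}. cl v u)"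

text \<open>A minimal \<open>v\<close> with \<open>e\<close> in \<open>cl w v\<close> exists because
  \<open>w\<close> is finite. Pulling \<open>e\<close> back along the transport gives
  \<open>n\<close>: a smaller support of \<open>n\<close> would be transported to a smaller support
  of \<open>e\<close>. That minimal supports are least is proved separately, in
  \<open>exact_support_subset\<close>.\<close>

lemma cl_support:
  assumes w: "w \<in> W" and e: "e \<in> cl w w"
  obtains v n where "v \<subseteq> w" "n \<in> exact v" "e = transport v w n"
proof -
  define S where "S = {v. v \<subseteq> w \<and> e \<in> cl w v}"
  have "finite S" using finite_W_member[OF w] by (simp add: S_def)
  moreover have "S \<noteq> {}" using e by (auto simp: S_def)
  ultimately obtain v where v: "v \<in> S" and min: "\<forall>u\<in>S. u \<subseteq> v \<longrightarrow> v = u"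
    using finite_has_minimal[of S] by blast
  have vw: "v \<subseteq> w" using v by (simp add: S_def)
  have "e \<in> transport v w ` cl v v" using v transport_cl[OF w vw subset_refl] by (simp add: S_def)
  then obtain n where n: "n \<in> cl v v" "e = transport v w n" by blast
  have "n \<notin> cl v u" if u: "u \<subset> v" for u
  proof
    assume "n \<in> cl v u"
    then have "e \<in> cl w u" using transport_cl[OF w vw psubset_imp_subset[OF u]] n(2) by blast
    then have "u \<in> S" using u vw by (auto simp: S_def)
    then show False using min u by blast
  qed
  then have "n \<in> exact v" using n(1) by (simp add: exact_def)
  then show thesis using n(2) by (rule that[OF vw])
qed

text \<open>If \<open>v\<close> were not contained in \<open>v'\<close>, then
  \<open>v \<inter> v'\<close> would be a proper subset of \<open>v\<close> and, by
  \<open>acl_inter\<close>, a support of the transported element. Injectivity of the transport would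
  pull this back to a smaller support of \<open>n\<close>.\<close>

lemma exact_support_subset:
  assumes w: "w \<in> W" and v: "v \<subseteq> w" "v' \<subseteq> w" and n: "n \<in> exact v" and e: "transport v w n \<in> cl w v'"
  shows "v \<subseteq> v'"
proof (rule ccontr)
  assume "\<not> v \<subseteq> v'"
  then have sub: "v \<inter> v' \<subset> v" by blast
  have n': "n \<in> cl v v" using n by (simp add: exact_def)
  have "transport v w n \<in> cl w v" using transport_cl[OF w v(1) subset_refl] n' by blast
  then have "transport v w n \<in> cl w (v \<inter> v')"
    using e unfolding cl_def by (rule acl_inter[OF w rl[OF w] v])
  then have "transport v w n \<in> transport v w ` cl v (v \<inter> v')"
    using transport_cl[OF w v(1), of "v \<inter> v'"] by simp
  then have "n \<in> cl v (v \<inter> v')"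
    using inj_on_image_mem_iff[OF transport_inj[OF w v(1)] subsetD[OF cl_univ n'] cl_univ] by simp
  then show False using n sub by (auto simp: exact_def)
qed

lemma exact_unique:
  assumes w: "w \<in> W" and v: "v \<subseteq> w" "v' \<subseteq> w" and n: "n \<in> exact v" "n' \<in> exact v'"
    and eq: "transport v w n = transport v' w n'"
  shows "v = v' \<and> n = n'"
proof -
  have h: "n \<in> cl v v" "n' \<in> cl v' v'" using n by (simp_all add: exact_def)
  have "transport v w n \<in> cl w v" using transport_cl[OF w v(1) subset_refl] h(1) by blast
  moreover have "transport v' w n' \<in> cl w v'" using transport_cl[OF w v(2) subset_refl] h(2) by blast
  ultimately have "v \<subseteq> v'" "v' \<subseteq> v"
    using exact_support_subset[OF w v n(1)] exact_support_subset[OF w v(2,1) n(2)] eq by auto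
  then have "v = v'" by blast
  moreover have "n \<in> univ M" "n' \<in> univ M" using h cl_univ by blast+
  ultimately show ?thesis using inj_onD[OF transport_inj[OF w v(1)]] eq by blast
qed

section \<open>Names for the new elements\<close>

text \<open>The index set is kept in the name, because the realizations chosen for different index
  sets are unrelated and the sets \<open>exact v\<close> may overlap by accident. Entries of the
  tuples are left out, as they already have variables.\<close>

definition names :: "(nat set \<times> 'a) set" where
  "names = (SIGMA v:W. exact v - rl v ` x v)"

definition name_var :: "nat set \<times> 'a \<Rightarrow> 'v" where
  "name_var = (SOME \<eta>. inj_on \<eta> names \<and> \<eta> ` names \<inter> (\<Union>w\<in>W. x w) = {})"

text \<open>The names form a finite union of subsets of small closures, hence a small set. Their
  variables avoid all the sets \<open>x w\<close> at once, so that a new variable is not an old one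
  for another index set.\<close>

lemma name_var: "inj_on name_var names" "name_var ` names \<inter> (\<Union>w\<in>W. x w) = {}"
proof -
  have "small \<kappa> (Pair v ` (exact v - rl v ` x v))" if v: "v \<in> W" for v
  proof -
    have "small \<kappa> (cl v v)" unfolding cl_def by (rule small_acl[OF small_params(2)[OF v rl[OF v]]])
    then have "small \<kappa> (exact v - rl v ` x v)" by (rule small_subset) (auto simp: exact_def)
    then show ?thesis by (rule small_image)
  qed
  then have "small \<kappa> (\<Union>v\<in>W. Pair v ` (exact v - rl v ` x v))" by (rule small_UN[OF finite_W])
  moreover have "names = (\<Union>v\<in>W. Pair v ` (exact v - rl v ` x v))" by (auto simp: names_def)
  ultimately have "small \<kappa> names" by simp
  moreover have "small \<kappa> (\<Union>w\<in>W. x w)" using small_x by (rule small_UN[OF finite_W])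
  ultimately have "\<exists>\<eta>. inj_on \<eta> names \<and> \<eta> ` names \<inter> (\<Union>w\<in>W. x w) = {}"
    using ex_inj_fresh by blast
  from someI_ex[OF this]
  show "inj_on name_var names" "name_var ` names \<inter> (\<Union>w\<in>W. x w) = {}"
    unfolding name_var_def by blast+
qed

section \<open>The extended tuples\<close>

definition y :: "nat set \<Rightarrow> 'v set" where
  "y w = x w \<union> name_var ` {vn \<in> names. fst vn \<subseteq> w}"

text \<open>Only the values on \<open>y w\<close> matter. There the index set of a name is contained
  in \<open>w\<close>, and \<open>transport v w\<close> is an automorphism over \<open>C\<close>;
  elsewhere the value is arbitrary.\<close>

definition ext :: "nat set \<Rightarrow> 'v \<Rightarrow> 'a" where
  "ext w z = (if z \<in> x w then rl w z else (case inv_into names name_var z of (v, n) \<Rightarrow> transport v w n))"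

definition s :: "nat set \<Rightarrow> ('f, 'r, 'v, 'a) fm set" where
  "s w = tp L M C (y w) (ext w)"

lemma ext_x: "z \<in> x w \<Longrightarrow> ext w z = rl w z"
  by (simp add: ext_def)

lemma name_var_notin_x: "vn \<in> names \<Longrightarrow> w \<in> W \<Longrightarrow> name_var vn \<notin> x w"
  using name_var(2) by blast

lemma ext_name: "w \<in> W \<Longrightarrow> (v, n) \<in> names \<Longrightarrow> ext w (name_var (v, n)) = transport v w n"
  using name_var_notin_x[of "(v, n)" w] inv_into_f_f[OF name_var(1), of "(v, n)"] by (simp add: ext_def)

lemma y_cases:
  assumes "z \<in> y w"
  obtains (old) "z \<in> x w"
    | (new) v n where "(v, n) \<in> names" "v \<subseteq> w" "z = name_var (v, n)"
  using assms unfolding y_def by auto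

lemma x_subset_y: "x w \<subseteq> y w"
  by (simp add: y_def)

lemma name_in_y: "(v, n) \<in> names \<Longrightarrow> v \<subseteq> w \<Longrightarrow> name_var (v, n) \<in> y w"
  by (force simp: y_def)

lemma namesD: "(v, n) \<in> names \<Longrightarrow> v \<in> W \<and> n \<in> exact v \<and> n \<notin> rl v ` x v"
  by (simp add: names_def)

lemma y_mono: "w \<in> W \<Longrightarrow> v \<subseteq> w \<Longrightarrow> y v \<subseteq> y w"
  unfolding y_def by (intro Un_mono image_mono x_mono) auto

text \<open>A new variable determines its index set and lies in \<open>y w\<close> exactly when that
  set is contained in \<open>w\<close>, so containment in both \<open>v\<close> and \<open>w\<close>
  is containment in the intersection. Mixed cases cannot occur, as new variables avoid all old
  ones.\<close>

lemma y_inter: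
  assumes v: "v \<in> W" and w: "w \<in> W"
  shows "y v \<inter> y w = y (v \<inter> w)"
proof
  show "y (v \<inter> w) \<subseteq> y v \<inter> y w" using y_mono[OF v, of "v \<inter> w"] y_mono[OF w, of "v \<inter> w"] by simp
  show "y v \<inter> y w \<subseteq> y (v \<inter> w)"
  proof
    fix z assume z: "z \<in> y v \<inter> y w"
    then have "z \<in> y v" by simp
    then show "z \<in> y (v \<inter> w)"
    proof (cases rule: y_cases)
      case old
      have "z \<in> y w" using z by simp
      then show ?thesis
      proof (cases rule: y_cases)
        case old': old
        then show ?thesis using old x_inter[OF v w] x_subset_y by blast
      next
        case (new u n)
        then show ?thesis using name_var_notin_x[OF new(1) v] old by simp
      qed
    next
      case (new u n)
      have "z \<in> y w" using z by simp
      then show ?thesis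
      proof (cases rule: y_cases)
        case old
        then show ?thesis using name_var_notin_x[OF new(1) w] new(3) by simp
      next
        case new': (new u' n')
        then have "(u', n') = (u, n)" using inj_onD[OF name_var(1)] new by metis
        then show ?thesis using new new' by (auto intro: name_in_y)
      qed
    qed
  qed
qed

text \<open>For a name with index set \<open>u\<close> this is the composition of the transports
  from \<open>u\<close> to \<open>v\<close> and from \<open>v\<close> to \<open>w\<close>; coherence
  is available there because the named element lies in \<open>cl u u\<close>.\<close>

lemma ext_compat:
  assumes w: "w \<in> W" and vw: "v \<subseteq> w" and z: "z \<in> y v"
  shows "ext w z = transport v w (ext v z)"
proof -
  have v: "v \<in> W" using W_subset w vw by blast
  show ?thesis using z
  proof (cases rule: y_cases)
    case old
    then have "z \<in> x w" using x_mono[OF w vw] by blast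
    then show ?thesis using old transport_rl[OF w vw] by (simp add: ext_x)
  next
    case (new u n)
    have "n \<in> cl u u" using namesD[OF new(1)] by (simp add: exact_def)
    then show ?thesis using new(3) ext_name[OF w new(1)] ext_name[OF v new(1)]
      transport_comp[OF w vw new(2)] by simp
  qed
qed

text \<open>Every element of the closure is transported from some \<open>exact v\<close>; its source
  there is either an entry of a_v, which has an old variable, or the element of a name.\<close>

lemma ext_image:
  assumes w: "w \<in> W"
  shows "ext w ` y w = cl w w"
proof
  show "ext w ` y w \<subseteq> cl w w"
  proof clarify
    fix z assume "z \<in> y w"
    then show "ext w z \<in> cl w w"
    proof (cases rule: y_cases)
      case old
      then have "rl w z \<in> C \<union> rl w ` x w" by blast
      then have "rl w z \<in> cl w w"
        unfolding cl_def by (rule subsetD[OF subset_acl[OF small_params(1)[OF w rl[OF w]]]])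
      then show ?thesis using old by (simp add: ext_x)
    next
      case (new v n)
      have "n \<in> cl v v" using namesD[OF new(1)] by (simp add: exact_def)
      then have "transport v w n \<in> cl w v" using transport_cl[OF w new(2) subset_refl] by blast
      then show ?thesis
        using cl_mono[OF w subset_refl new(2)] new(3) ext_name[OF w new(1)] by auto
    qed
  qed
  show "cl w w \<subseteq> ext w ` y w"
  proof
    fix e assume "e \<in> cl w w"
    then obtain v n where vn: "v \<subseteq> w" "n \<in> exact v" "e = transport v w n"
      by (rule cl_support[OF w]) (rule that)
    have v: "v \<in> W" using W_subset w vn(1) by blast
    show "e \<in> ext w ` y w"
    proof (cases "n \<in> rl v ` x v")
      case True
      then obtain u where u: "u \<in> x v" "n = rl v u" by blast
      then have "u \<in> x w" using x_mono[OF w vn(1)] by blast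
      moreover have "e = rl w u" using transport_rl[OF w vn(1) u(1)] u(2) vn(3) by simp
      ultimately show ?thesis using x_subset_y ext_x by (metis image_eqI subsetD)
    next
      case False
      then have "(v, n) \<in> names" using v vn(2) by (simp add: names_def)
      then show ?thesis using ext_name[OF w] name_in_y vn by (metis image_eqI)
    qed
  qed
qed

text \<open>Two old variables are separated by the given types, two names by the uniqueness of
  supports. In the mixed case an entry of a_w would be algebraic over C a_v, hence an entry of its
  restriction to \<open>x v\<close>; pulled back along the transport, the named element would be an
  entry of a_v, which \<open>names\<close> excludes.\<close>

lemma ext_inj:
  assumes w: "w \<in> W"
  shows "inj_on (ext w) (y w)"
proof -
  have mixed: False if "u \<in> x w" "(v, n) \<in> names" "v \<subseteq> w" "rl w u = transport v w n" for u v n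
  proof -
    have n: "n \<in> exact v" "n \<notin> rl v ` x v" "v \<in> W" using namesD[OF that(2)] by auto
    have "n \<in> cl v v" using n(1) by (simp add: exact_def)
    then have "transport v w n \<in> cl w v" using transport_cl[OF w that(3) subset_refl] by blast
    then have "rl w u \<in> acl TYPE('v) L M (C \<union> rl w ` x v)" using that(4) by (simp add: cl_def)
    then have "rl w u \<in> acl TYPE('v) L M (C \<union> rl w ` x v) \<inter> rl w ` x w" using that(1) by blast
    then have "rl w u \<in> rl w ` x v" using acl_inter_tuple[OF w rl[OF w] n(3) that(3)] by simp
    then obtain u' where u': "u' \<in> x v" "rl w u = rl w u'" by blast
    then have "transport v w n = transport v w (rl v u')"
      using that(4) transport_rl[OF w that(3)] by simp
    moreover have "n \<in> univ M" "rl v u' \<in> univ M"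
      using subsetD[OF cl_univ \<open>n \<in> cl v v\<close>] rl_univ[OF n(3)] u'(1) by auto
    ultimately have "n = rl v u'" by (rule inj_onD[OF transport_inj[OF w that(3)]])
    then show False using n(2) u'(1) by blast
  qed
  show ?thesis
  proof (rule inj_onI)
    fix z z' assume z: "z \<in> y w" "z' \<in> y w" and eq: "ext w z = ext w z'"
    from z(1) show "z = z'"
    proof (cases rule: y_cases)
      case old
      from z(2) show ?thesis
      proof (cases rule: y_cases)
        case old': old
        then show ?thesis using old eq inj_onD[OF rl_inj[OF w]] by (simp add: ext_x)
      next
        case (new v n)
        then show ?thesis using mixed[OF old new(1,2)] eq old ext_name[OF w new(1)] by (simp add: ext_x)
      qed
    next
      case (new v n)
      from z(2) show ?thesis
      proof (cases rule: y_cases)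
        case old
        then show ?thesis using mixed[OF old new(1,2)] eq new(3) ext_name[OF w new(1)] by (simp add: ext_x)
      next
        case new': (new v' n')
        have "transport v w n = transport v' w n'"
          using eq new(3) new'(3) ext_name[OF w new(1)] ext_name[OF w new'(1)] by simp
        then have "v = v' \<and> n = n'"
          using exact_unique[OF w new(2) new'(2)] namesD[OF new(1)] namesD[OF new'(1)] by blast
        then show ?thesis using new(3) new'(3) by simp
      qed
    qed
  qed
qed

lemma ext_univ: "w \<in> W \<Longrightarrow> ext w ` y w \<subseteq> univ M"
  using ext_image cl_univ by simp

lemma small_y:
  assumes w: "w \<in> W"
  shows "small \<kappa> (y w)"
proof -
  have "small \<kappa> (ext w ` y w)"
    unfolding ext_image[OF w] cl_def by (rule small_acl[OF small_params(2)[OF w rl[OF w]]])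
  from small_image[OF this, of "inv_into (y w) (ext w)"]
  show ?thesis by (simp add: inv_into_image_cancel[OF ext_inj[OF w]])
qed

section \<open>The extended types and their realizations\<close>

lemma s_restrict_x:
  assumes w: "w \<in> W"
  shows "type_restrict (s w) (x w) = q w"
proof -
  have "type_restrict (s w) (x w) = tp L M C (x w) (ext w)"
    unfolding s_def by (rule type_restrict_tp[OF x_subset_y])
  also have "\<dots> = tp L M C (x w) (rl w)" by (rule tp_cong) (rule ext_x)
  finally show ?thesis using q_eq_tp[OF w] by simp
qed

text \<open>On \<open>y v\<close> the tuple \<open>ext w\<close> is the image of
  \<open>ext v\<close> under an automorphism over \<open>C\<close>, so both have the same type over
  \<open>C\<close>.\<close>

lemma s_restrict_y:
  assumes w: "w \<in> W" and vw: "v \<subseteq> w"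
  shows "type_restrict (s w) (y v) = s v"
proof -
  have v: "v \<in> W" using W_subset w vw by blast
  note g = transport[OF w vw]
  have "type_restrict (s w) (y v) = tp L M C (y v) (ext w)"
    unfolding s_def by (rule type_restrict_tp[OF y_mono[OF w vw]])
  also have "\<dots> = tp L M C (y v) (\<lambda>z. transport v w (ext v z))"
    by (rule tp_cong) (rule ext_compat[OF w vw])
  also have "\<dots> = tp L M C (y v) (ext v)"
  proof -
    have "sat M (\<lambda>z. transport v w (ext v z)) \<phi> \<longleftrightarrow> sat M (ext v) \<phi>"
      if \<phi>: "\<phi> \<in> Form L C (y v)" for \<phi>
    proof -
      have "map_fm id (transport v w) \<phi> = \<phi>"
        using FormD(2)[OF \<phi>] fixerD(2)[OF g] by (intro map_fm_fixed) auto
      moreover have "pars \<phi> \<subseteq> univ M" using FormD(2)[OF \<phi>] C(1) by blast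
      moreover have "\<forall>z\<in>fv \<phi>. ext v z \<in> univ M" using FormD(3)[OF \<phi>] ext_univ[OF v] by auto
      ultimately show ?thesis
        using automorphism_sat[OF M_struct fixerD(1)[OF g] FormD(1)[OF \<phi>], of "ext v"] by simp
    qed
    then show ?thesis unfolding tp_def by auto
  qed
  finally show ?thesis by (simp add: s_def)
qed

lemma realizes_x:
  assumes w: "w \<in> W" and c: "realizes M (y w) (s w) c"
  shows "realizes M (x w) (q w) c"
proof -
  have "q w \<subseteq> s w" using s_restrict_x[OF w] by (auto simp: type_restrict_def)
  then show ?thesis using c x_subset_y[of w] unfolding realizes_def by blast
qed

text \<open>Any realization is conjugate over \<open>C\<close> to \<open>ext w\<close>, and
  automorphisms commute with algebraic closure. The statement covers all
  \<open>v \<subseteq> w\<close> because independence needs it at singletons inside a realization of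
  the type for \<open>w\<close>.\<close>

lemma realization_image:
  assumes w: "w \<in> W" and vw: "v \<subseteq> w" and c: "realizes M (y w) (s w) c"
  shows "c ` y v = acl TYPE('v) L M (C \<union> c ` x v)"
proof -
  have v: "v \<in> W" using W_subset w vw by blast
  obtain h where h: "automorphism L M h" "\<And>a. a \<in> C \<Longrightarrow> h a = a" "\<And>u. u \<in> y w \<Longrightarrow> h (ext w u) = c u"
    by (rule conjugate_realizations[OF C small_y[OF w] ext_univ[OF w] c[unfolded s_def]]) (rule that)
  have yv: "y v \<subseteq> y w" by (rule y_mono[OF w vw])
  have "ext w ` y v = transport v w ` ext v ` y v"
    unfolding image_image using ext_compat[OF w vw] by (intro image_cong) auto
  also have "\<dots> = cl w v"
    using ext_image[OF v] transport_cl[OF w vw subset_refl] by simp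
  finally have ew: "ext w ` y v = cl w v" .
  have "c ` y v = h ` ext w ` y v"
    unfolding image_image using h(3) yv by (intro image_cong) auto
  also have "\<dots> = acl TYPE('v) L M (h ` (C \<union> rl w ` x v))"
  proof -
    have "C \<union> rl w ` x v \<subseteq> univ M" using C(1) rl_univ[OF w] x_mono[OF w vw] by blast
    then show ?thesis unfolding ew cl_def by (rule automorphism_acl[OF h(1)])
  qed
  also have "h ` (C \<union> rl w ` x v) = C \<union> c ` x v"
  proof -
    have "h ` C = C" using h(2) by simp
    moreover have "h (rl w u) = c u" if "u \<in> x v" for u
    proof -
      have "u \<in> x w" using that x_mono[OF w vw] by blast
      then show ?thesis using h(3)[of u] x_subset_y[of w] ext_x[of u w] by auto
    qed
    then have "h ` rl w ` x v = c ` x v" unfolding image_image by (intro image_cong) auto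
    ultimately show ?thesis by (simp add: image_Un)
  qed
  finally show ?thesis .
qed

text \<open>On \<open>y {j}\<close> a realization enumerates the definable closure of
  \<open>C\<close> and its restriction to \<open>x {j}\<close>. The independence of the old parts is
  therefore extended first on the parameter side, then on the side of the tuple.\<close>

lemma realization_indep:
  assumes w: "w \<in> W" and c: "realizes M (y w) (s w) c"
  shows "indep_family L M C w (\<lambda>i. y {i}) c"
  unfolding indep_family_def
proof
  fix i assume i: "i \<in> w"
  have cx: "realizes M (x w) (q w) c" by (rule realizes_x[OF w c])
  have dcl: "c ` y {j} = dcl TYPE('v) L M (C \<union> c ` x {j})" if "j \<in> w" for j
  proof -
    have jw: "{j} \<subseteq> w" using that by simp
    show ?thesis
      using realization_image[OF w jw c] acl_dcl[OF W_subset[OF w jw] realizes_subset[OF w jw cx]] by simp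
  qed
  let ?B = "\<Union>j \<in> w - {i}. c ` x {j}"
  have "indep L M C (x {i}) c ?B" using q_indep[OF w cx] i by (simp add: indep_family_def)
  moreover have "(\<Union>j \<in> w - {i}. c ` y {j}) \<subseteq> dcl TYPE('v) L M (C \<union> ?B)"
  proof (rule UN_least)
    fix j assume j: "j \<in> w - {i}"
    then have "C \<union> c ` x {j} \<subseteq> C \<union> ?B" by blast
    then show "c ` y {j} \<subseteq> dcl TYPE('v) L M (C \<union> ?B)" using dcl[of j] j by (simp add: dcl_mono)
  qed
  ultimately have "indep L M C (x {i}) c (\<Union>j \<in> w - {i}. c ` y {j})" by (rule indep_dcl_right)
  then show "indep L M C (y {i}) c (\<Union>j \<in> w - {i}. c ` y {j})"
    by (rule indep_dcl_left[OF _ C(1) x_subset_y]) (simp add: dcl[OF i])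
qed

lemma realization_closed:
  assumes w: "w \<in> W" and c: "realizes M (y w) (s w) c"
  shows "c ` y w = acl TYPE('v) L M (C \<union> (\<Union>i \<in> w. c ` y {i}))"
proof
  have cx: "realizes M (x w) (q w) c" by (rule realizes_x[OF w c])
  have im: "c ` y w = acl TYPE('v) L M (C \<union> c ` x w)" by (rule realization_image[OF w subset_refl c])
  have "C \<union> (\<Union>i \<in> w. c ` x {i}) \<subseteq> C \<union> (\<Union>i \<in> w. c ` y {i})" using x_subset_y by blast
  then show "c ` y w \<subseteq> acl TYPE('v) L M (C \<union> (\<Union>i \<in> w. c ` y {i}))"
    unfolding im acl_tuple_eq[OF w cx] by (rule acl_mono)
  have "y {i} \<subseteq> y w" if "i \<in> w" for i using that by (intro y_mono[OF w]) simp
  then have "(\<Union>i \<in> w. c ` y {i}) \<subseteq> c ` y w" by blast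
  then have "C \<union> (\<Union>i \<in> w. c ` y {i}) \<subseteq> acl TYPE('v) L M (C \<union> c ` x w)"
    using subset_acl[OF small_params(1)[OF w cx], of "TYPE('v)" L] im by blast
  then show "acl TYPE('v) L M (C \<union> (\<Union>i \<in> w. c ` y {i})) \<subseteq> c ` y w"
    unfolding im by (rule acl_least[OF small_params[OF w cx]])
qed

lemma alg_closed_s: "alg_closed_system L \<kappa> M C W y s"
proof -
  have "complete_type L M C (y w) (s w)" if "w \<in> W" for w
    unfolding s_def by (rule complete_type_tp[OF ext_univ[OF that] univ_nonempty])
  moreover have "Neg (Eq (Var u) (Var z)) \<in> s w" if "w \<in> W" "u \<in> y w" "z \<in> y w" "u \<noteq> z" for w u z
  proof -
    have "ext w u \<noteq> ext w z" using inj_onD[OF ext_inj[OF that(1)] _ that(2,3)] that(4) by blast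
    then show ?thesis using that(2,3) by (simp add: s_def tp_def Form_def)
  qed
  moreover have "c ` y w \<subseteq> acl TYPE('v) L M (C \<union> (\<Union>i \<in> w. c ` y {i}))"
    if "w \<in> W" "realizes M (y w) (s w) c" for w c using realization_closed[OF that] by simp
  ultimately have "amalg_conditions L \<kappa> M C W y s"
    unfolding amalg_conditions_def
    using small_y y_inter s_restrict_y realization_indep by (simp add: W_singletons)
  then show ?thesis
    unfolding alg_closed_system_def amalgamation_system_def
    using finite_W W_subset realization_closed by simp
qed

section \<open>Restricting completions\<close>

lemma completion_restrict:
  assumes "completion L \<kappa> M C W y s t yt st"
  shows "\<exists>xt. xt \<subseteq> yt \<and> completion L \<kappa> M C W x q t xt (type_restrict st xt)"
proof -
  have Wt: "w \<subseteq> t" if "w \<in> W" for w using assms that by (simp add: completion_def)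
  obtain y' s' where ys': "\<forall>w\<in>W. y' w = y w \<and> s' w = s w" "y' t = yt" "s' t = st"
    and cond: "amalg_conditions L \<kappa> M C (insert t W) y' s'"
    using assms unfolding completion_def by (elim conjE exE) (rule that)
  have y': "w \<in> W \<Longrightarrow> y' w = y w" "y' t = yt" and s': "w \<in> W \<Longrightarrow> s' w = s w" "s' t = st" for w
    using ys' by simp_all
  \<comment> \<open>For a variable of some \<open>x w\<close>, algebraicity over the singleton parts
    is inherited from \<open>q w\<close>; other variables of \<open>yt\<close> offer no such
    guarantee over the old parts.\<close>
  define xt where "xt = (\<Union>w\<in>W. x w)"
  define x' where "x' = x(t := xt)"
  define q' where "q' = q(t := type_restrict st xt)"
  have small_yt: "small \<kappa> yt" and complete_st: "complete_type L M C yt st"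
    using cond y'(2) s'(2) unfolding amalg_conditions_def by auto
  have st_distinct: "Neg (Eq (Var u) (Var z)) \<in> st" if "u \<in> yt" "z \<in> yt" "u \<noteq> z" for u z
    using cond that y'(2) s'(2) unfolding amalg_conditions_def by auto
  have yw: "y w \<subseteq> yt" and sw: "type_restrict st (y w) = s w" if w: "w \<in> W" for w
  proof -
    have "y' w \<inter> y' t = y' (w \<inter> t)" using cond w unfolding amalg_conditions_def by auto
    moreover have "w \<inter> t = w" using Wt[OF w] by blast
    ultimately show "y w \<subseteq> yt" using y' w by auto
    have "type_restrict (s' t) (y' w) = s' w"
      using cond w Wt[OF w] unfolding amalg_conditions_def by auto
    then show "type_restrict st (y w) = s w" using y'(1)[OF w] s' w by simp
  qed
  have xw: "x w \<subseteq> xt" if "w \<in> W" for w using that by (auto simp: xt_def)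
  have xt_yt: "xt \<subseteq> yt" using yw x_subset_y by (auto simp: xt_def)
  have st_x: "type_restrict st (x w) = q w" if w: "w \<in> W" for w
  proof -
    have "type_restrict st (x w) = type_restrict (type_restrict st (y w)) (x w)"
      by (rule type_restrict_twice[OF x_subset_y, symmetric])
    then show ?thesis using sw[OF w] s_restrict_x[OF w] by simp
  qed
  \<comment> \<open>If \<open>t\<close> belongs to \<open>W\<close>, it contains all other members,
    so the union adds nothing and the modified family still extends the given one.\<close>
  have x't: "xt = x t" if "t \<in> W" using x_mono[OF that Wt] xw[OF that] by (auto simp: xt_def)
  have x'W: "x' w = x w" "q' w = q w" if "w \<in> W" for w
    using that x't st_x by (auto simp: x'_def q'_def)
  have x'q't: "x' t = xt" "q' t = type_restrict st xt" by (simp_all add: x'_def q'_def)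
  have real_t: "indep_family L M C {i \<in> t. {i} \<in> insert t W} (\<lambda>i. x' {i}) b \<and>
      b ` xt \<subseteq> acl TYPE('v) L M (C \<union> (\<Union>i \<in> {i \<in> t. {i} \<in> insert t W}. b ` x' {i}))"
    if b: "realizes M xt (type_restrict st xt) b" for b
  proof
    \<comment> \<open>The tuple \<open>b\<close> is known only on \<open>xt\<close>, while
      independence is given for realizations of \<open>st\<close>. Some realization of
      \<open>st\<close> is moved over \<open>C\<close> so that it agrees with \<open>b\<close> on
      \<open>xt\<close>.\<close>
    obtain c where c: "realizes M yt st c" using ex_realization[OF C small_yt complete_st] by blast
    have c_univ: "c ` xt \<subseteq> univ M" using c xt_yt by (auto simp: realizes_def)
    have "type_restrict st xt = tp L M C xt c"
      using complete_type_eq_tp[OF complete_st c] type_restrict_tp[OF xt_yt] by simp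
    then have "realizes M xt (tp L M C xt c) b" using b by simp
    then obtain h where h: "automorphism L M h" "\<And>a. a \<in> C \<Longrightarrow> h a = a" "\<And>u. u \<in> xt \<Longrightarrow> h (c u) = b u"
      by (rule conjugate_realizations[OF C small_subset[OF small_yt xt_yt] c_univ]) (rule that)
    define b' where "b' u = h (c u)" for u
    have b': "realizes M yt st b'" unfolding realizes_def
    proof (intro conjI ballI)
      show "b' ` yt \<subseteq> univ M" using c automorphism_in_univ[OF h(1)] by (auto simp: realizes_def b'_def)
      fix \<phi> assume \<phi>: "\<phi> \<in> st"
      then have F: "\<phi> \<in> Form L C yt" using complete_st by (auto simp: complete_type_def)
      have "map_fm id h \<phi> = \<phi>" using FormD(2)[OF F] h(2) by (intro map_fm_fixed) auto
      moreover have "pars \<phi> \<subseteq> univ M" using FormD(2)[OF F] C(1) by blast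
      moreover have "\<forall>z\<in>fv \<phi>. c z \<in> univ M" using FormD(3)[OF F] c by (auto simp: realizes_def)
      ultimately have "sat M b' \<phi> \<longleftrightarrow> sat M c \<phi>"
        using automorphism_sat[OF M_struct h(1) FormD(1)[OF F], of c] by (simp add: b'_def[abs_def])
      then show "sat M b' \<phi>" using c \<phi> by (simp add: realizes_def)
    qed
    let ?I = "{i \<in> t. {i} \<in> insert t W}"
    have "indep_family L M C ?I (\<lambda>i. y' {i}) b'"
      using cond b' y'(2) s'(2) unfolding amalg_conditions_def by auto
    then have ind: "indep L M C (y' {i}) b' (\<Union>j \<in> ?I - {i}. b' ` y' {j})" if "i \<in> ?I" for i
      using that unfolding indep_family_def by blast
    have x'y': "x' {i} \<subseteq> y' {i}" "x' {i} \<subseteq> xt" if "i \<in> ?I" for i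
    proof -
      \<comment> \<open>The second case covers a singleton \<open>t\<close>, whose own variables
        then count as a singleton part.\<close>
      have "{i} \<in> W \<or> {i} = t" using that by auto
      then show "x' {i} \<subseteq> y' {i}" using x'W(1) x'q't(1) y' x_subset_y xt_yt by metis
      show "x' {i} \<subseteq> xt" using \<open>{i} \<in> W \<or> {i} = t\<close> x'W(1) x'q't(1) xw by auto
    qed
    have bb': "b u = b' u" if "u \<in> xt" for u using h(3)[OF that] by (simp add: b'_def)
    show "indep_family L M C ?I (\<lambda>i. x' {i}) b"
      unfolding indep_family_def
    proof
      fix i assume i: "i \<in> ?I"
      have "(\<Union>j \<in> ?I - {i}. b ` x' {j}) \<subseteq> (\<Union>j \<in> ?I - {i}. b' ` y' {j})"
      proof (rule UN_mono[OF subset_refl])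
        fix j assume "j \<in> ?I - {i}"
        then have j: "j \<in> ?I" by blast
        have "b ` x' {j} = b' ` x' {j}" using bb' x'y'(2)[OF j] by (intro image_cong) auto
        then show "b ` x' {j} \<subseteq> b' ` y' {j}" using x'y'(1)[OF j] by auto
      qed
      then have "indep L M C (x' {i}) b' (\<Union>j \<in> ?I - {i}. b ` x' {j})"
        by (rule indep_mono[OF ind[OF i] x'y'(1)[OF i]])
      moreover have "b u = b' u" if "u \<in> x' {i}" for u using that bb' x'y'(2)[OF i] by blast
      ultimately show "indep L M C (x' {i}) b (\<Union>j \<in> ?I - {i}. b ` x' {j})"
        using indep_cong[of "x' {i}" b b'] by blast
    qed
    show "b ` xt \<subseteq> acl TYPE('v) L M (C \<union> (\<Union>i \<in> ?I. b ` x' {i}))"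
    proof clarify
      fix u assume "u \<in> xt"
      then obtain w where w: "w \<in> W" "u \<in> x w" by (auto simp: xt_def)
      \<comment> \<open>The indices of \<open>w\<close> all lie in \<open>t\<close> and their
        singletons in \<open>W\<close>, so algebraicity over the parts for \<open>w\<close> is
        algebraicity over part of the parameters allowed for \<open>t\<close>.\<close>
      have "q w \<subseteq> type_restrict st xt" using st_x[OF w(1)] xw[OF w(1)] by (auto simp: type_restrict_def)
      then have "realizes M (x w) (q w) b" using b xw[OF w(1)] by (auto simp: realizes_def)
      then have "b ` x w \<subseteq> acl TYPE('v) L M (C \<union> (\<Union>i \<in> w. b ` x {i}))" by (rule q_acl[OF w(1)])
      then have "b u \<in> acl TYPE('v) L M (C \<union> (\<Union>i \<in> w. b ` x {i}))" using w(2) by blast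
      moreover have "C \<union> (\<Union>i \<in> w. b ` x {i}) \<subseteq> C \<union> (\<Union>i \<in> ?I. b ` x' {i})"
      proof -
        have "i \<in> ?I" "x {i} = x' {i}" if "i \<in> w" for i
        proof -
          have "{i} \<in> W" using that by (intro W_subset[OF w(1)]) simp
          then show "x {i} = x' {i}" "i \<in> ?I" using x'W(1) Wt[OF w(1)] that by auto
        qed
        then have "(\<Union>i \<in> w. b ` x {i}) \<subseteq> (\<Union>i \<in> ?I. b ` x' {i})" by (intro UN_mono) auto
        then show ?thesis by (rule Un_mono[OF subset_refl])
      qed
      ultimately show "b u \<in> acl TYPE('v) L M (C \<union> (\<Union>i \<in> ?I. b ` x' {i}))"
        by (rule subsetD[OF acl_mono, rotated])
    qed
  qed
  have "amalg_conditions L \<kappa> M C (insert t W) x' q'"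
    unfolding amalg_conditions_def
  proof (intro conjI)
    show "\<forall>w\<in>insert t W. small \<kappa> (x' w) \<and> complete_type L M C (x' w) (q' w)"
      using x'W x'q't small_x complete_q small_subset[OF small_yt xt_yt]
        complete_type_restrict[OF complete_st xt_yt] by simp
    have "Neg (Eq (Var u) (Var z)) \<in> type_restrict st xt" if "u \<in> xt" "z \<in> xt" "u \<noteq> z" for u z
      using st_distinct[of u z] that xt_yt by (auto simp: type_restrict_def)
    then show "\<forall>w\<in>insert t W. \<forall>u\<in>x' w. \<forall>z\<in>x' w. u \<noteq> z \<longrightarrow> Neg (Eq (Var u) (Var z)) \<in> q' w"
      using x'W x'q't q_distinct by simp
    show "\<forall>v\<in>insert t W. \<forall>w\<in>insert t W. x' v \<inter> x' w = x' (v \<inter> w)"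
    proof (intro ballI)
      fix v w assume "v \<in> insert t W" "w \<in> insert t W"
      then consider "v \<in> W" "w \<in> W" | "v = t" "w \<in> W" | "v \<in> W" "w = t" | "v = t" "w = t" by auto
      then show "x' v \<inter> x' w = x' (v \<inter> w)"
      proof cases
        case 1
        moreover have "v \<inter> w \<in> W" using W_subset[OF 1(1)] by blast
        ultimately show ?thesis using x'W x_inter by simp
      next
        case 2
        then have "v \<inter> w = w" using Wt by blast
        then show ?thesis using 2 x'W x'q't xw[OF 2(2)] by auto
      next
        case 3
        then have "v \<inter> w = v" using Wt by blast
        then show ?thesis using 3 x'W x'q't xw[OF 3(1)] by auto
      qed simp
    qed
    have restrict_t: "type_restrict (q' t) (x' v) = q' v" if "v \<in> insert t W" for v
    proof (cases "v = t")
      case True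
      then show ?thesis using x'q't type_restrict_twice[OF subset_refl] by simp
    next
      case False
      then have v: "v \<in> W" using that by simp
      show ?thesis
        using type_restrict_twice[OF xw[OF v], of st] by (simp only: x'q't x'W[OF v] st_x[OF v])
    qed
    show "\<forall>v\<in>insert t W. \<forall>w\<in>insert t W. v \<subseteq> w \<longrightarrow> type_restrict (q' w) (x' v) = q' v"
    proof (intro ballI impI)
      fix v w assume vw: "v \<in> insert t W" "w \<in> insert t W" "v \<subseteq> w"
      show "type_restrict (q' w) (x' v) = q' v"
      proof (cases "w = t")
        case True
        then show ?thesis using restrict_t[OF vw(1)] by simp
      next
        case False
        then have "w \<in> W" using vw(2) by simp
        moreover have "v \<in> W" using W_subset[OF \<open>w \<in> W\<close> vw(3)] .
        ultimately show ?thesis using x'W q_restrict vw(3) by simp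
      qed
    qed
    show "\<forall>w\<in>insert t W. \<forall>b. realizes M (x' w) (q' w) b \<longrightarrow>
        indep_family L M C {i \<in> w. {i} \<in> insert t W} (\<lambda>i. x' {i}) b \<and>
        b ` x' w \<subseteq> acl TYPE('v) L M (C \<union> (\<Union>i \<in> {i \<in> w. {i} \<in> insert t W}. b ` x' {i}))"
    proof (intro ballI allI impI)
      fix w b assume w: "w \<in> insert t W" and b: "realizes M (x' w) (q' w) b"
      show "indep_family L M C {i \<in> w. {i} \<in> insert t W} (\<lambda>i. x' {i}) b \<and>
        b ` x' w \<subseteq> acl TYPE('v) L M (C \<union> (\<Union>i \<in> {i \<in> w. {i} \<in> insert t W}. b ` x' {i}))"
      proof (cases "w = t")
        case True
        then show ?thesis using real_t[of b] b x'q't by simp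
      next
        case False
        then have wW: "w \<in> W" using w by simp
        have b': "realizes M (x w) (q w) b" using b x'W[OF wW] by simp
        have I: "{i \<in> w. {i} \<in> insert t W} = w" using W_singletons[OF wW] by auto
        have xi: "x' {i} = x {i}" if "i \<in> w" for i
          using that x'W(1)[OF W_subset[OF wW, of "{i}"]] by simp
        have "indep_family L M C w (\<lambda>i. x' {i}) b"
          using q_indep[OF wW b'] xi by (simp add: indep_family_def)
        then show ?thesis unfolding I using q_acl[OF wW b'] xi x'W(1)[OF wW] by simp
      qed
    qed
  qed
  then have "completion L \<kappa> M C W x q t xt (type_restrict st xt)"
    unfolding completion_def using Wt x'W x'q't by (intro conjI exI[of _ x'] exI[of _ q']) simp_all
  then show ?thesis using xt_yt by blast
qed

end

theorem lemma2p11: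
  fixes L :: "('f, 'r) lang"
    and T :: "('f, 'r, 'v, 'a) fm set"
    and \<kappa> :: "'k rel"
    and M :: "('f, 'r, 'a) fo_struct"
    and C :: "'a set"
    and W :: "nat set set"
    and x :: "nat set \<Rightarrow> 'v set"
    and q :: "nat set \<Rightarrow> ('f, 'r, 'v, 'a) fm set"
  assumes "complete_theory L T"
    and "simple_theory L T"
    and "monster_model L T \<kappa> M"
    and "C \<subseteq> univ M" and "small \<kappa> C"
    and "acl TYPE('v) L M C = C"
    and "amalgamation_system L \<kappa> M C W x q"
    and "\<And>w a. w \<in> W \<Longrightarrow> realizes M (x w) (q w) a \<Longrightarrow>
           acl TYPE('v) L M (C \<union> a ` x w) = dcl TYPE('v) L M (C \<union> a ` x w)"
    and "\<And>w a v. w \<in> W \<Longrightarrow> realizes M (x w) (q w) a \<Longrightarrow> v \<in> W \<Longrightarrow> v \<subseteq> w \<Longrightarrow>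
           acl TYPE('v) L M (C \<union> a ` x v) \<inter> a ` x w = a ` x v"
  shows "\<exists>(y :: nat set \<Rightarrow> 'v set) (s :: nat set \<Rightarrow> ('f, 'r, 'v, 'a) fm set).
    alg_closed_system L \<kappa> M C W y s \<and>
    (\<forall>w \<in> W. x w \<subseteq> y w \<and> type_restrict (s w) (x w) = q w \<and>
       (\<forall>b. realizes M (y w) (s w) b \<longrightarrow>
          b ` y w = acl TYPE('v) L M (C \<union> b ` x w))) \<and>
    (\<forall>t yt st. completion L \<kappa> M C W y s t yt st \<longrightarrow>
       (\<exists>xt. xt \<subseteq> yt \<and> completion L \<kappa> M C W x q t xt (type_restrict st xt)))"
proof -
  interpret dcl_amalgamation L T \<kappa> M C W x q
    using assms(3-5,7-9) by unfold_locales
  show ?thesis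
    using alg_closed_s x_subset_y s_restrict_x realization_image[OF _ subset_refl] completion_restrict
    by (intro exI[of _ y] exI[of _ s]) simp
qed

end
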